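(* Assume the setup below, and suppose there are constants $C,\gamma\in(0,\infty)$ such that $\max_{n\in\{0,1\}}a(m,n)\le Ce^{-\gamma|m|}$ for all $m\in\mathbb Z$. Then for $\mu$-almost every $\omega\in\Omega$, $J_\omega$ has pure point spectrum, and every eigenfunction $u$ of $J_\omega$ satisfies, for every $\epsilon\in(0,\gamma)$, an estimate $|u(m)|\le C_{\omega,\epsilon,u}e^{-(\gamma-\epsilon)|m|}$ for all $m\in\mathbb Z$, with a constant $C_{\omega,\epsilon,u}<\infty$.
   Context: Setup: $r:\mathbb R\to[0,\infty)$ is bounded, measurable, compactly supported, with $\int_{\mathbb R} r(x)\,dx=1$. $(d_n)_{n\in\mathbb Z}$ is a fixed sequence of positive reals and $r_n(x)=d_n^{-1}r(d_n^{-1}x)$. $c\in\ell^\infty(\mathbb Z)$ is real. $a\in\ell^\infty(\mathbb Z)$ is real with $a(n)\ge\delta>0$ for all $n$. $\Omega=\mathbb R^{\mathbb Z}$ and $\mu$ is the product probability measure $d\mu(\omega)=\prod_{n} r_n(\omega(n)-c(n))\,d\omega(n)$. $(J_\omega\phi)(n)=a(n)\phi(n+1)+a(n-1)\phi(n-1)+\omega(n)\phi(n)$ on $\ell^2(\mathbb Z)$. For $m,n\in\mathbb Z$, $a(m,n)=\int_\Omega\sup_{t\in\mathbb R}|\langle\delta_m,e^{-itJ_\omega}\delta_n\rangle|\,d\mu(\omega)$. *)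

theory Defs
  imports "HOL-Probability.Probability"
begin

definition in_l2 :: "(int \<Rightarrow> complex) \<Rightarrow> bool" where
  "in_l2 f \<longleftrightarrow> (\<lambda>n. (cmod (f n))^2) summable_on UNIV"

definition l2norm :: "(int \<Rightarrow> complex) \<Rightarrow> real" where
  "l2norm f = sqrt (infsum (\<lambda>n. (cmod (f n))^2) UNIV)"

definition kdelta :: "int \<Rightarrow> int \<Rightarrow> complex" where
  "kdelta n = (\<lambda>m. if m = n then 1 else 0)"

definition jacobi :: "(int \<Rightarrow> real) \<Rightarrow> (int \<Rightarrow> real) \<Rightarrow> (int \<Rightarrow> complex) \<Rightarrow> int \<Rightarrow> complex" where
  "jacobi a \<omega> \<phi> n =
     of_real (a n) * \<phi> (n + 1) + of_real (a (n - 1)) * \<phi> (n - 1) + of_real (\<omega> n) * \<phi> n"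

text \<open>Maximal (= self-adjoint) domain of J_omega.\<close>

definition jdom :: "(int \<Rightarrow> real) \<Rightarrow> (int \<Rightarrow> real) \<Rightarrow> (int \<Rightarrow> complex) set" where
  "jdom a \<omega> = {\<psi>. in_l2 \<psi> \<and> in_l2 (jacobi a \<omega> \<psi>)}"

text \<open>psi(t) = e^{-itJ} psi0 is the unique solution in the domain of J of the Schroedinger
  equation i psi'(t) = J psi(t) (derivative in the \<ell>^2 norm) with psi(0) = psi0 (Stone).\<close>

definition schrod_sol ::
  "(int \<Rightarrow> real) \<Rightarrow> (int \<Rightarrow> real) \<Rightarrow> (int \<Rightarrow> complex) \<Rightarrow> (real \<Rightarrow> int \<Rightarrow> complex) \<Rightarrow> bool" where
  "schrod_sol a \<omega> \<psi>0 \<psi> \<longleftrightarrow>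
     \<psi> 0 = \<psi>0 \<and> (\<forall>t. \<psi> t \<in> jdom a \<omega>) \<and>
     (\<forall>t. ((\<lambda>h. l2norm (\<lambda>m. (\<psi> (t + h) m - \<psi> t m) / of_real h
                              + \<i> * jacobi a \<omega> (\<psi> t) m)) \<longlongrightarrow> 0) (at 0))"

definition unitary_evol ::
  "(int \<Rightarrow> real) \<Rightarrow> (int \<Rightarrow> real) \<Rightarrow> real \<Rightarrow> (int \<Rightarrow> complex) \<Rightarrow> int \<Rightarrow> complex" where
  "unitary_evol a \<omega> t \<psi>0 = (THE \<psi>. schrod_sol a \<omega> \<psi>0 \<psi>) t"

definition matrix_elem :: "(int \<Rightarrow> real) \<Rightarrow> (int \<Rightarrow> real) \<Rightarrow> int \<Rightarrow> int \<Rightarrow> real \<Rightarrow> complex" where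
  "matrix_elem a \<omega> m n t = unitary_evol a \<omega> t (kdelta n) m"

definition scaled_density :: "(real \<Rightarrow> real) \<Rightarrow> real \<Rightarrow> real \<Rightarrow> real" where
  "scaled_density r dn x = r (x / dn) / dn"

definition mu :: "(real \<Rightarrow> real) \<Rightarrow> (int \<Rightarrow> real) \<Rightarrow> (int \<Rightarrow> real) \<Rightarrow> (int \<Rightarrow> real) measure" where
  "mu r d c = (\<Pi>\<^sub>M n\<in>UNIV. density lborel (\<lambda>x. ennreal (scaled_density r (d n) (x - c n))))"

definition a_corr :: "(real \<Rightarrow> real) \<Rightarrow> (int \<Rightarrow> real) \<Rightarrow> (int \<Rightarrow> real) \<Rightarrow> (int \<Rightarrow> real)
    \<Rightarrow> int \<Rightarrow> int \<Rightarrow> ennreal" where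
  "a_corr r d c a m n =
     (\<integral>\<^sup>+ \<omega>. ennreal (SUP t. cmod (matrix_elem a \<omega> m n t)) \<partial>(mu r d c))"

definition eigenfunction :: "(int \<Rightarrow> real) \<Rightarrow> (int \<Rightarrow> real) \<Rightarrow> (int \<Rightarrow> complex) \<Rightarrow> bool" where
  "eigenfunction a \<omega> u \<longleftrightarrow> in_l2 u \<and> u \<noteq> (\<lambda>_. 0) \<and> (\<exists>E::complex. jacobi a \<omega> u = (\<lambda>m. E * u m))"

definition pure_point :: "(int \<Rightarrow> real) \<Rightarrow> (int \<Rightarrow> real) \<Rightarrow> bool" where
  "pure_point a \<omega> \<longleftrightarrow>
     (\<forall>f. in_l2 f \<longrightarrow> (\<forall>\<epsilon>>0. \<exists>U coef. finite U \<and> (\<forall>u\<in>U. eigenfunction a \<omega> u) \<and>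
         l2norm (\<lambda>m. f m - (\<Sum>u\<in>U. coef u * u m)) < \<epsilon>))"

end

theory Submission
  imports Defs
begin

text \<open>
  Almost surely the bound on the averaged suprema makes the orbits of \<open>e\<^sup>-\<^sup>i\<^sup>t\<^sup>J\<close> started at the
  sites 0 and 1 exponentially localized, uniformly in time.

  If \<open>u\<close> is an eigenfunction with energy \<open>E\<close>, a limit point \<open>v\<close> of the means over \<open>[0, T]\<close> of
  \<open>e\<^sup>i\<^sup>t\<^sup>E e\<^sup>-\<^sup>i\<^sup>t\<^sup>J \<delta>\<^sub>n\<close> is again a solution of \<open>J v = E v\<close>, inherits the exponential bound and
  satisfies \<open>\<langle>u, v\<rangle> = \<langle>u, \<delta>\<^sub>n\<rangle>\<close>. Since \<open>u 0\<close> and \<open>u 1\<close> do not both vanish, \<open>v \<noteq> 0\<close> for one of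
  \<open>n = 0, 1\<close>, and constancy of the Wronskian makes \<open>u\<close> a multiple of \<open>v\<close>.

  For pure point spectrum, a limit point \<open>B\<close> of the time averages of the projections onto
  \<open>e\<^sup>-\<^sup>i\<^sup>t\<^sup>J \<delta>\<^sub>n\<close> is compact, symmetric and commutes with \<open>J\<close>. A positive top eigenspace of \<open>B\<close>
  inside the orthogonal complement of all eigenfunctions would contain an eigenvector of \<open>J\<close>.
  So the quadratic mean of \<open>\<langle>y, e\<^sup>-\<^sup>i\<^sup>t\<^sup>J \<delta>\<^sub>n\<rangle>\<close> vanishes for every \<open>y\<close> in this complement, and
  since the orbit is almost periodic the function itself vanishes. Differentiating in \<open>t\<close>
  propagates this from \<open>n = 0, 1\<close> to all sites, so \<open>y = 0\<close>.

  The lower integral of a non-measurable function says nothing about almost every \<open>\<omega>\<close>, so the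
  suprema must be shown measurable: the evolution is constructed as the limit of the evolutions
  with potential truncated to a box, whose matrix elements are power series in finitely many
  values of \<open>\<omega>\<close>.
\<close>

section \<open>Hilbert spaces\<close>

lemma minimizing_sequence_Cauchy:
  fixes s :: "nat \<Rightarrow> 'a::real_inner"
  assumes "convex S" and s_mem: "\<And>n. s n \<in> S"
    and distance_limit: "(\<lambda>n. norm (x - s n)) \<longlonglongrightarrow> infdist x S"
  shows "Cauchy s"
proof (rule metric_CauchyI)
  let ?d = "infdist x S"
  fix e :: real assume "0 < e"
  have "(\<lambda>n. (norm (x - s n))\<^sup>2) \<longlonglongrightarrow> ?d\<^sup>2" by (intro tendsto_intros distance_limit)
  then have "\<forall>\<^sub>F n in sequentially. (norm (x - s n))\<^sup>2 < ?d\<^sup>2 + e\<^sup>2 / 4"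
    by (rule order_tendstoD(2)) (use \<open>0 < e\<close> in simp)
  then obtain N where N_close: "\<And>n. N \<le> n \<Longrightarrow> (norm (x - s n))\<^sup>2 < ?d\<^sup>2 + e\<^sup>2 / 4"
    by (auto simp: eventually_sequentially)
  have "dist (s m) (s n) < e" if "N \<le> m" "N \<le> n" for m n
  proof -
    let ?c = "(1/2) *\<^sub>R s m + (1/2) *\<^sub>R s n"
    have "?c \<in> S" using \<open>convex S\<close> s_mem by (intro convexD) auto
    then have "?d \<le> norm (x - ?c)" using infdist_le by (fastforce simp: dist_norm)
    then have midpoint: "?d\<^sup>2 \<le> (norm (x - ?c))\<^sup>2" by (simp add: infdist_nonneg power_mono)
    have "(norm (s m - s n))\<^sup>2
        = 2 * (norm (x - s m))\<^sup>2 + 2 * (norm (x - s n))\<^sup>2 - 4 * (norm (x - ?c))\<^sup>2"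
      unfolding power2_norm_eq_inner by (simp add: inner_commute algebra_simps)
    also have "\<dots> < e\<^sup>2" using midpoint N_close[OF that(1)] N_close[OF that(2)] by linarith
    finally show ?thesis using \<open>0 < e\<close> by (simp add: dist_norm power2_less_imp_less)
  qed
  then show "\<exists>N. \<forall>m\<ge>N. \<forall>n\<ge>N. dist (s m) (s n) < e" by blast
qed

lemma closed_convex_nearest_point:
  fixes S :: "'a::{real_inner,banach} set"
  assumes "convex S" "closed S" "S \<noteq> {}"
  obtains y where "y \<in> S" "\<And>z. z \<in> S \<Longrightarrow> dist x y \<le> dist x z"
proof -
  have "\<exists>s\<in>S. norm (x - s) < infdist x S + inverse (real (Suc n))" for n
  proof -
    have "infdist x S < infdist x S + inverse (real (Suc n))" by simp
    then have "\<exists>s\<in>S. dist x s < infdist x S + inverse (real (Suc n))"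
      unfolding infdist_notempty[OF \<open>S \<noteq> {}\<close>] by (subst (asm) cINF_less_iff) (auto simp: \<open>S \<noteq> {}\<close>)
    then show ?thesis by (simp add: dist_norm)
  qed
  then obtain s where s_near: "\<And>n. s n \<in> S"
    "\<And>n. norm (x - s n) < infdist x S + inverse (real (Suc n))"
    by metis
  have distance_limit: "(\<lambda>n. norm (x - s n)) \<longlonglongrightarrow> infdist x S"
  proof (rule tendsto_sandwich[OF _ _ tendsto_const])
    show "\<forall>\<^sub>F n in sequentially. infdist x S \<le> norm (x - s n)"
      using s_near(1) by (auto simp: infdist_le simp flip: dist_norm)
    show "\<forall>\<^sub>F n in sequentially. norm (x - s n) \<le> infdist x S + inverse (real (Suc n))"
      using s_near(2) by (intro always_eventually allI less_imp_le)
    show "(\<lambda>n. infdist x S + inverse (real (Suc n))) \<longlonglongrightarrow> infdist x S"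
      using tendsto_add[OF tendsto_const LIMSEQ_inverse_real_of_nat] by simp
  qed
  obtain y where y_limit: "s \<longlonglongrightarrow> y"
    using minimizing_sequence_Cauchy[OF assms(1) s_near(1) distance_limit]
    by (auto simp: Cauchy_convergent_iff convergent_def)
  have "dist x y = infdist x S"
    unfolding dist_norm by (rule LIMSEQ_unique[OF _ distance_limit]) (intro tendsto_intros y_limit)
  then show ?thesis
    using that[of y] closed_sequentially[OF \<open>closed S\<close> _ y_limit] s_near(1) infdist_le by metis
qed

lemma orthogonal_projection_exists:
  fixes S :: "'a::{real_inner,banach} set"
  assumes "subspace S" "closed S"
  obtains y where "y \<in> S" "x - y \<in> S\<^sup>\<bottom>"
proof -
  have "convex S" "S \<noteq> {}" using assms(1) subspace_imp_convex subspace_0 by blast+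
  then obtain y where y_nearest: "y \<in> S" "\<And>z. z \<in> S \<Longrightarrow> dist x y \<le> dist x z"
    using closed_convex_nearest_point[OF _ assms(2)] by blast
  have obtuse: "(x - y) \<bullet> v \<le> 0" if "v \<in> S" for v
    using any_closest_point_dot[OF \<open>convex S\<close> assms(2) y_nearest(1), of "y + v" x] y_nearest that
      assms(1)
    by (simp add: subspace_add)
  have "v \<bullet> (x - y) = 0" if "v \<in> S" for v
    using obtuse[OF that] obtuse[of "- v"] that assms(1) by (simp add: subspace_neg inner_commute)
  then show ?thesis using that y_nearest(1) by (simp add: orthogonal_comp_def orthogonal_def)
qed

lemma subspace_closure:
  fixes S :: "'a::real_normed_vector set"
  assumes "subspace S"
  shows "subspace (closure S)"
proof (rule subspaceI)
  show "0 \<in> closure S" using closure_subset subspace_0[OF assms] by blast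
next
  fix x y assume "x \<in> closure S" "y \<in> closure S"
  then obtain f g where "\<And>n. f n \<in> S" "f \<longlonglongrightarrow> x" "\<And>n. g n \<in> S" "g \<longlonglongrightarrow> y"
    unfolding closure_sequential by blast
  then show "x + y \<in> closure S"
    unfolding closure_sequential
    by (intro exI[of _ "\<lambda>n. f n + g n"]) (auto intro: tendsto_add subspace_add[OF assms])
next
  fix c x assume "x \<in> closure S"
  then obtain f where "\<And>n. f n \<in> S" "f \<longlonglongrightarrow> x" unfolding closure_sequential by blast
  then show "c *\<^sub>R x \<in> closure S"
    unfolding closure_sequential
    by (intro exI[of _ "\<lambda>n. c *\<^sub>R f n"]) (auto intro: tendsto_scaleR subspace_scale[OF assms])
qed

lemma subspace_dense_if_orthogonal_comp_trivial:
  fixes S :: "'a::{real_inner,banach} set"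
  assumes "subspace S" "S\<^sup>\<bottom> = {0}"
  shows "closure S = UNIV"
proof -
  have "x \<in> closure S" for x
  proof -
    obtain y where "y \<in> closure S" "x - y \<in> (closure S)\<^sup>\<bottom>"
      using orthogonal_projection_exists[OF subspace_closure[OF assms(1)] closed_closure] by blast
    moreover have "(closure S)\<^sup>\<bottom> \<subseteq> S\<^sup>\<bottom>" by (rule orthogonal_comp_anti_mono[OF closure_subset])
    ultimately show ?thesis using assms(2) by auto
  qed
  then show ?thesis by blast
qed

lemma closed_orthogonal_comp: "closed (S\<^sup>\<bottom>)"
proof -
  have "S\<^sup>\<bottom> = (\<Inter>u\<in>S. {y. u \<bullet> y = 0})" by (auto simp: orthogonal_comp_def orthogonal_def)
  moreover have "closed {y. u \<bullet> y = 0}" for u :: 'a by (intro closed_Collect_eq continuous_intros)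
  ultimately show ?thesis by auto
qed

lemma Riesz_representation:
  fixes l :: "'a::{real_inner,banach} \<Rightarrow> real"
  assumes "bounded_linear l"
  obtains v where "\<And>w. l w = w \<bullet> v"
proof (cases "\<forall>w. l w = 0")
  case True
  then show ?thesis using that[of 0] by simp
next
  case False
  then obtain x where "l x \<noteq> 0" by blast
  interpret l: bounded_linear l by fact
  let ?K = "{w. l w = 0}"
  have "subspace ?K" by (auto simp: subspace_def l.zero l.add l.scaleR)
  moreover have "closed ?K" by (intro closed_Collect_eq l.continuous_on continuous_intros)
  ultimately obtain y where y_projection: "l y = 0" "x - y \<in> ?K\<^sup>\<bottom>"
    using orthogonal_projection_exists[of ?K x] by auto
  define z where "z = x - y"
  have "l z \<noteq> 0" using \<open>l x \<noteq> 0\<close> y_projection(1) by (simp add: z_def l.diff)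
  then have "z \<bullet> z \<noteq> 0" by auto
  have "l w = w \<bullet> ((l z / (z \<bullet> z)) *\<^sub>R z)" for w
  proof -
    have "l w *\<^sub>R z - l z *\<^sub>R w \<in> ?K" by (simp add: l.diff l.scaleR)
    then have "(l w *\<^sub>R z - l z *\<^sub>R w) \<bullet> z = 0"
      using y_projection(2) unfolding z_def[symmetric]
      by (simp only: orthogonal_comp_def orthogonal_def) blast
    then show ?thesis using \<open>z \<bullet> z \<noteq> 0\<close> by (simp add: inner_diff_left field_simps)
  qed
  then show ?thesis by (rule that)
qed

subsection \<open>Weak convergence\<close>

definition weakly_tendsto :: "('t \<Rightarrow> 'a::real_inner) \<Rightarrow> 'a \<Rightarrow> 't filter \<Rightarrow> bool" where
  "weakly_tendsto x y F \<longleftrightarrow> (\<forall>w. ((\<lambda>t. w \<bullet> x t) \<longlongrightarrow> w \<bullet> y) F)"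

lemma weakly_tendsto_inner: "weakly_tendsto x y F \<Longrightarrow> ((\<lambda>t. w \<bullet> x t) \<longlongrightarrow> w \<bullet> y) F"
  by (simp add: weakly_tendsto_def)

lemma weakly_tendsto_add:
  "weakly_tendsto x y F \<Longrightarrow> weakly_tendsto x' y' F \<Longrightarrow> weakly_tendsto (\<lambda>t. x t + x' t) (y + y') F"
  unfolding weakly_tendsto_def inner_add_right by (intro allI tendsto_add) auto

lemma weakly_tendsto_diff:
  "weakly_tendsto x y F \<Longrightarrow> weakly_tendsto x' y' F \<Longrightarrow> weakly_tendsto (\<lambda>t. x t - x' t) (y - y') F"
  unfolding weakly_tendsto_def inner_diff_right by (intro allI tendsto_diff) auto

lemma weakly_tendsto_scaleR:
  "(r \<longlongrightarrow> s) F \<Longrightarrow> weakly_tendsto x y F \<Longrightarrow> weakly_tendsto (\<lambda>t. r t *\<^sub>R x t) (s *\<^sub>R y) F"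
  unfolding weakly_tendsto_def inner_scaleR_right by (intro allI tendsto_mult) auto

lemma weakly_tendsto_unique:
  assumes "F \<noteq> bot" "weakly_tendsto x y F" "weakly_tendsto x z F"
  shows "y = z"
proof -
  have "w \<bullet> y = w \<bullet> z" for w using assms by (auto simp: weakly_tendsto_def intro: tendsto_unique)
  then show ?thesis using vector_eq_ldot by blast
qed

lemma weakly_tendsto_norm_le:
  assumes "F \<noteq> bot" and weak_limit: "weakly_tendsto x y F"
    and norm_bound: "\<forall>\<^sub>F t in F. norm (x t) \<le> C"
  shows "norm y \<le> C"
proof -
  have "\<forall>\<^sub>F t in F. y \<bullet> x t \<le> norm y * C"
    using norm_bound
    by eventually_elim (meson mult_left_mono norm_cauchy_schwarz norm_ge_zero order_trans)
  then have "norm y * norm y \<le> norm y * C"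
    using tendsto_upperbound[OF weakly_tendsto_inner[OF weak_limit] _ assms(1), of y]
    by (simp add: norm_eq_sqrt_inner)
  moreover have "0 \<le> C"
    using eventually_happens[OF norm_bound] assms(1) norm_ge_zero order_trans by blast
  ultimately show ?thesis by (cases "y = 0") auto
qed

lemma weakly_tendsto_orthogonal_comp:
  assumes "F \<noteq> bot" "weakly_tendsto x y F" "\<And>t. x t \<in> S\<^sup>\<bottom>"
  shows "y \<in> S\<^sup>\<bottom>"
proof -
  have "u \<bullet> y = 0" if "u \<in> S" for u
  proof (rule tendsto_unique[OF assms(1) weakly_tendsto_inner[OF assms(2)]])
    show "((\<lambda>t. u \<bullet> x t) \<longlongrightarrow> 0) F"
      using assms(3) that by (simp add: orthogonal_comp_def orthogonal_def)
  qed
  then show ?thesis by (simp add: orthogonal_comp_def orthogonal_def)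
qed

lemma inf_filtercomap_neq_bot:
  assumes "inf (filtermap f F) H \<noteq> bot"
  shows "inf F (filtercomap f H) \<noteq> bot"
proof
  assume "inf F (filtercomap f H) = bot"
  then obtain P Q where PQ_disjoint: "eventually P F" "eventually Q (filtercomap f H)"
    "\<And>x. \<not> (P x \<and> Q x)"
    unfolding trivial_limit_def eventually_inf by blast
  then obtain R where R_pulled_back: "eventually R H" "\<And>x. R (f x) \<Longrightarrow> Q x"
    unfolding eventually_filtercomap by blast
  have "\<forall>\<^sub>F y in filtermap f F. \<not> R y"
    unfolding eventually_filtermap using PQ_disjoint(1)
    by eventually_elim (use PQ_disjoint(3) R_pulled_back(2) in blast)
  then have "inf (filtermap f F) H = bot"
    using R_pulled_back(1) unfolding trivial_limit_def eventually_inf by blast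
  then show False using assms by contradiction
qed

lemma pointwise_convergent_subfilter:
  fixes g :: "'t \<Rightarrow> 'i \<Rightarrow> real"
  assumes "F \<noteq> bot" and g_bound: "\<And>t i. \<bar>g t i\<bar> \<le> b i"
  obtains G l where "G \<le> F" "G \<noteq> bot" "\<And>i. ((\<lambda>t. g t i) \<longlongrightarrow> l i) G"
proof -
  let ?box = "Pi\<^sub>E UNIV (\<lambda>i. {- b i..b i})"
  have "compact ?box"
    using compactin_PiE[of "\<lambda>_. euclidean" UNIV "\<lambda>i. {- b i..b i}"]
    by (simp add: euclidean_product_topology)
  moreover have "filtermap g F \<noteq> bot" using assms(1) by (simp add: filtermap_bot_iff)
  moreover have "\<forall>\<^sub>F h in filtermap g F. h \<in> ?box"
    unfolding eventually_filtermap using g_bound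
    by (intro always_eventually) (auto simp: abs_le_iff minus_le_iff)
  ultimately obtain l where l_cluster: "inf (nhds l) (filtermap g F) \<noteq> bot"
    unfolding compact_filter by blast
  let ?G = "inf F (filtercomap g (nhds l))"
  have "(g \<longlongrightarrow> l) ?G" by (rule filterlim_mono[OF filterlim_filtercomap order_refl]) simp
  then have "((\<lambda>t. g t i) \<longlongrightarrow> l i) ?G" for i
    using continuous_on_tendsto_compose[OF continuous_on_product_coordinates[of i]] by fastforce
  moreover have "?G \<noteq> bot"
    using l_cluster by (intro inf_filtercomap_neq_bot) (simp add: inf_commute)
  ultimately show ?thesis using that[of ?G l] by simp
qed

text \<open>Banach--Alaoglu for a whole family at once, so that a single filter serves all parameters.\<close>

lemma weakly_convergent_subfilter_family:
  fixes x :: "'t \<Rightarrow> 'p \<Rightarrow> 'a::{real_inner,banach}"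
  assumes "F \<noteq> bot" and norm_bound: "\<And>t p. norm (x t p) \<le> C p"
  shows "\<exists>G y. G \<le> F \<and> G \<noteq> bot \<and> (\<forall>p. weakly_tendsto (\<lambda>t. x t p) (y p) G \<and> norm (y p) \<le> C p)"
proof -
  have inner_bound: "\<bar>w \<bullet> x t p\<bar> \<le> C p * norm w" for t p w
    using Cauchy_Schwarz_ineq2[of w "x t p"] mult_left_mono[OF norm_bound[of t p], of "norm w"]
    by (simp add: mult.commute)
  obtain G L where G_refines: "G \<le> F" "G \<noteq> bot"
    and pair_limit: "\<And>i. ((\<lambda>t. (\<lambda>(p, w). w \<bullet> x t p) i) \<longlongrightarrow> L i) G"
    by (rule pointwise_convergent_subfilter[OF assms(1),
        of "\<lambda>t (p, w). w \<bullet> x t p" "\<lambda>(p, w). C p * norm w"])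
      (use inner_bound in \<open>auto split: prod.splits\<close>)
  have inner_limit: "((\<lambda>t. w \<bullet> x t p) \<longlongrightarrow> L (p, w)) G" for p w using pair_limit[of "(p, w)"] by simp
  have "bounded_linear (\<lambda>w. L (p, w))" for p
  proof (rule bounded_linear_intro[where K="C p"])
    show "L (p, v + w) = L (p, v) + L (p, w)" for v w
      using tendsto_unique[OF G_refines(2) inner_limit[of "v + w" p]]
        tendsto_add[OF inner_limit[of v p] inner_limit[of w p]]
      by (simp add: inner_add_left)
    show "L (p, r *\<^sub>R w) = r *\<^sub>R L (p, w)" for r w
      using tendsto_unique[OF G_refines(2) inner_limit[of "r *\<^sub>R w" p]]
        tendsto_mult_left[OF inner_limit[of w p], of r] by simp
    show "norm (L (p, w)) \<le> norm w * C p" for w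
      using tendsto_upperbound[OF tendsto_rabs[OF inner_limit[of w p]] always_eventually
          G_refines(2)]
        inner_bound
      by (simp add: mult.commute)
  qed
  then have "\<exists>y. \<forall>w. L (p, w) = w \<bullet> y" for p using Riesz_representation by metis
  then obtain y where "\<And>p w. L (p, w) = w \<bullet> y p" by metis
  then have "weakly_tendsto (\<lambda>t. x t p) (y p) G" for p
    using inner_limit by (simp add: weakly_tendsto_def)
  moreover from this have "norm (y p) \<le> C p" for p
    by (rule weakly_tendsto_norm_le[OF G_refines(2)]) (simp add: norm_bound)
  ultimately show ?thesis using G_refines by blast
qed

lemma weakly_convergent_subfilter:
  fixes x :: "'t \<Rightarrow> 'a::{real_inner,banach}"
  assumes "F \<noteq> bot" "\<And>t. norm (x t) \<le> C"
  obtains G y where "G \<le> F" "G \<noteq> bot" "weakly_tendsto x y G" "norm y \<le> C"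
proof -
  have "\<exists>G (y :: unit \<Rightarrow> 'a). G \<le> F \<and> G \<noteq> bot \<and> (\<forall>p. weakly_tendsto x (y p) G \<and> norm (y p) \<le> C)"
    by (rule weakly_convergent_subfilter_family[OF assms])
  then show ?thesis using that by blast
qed

lemma tendsto_if_convergent_subfilters:
  fixes f :: "'t \<Rightarrow> 'a::topological_space"
  assumes "\<And>F. F \<le> H \<Longrightarrow> F \<noteq> bot \<Longrightarrow> \<exists>G\<le>F. G \<noteq> bot \<and> (f \<longlongrightarrow> l) G"
  shows "(f \<longlongrightarrow> l) H"
proof (rule topological_tendstoI, rule ccontr)
  fix S assume S_open: "open S" "l \<in> S" "\<not> (\<forall>\<^sub>F t in H. f t \<in> S)"
  define F where "F = inf H (principal {t. f t \<notin> S})"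
  have "F \<noteq> bot" "F \<le> H"
    using S_open(3) by (auto simp: F_def trivial_limit_def eventually_inf_principal)
  then obtain G where G_refines: "G \<le> F" "G \<noteq> bot" "(f \<longlongrightarrow> l) G" using assms by blast
  have "\<forall>\<^sub>F t in G. f t \<in> S" using topological_tendstoD[OF G_refines(3)] S_open by blast
  moreover have "\<forall>\<^sub>F t in G. f t \<notin> S"
    by (rule filter_leD[OF G_refines(1)]) (simp add: F_def eventually_inf_principal)
  ultimately have "\<forall>\<^sub>F t in G. False" by eventually_elim simp
  then show False using G_refines(2) by (simp add: trivial_limit_def)
qed

subsection \<open>Eigenvectors of symmetric operators\<close>

lemma linear_if_symmetric:
  fixes T :: "'a::real_inner \<Rightarrow> 'a"
  assumes symmetric: "\<And>x y. x \<bullet> T y = T x \<bullet> y"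
  shows "linear T"
proof (rule linearI)
  show "T (x + y) = T x + T y" for x y
    by (rule iffD1[OF vector_eq_ldot]) (simp add: symmetric inner_add_right)
  show "T (r *\<^sub>R x) = r *\<^sub>R T x" for r x
    by (rule iffD1[OF vector_eq_ldot]) (simp add: symmetric)
qed

lemma nonneg_quadratic_imp_zero:
  fixes p q :: real
  assumes "\<And>s. 0 \<le> 2 * s * p + s\<^sup>2 * q"
  shows "p = 0"
proof -
  define k where "k = \<bar>q\<bar> + 1"
  have "0 < k" "q < 2 * k" by (auto simp: k_def)
  have "2 * (- p / k) * p + (- p / k)\<^sup>2 * q = p\<^sup>2 / k\<^sup>2 * (q - 2 * k)"
    using \<open>0 < k\<close> by (simp add: field_simps power2_eq_square)
  with assms[of "- p / k"] have "0 \<le> p\<^sup>2 / k\<^sup>2 * (q - 2 * k)" by simp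
  then have "p\<^sup>2 / k\<^sup>2 \<le> 0" using \<open>q < 2 * k\<close> by (simp only: zero_le_mult_iff) linarith
  then show ?thesis using \<open>0 < k\<close> by (simp add: divide_le_0_iff)
qed

text \<open>The first variation of the Rayleigh quotient in the direction \<open>\<mu> x - T x\<close>.\<close>

lemma maximizer_is_eigenvector:
  fixes T :: "'a::real_inner \<Rightarrow> 'a"
  assumes subspace: "subspace V" and invariant: "\<And>v. v \<in> V \<Longrightarrow> T v \<in> V"
    and linear: "\<And>v w s. v \<in> V \<Longrightarrow> w \<in> V \<Longrightarrow> T (v + s *\<^sub>R w) = T v + s *\<^sub>R T w"
    and symmetric: "\<And>v w. v \<in> V \<Longrightarrow> w \<in> V \<Longrightarrow> v \<bullet> T w = T v \<bullet> w"
    and rayleigh_le: "\<And>v. v \<in> V \<Longrightarrow> v \<bullet> T v \<le> \<mu> * (v \<bullet> v)"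
    and x_maximal: "x \<in> V" "x \<bullet> T x = \<mu> * (x \<bullet> x)"
  shows "T x = \<mu> *\<^sub>R x"
proof -
  define y where "y = \<mu> *\<^sub>R x - T x"
  have y_mem: "y \<in> V" unfolding y_def
    using subspace x_maximal(1) invariant by (simp add: subspace_diff subspace_scale)
  have "0 \<le> 2 * s * (y \<bullet> y) + s\<^sup>2 * (\<mu> * (y \<bullet> y) - y \<bullet> T y)" for s
  proof -
    have "x + s *\<^sub>R y \<in> V"
      using subspace x_maximal(1) y_mem by (simp add: subspace_add subspace_scale)
    from rayleigh_le[OF this]
    have "0 \<le> \<mu> * ((x + s *\<^sub>R y) \<bullet> (x + s *\<^sub>R y)) - (x + s *\<^sub>R y) \<bullet> T (x + s *\<^sub>R y)" by simp
    also have "\<dots> = (\<mu> * (x \<bullet> x) - x \<bullet> T x) + 2 * s * (\<mu> * (y \<bullet> x) - y \<bullet> T x)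
        + s\<^sup>2 * (\<mu> * (y \<bullet> y) - y \<bullet> T y)"
      unfolding linear[OF x_maximal(1) y_mem] using symmetric[OF x_maximal(1) y_mem]
      by (simp add: inner_commute algebra_simps power2_eq_square)
    also have "\<mu> * (y \<bullet> x) - y \<bullet> T x = y \<bullet> y" by (simp add: y_def inner_diff_right)
    finally show ?thesis using x_maximal(2) by simp
  qed
  then have "y \<bullet> y = 0" by (rule nonneg_quadratic_imp_zero)
  then show ?thesis by (simp add: y_def)
qed

lemma quadratic_form_le_if_le_on_sphere:
  fixes T :: "'a::real_inner \<Rightarrow> 'a"
  assumes subspace: "subspace V" and homogeneous: "\<And>r v. v \<in> V \<Longrightarrow> T (r *\<^sub>R v) = r *\<^sub>R T v"
    and le_on_sphere: "\<And>v. v \<in> V \<Longrightarrow> norm v = 1 \<Longrightarrow> v \<bullet> T v \<le> \<mu>" and "v \<in> V"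
  shows "v \<bullet> T v \<le> \<mu> * (v \<bullet> v)"
proof (cases "v = 0")
  case True
  then show ?thesis by simp
next
  case False
  let ?u = "inverse (norm v) *\<^sub>R v"
  have "?u \<bullet> T ?u \<le> \<mu>" using False \<open>v \<in> V\<close> by (intro le_on_sphere subspace_scale[OF subspace]) auto
  moreover have "?u \<bullet> T ?u = (v \<bullet> T v) / (v \<bullet> v)"
    using False
    by (simp add: homogeneous \<open>v \<in> V\<close> field_simps power2_eq_square flip: power2_norm_eq_inner)
  ultimately show ?thesis using False by (simp add: pos_divide_le_eq)
qed

lemma eigenvector_if_compact_sphere:
  fixes T :: "'a::real_inner \<Rightarrow> 'a"
  assumes subspace: "subspace V" and invariant: "\<And>v. v \<in> V \<Longrightarrow> T v \<in> V"
    and linear: "\<And>v w s. v \<in> V \<Longrightarrow> w \<in> V \<Longrightarrow> T (v + s *\<^sub>R w) = T v + s *\<^sub>R T w"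
    and symmetric: "\<And>v w. v \<in> V \<Longrightarrow> w \<in> V \<Longrightarrow> v \<bullet> T w = T v \<bullet> w"
    and sphere_compact: "compact {v \<in> V. norm v = 1}"
    and T_continuous: "continuous_on {v \<in> V. norm v = 1} T"
    and z_nonzero: "z \<in> V" "z \<noteq> 0"
  obtains x \<mu> where "x \<in> V" "x \<noteq> 0" "T x = \<mu> *\<^sub>R x"
proof -
  let ?S = "{v \<in> V. norm v = 1}"
  have "inverse (norm z) *\<^sub>R z \<in> ?S" using z_nonzero by (simp add: subspace_scale[OF subspace])
  then have "?S \<noteq> {}" by blast
  moreover have "continuous_on ?S (\<lambda>v. v \<bullet> T v)" by (intro continuous_intros T_continuous)
  ultimately obtain x where x_maximal: "x \<in> ?S" "\<And>v. v \<in> ?S \<Longrightarrow> v \<bullet> T v \<le> x \<bullet> T x"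
    using continuous_attains_sup[OF sphere_compact] by blast
  have "T 0 = 0" using linear[OF subspace_0[OF subspace] subspace_0[OF subspace], of "-1"] by simp
  then have homogeneous: "T (r *\<^sub>R v) = r *\<^sub>R T v" if "v \<in> V" for r v
    using linear[OF subspace_0[OF subspace] that, of r] by simp
  have "T x = (x \<bullet> T x) *\<^sub>R x"
  proof (rule maximizer_is_eigenvector[OF subspace invariant linear symmetric])
    show "v \<bullet> T v \<le> (x \<bullet> T x) * (v \<bullet> v)" if "v \<in> V" for v
      using quadratic_form_le_if_le_on_sphere[OF subspace homogeneous _ that] x_maximal(2) by blast
    show "x \<in> V" "x \<bullet> T x = (x \<bullet> T x) * (x \<bullet> x)"
      using x_maximal(1) by (simp_all add: norm_eq_1)
  qed
  then show ?thesis using that[of x] x_maximal(1) by fastforce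
qed

definition completely_continuous :: "('a::real_inner \<Rightarrow> 'b::real_normed_vector) \<Rightarrow> bool" where
  "completely_continuous T \<longleftrightarrow> bounded_linear T \<and>
     (\<forall>F y. weakly_tendsto (\<lambda>x. x) y F \<longrightarrow> (\<forall>\<^sub>F x in F. norm x \<le> 1) \<longrightarrow> (T \<longlongrightarrow> T y) F)"

lemma completely_continuous_tendsto:
  assumes "completely_continuous T" "weakly_tendsto x y F" "\<And>t. norm (x t) \<le> 1"
  shows "((\<lambda>t. T (x t)) \<longlongrightarrow> T y) F"
proof -
  have "weakly_tendsto (\<lambda>v. v) y (filtermap x F)" "\<forall>\<^sub>F v in filtermap x F. norm v \<le> 1"
    using assms(2,3) by (simp_all add: weakly_tendsto_def filterlim_filtermap eventually_filtermap)
  then have "(T \<longlongrightarrow> T y) (filtermap x F)" using assms(1) unfolding completely_continuous_def by blast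
  then show ?thesis by (simp add: filterlim_filtermap)
qed

lemma completely_continuous_inner_tendsto:
  assumes "completely_continuous T" "weakly_tendsto x y F" "\<And>t. norm (x t) \<le> 1"
  shows "((\<lambda>t. x t \<bullet> T (x t)) \<longlongrightarrow> y \<bullet> T y) F"
proof -
  have "((\<lambda>t. T y \<bullet> x t + x t \<bullet> (T (x t) - T y)) \<longlongrightarrow> T y \<bullet> y + 0) F"
  proof (rule tendsto_add[OF weakly_tendsto_inner[OF assms(2)] Lim_null_comparison])
    show "((\<lambda>t. norm (T (x t) - T y)) \<longlongrightarrow> 0) F"
      using completely_continuous_tendsto[OF assms]
      by (simp add: tendsto_norm_zero_iff LIM_zero_iff)
    have "norm (x t \<bullet> (T (x t) - T y)) \<le> norm (T (x t) - T y)" for t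
      using order_trans[OF Cauchy_Schwarz_ineq2 mult_right_mono[OF assms(3)]] by simp
    then show "\<forall>\<^sub>F t in F. norm (x t \<bullet> (T (x t) - T y)) \<le> norm (T (x t) - T y)" by simp
  qed
  then show ?thesis by (simp add: inner_diff_right inner_commute)
qed

lemma bounded_linear_quadratic_form_bounded:
  fixes T :: "'a::real_inner \<Rightarrow> 'a"
  assumes "bounded_linear T"
  shows "\<exists>K. \<forall>x. norm x \<le> 1 \<longrightarrow> x \<bullet> T x \<le> K"
proof -
  obtain K where T_bound: "0 \<le> K" "\<And>x. norm (T x) \<le> norm x * K"
    using bounded_linear.nonneg_bounded[OF assms] by blast
  have "x \<bullet> T x \<le> K" if "norm x \<le> 1" for x
  proof -
    have "x \<bullet> T x \<le> norm x * norm (T x)" by (rule norm_cauchy_schwarz)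
    also have "\<dots> \<le> 1 * (1 * K)"
      using that T_bound(1) order_trans[OF T_bound(2) mult_right_mono[OF that T_bound(1)]]
      by (intro mult_mono) auto
    finally show ?thesis by simp
  qed
  then show ?thesis by blast
qed

lemma completely_continuous_attains_sup:
  fixes T :: "'a::{real_inner,banach} \<Rightarrow> 'a"
  assumes T_completely_continuous: "completely_continuous T"
  obtains z where "z \<in> S\<^sup>\<bottom>" "norm z \<le> 1" "\<And>x. x \<in> S\<^sup>\<bottom> \<Longrightarrow> norm x \<le> 1 \<Longrightarrow> x \<bullet> T x \<le> z \<bullet> T z"
proof -
  define Q where "Q = (\<lambda>x. x \<bullet> T x) ` {x \<in> S\<^sup>\<bottom>. norm x \<le> 1}"
  have "bounded_linear T" using T_completely_continuous by (simp add: completely_continuous_def)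
  then obtain K where "\<And>x. norm x \<le> 1 \<Longrightarrow> x \<bullet> T x \<le> K"
    using bounded_linear_quadratic_form_bounded by blast
  then have Q_bounded: "bdd_above Q" unfolding Q_def by (intro bdd_aboveI2) auto
  have "0 \<in> Q" using subspace_0[OF subspace_orthogonal_comp] by (force simp: Q_def)
  then have "\<exists>q\<in>Q. Sup Q - 1 / real (Suc j) < q" for j using Q_bounded by (intro less_cSupD) auto
  then have "\<exists>x. x \<in> S\<^sup>\<bottom> \<and> norm x \<le> 1 \<and> Sup Q - 1 / real (Suc j) < x \<bullet> T x" for j
    by (auto simp: Q_def)
  then obtain x where x_maximizing: "\<And>j. x j \<in> S\<^sup>\<bottom>" "\<And>j. norm (x j) \<le> 1"
    "\<And>j. Sup Q - 1 / real (Suc j) < x j \<bullet> T (x j)"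
    by metis
  obtain F z where F_cluster: "F \<le> sequentially" "F \<noteq> bot" "weakly_tendsto x z F"
    and norm_z: "norm z \<le> 1"
    by (rule weakly_convergent_subfilter[OF sequentially_bot x_maximizing(2)])
  have "((\<lambda>j. Sup Q - 1 / real (Suc j)) \<longlongrightarrow> Sup Q - 0) F"
    using tendsto_mono[OF F_cluster(1) LIMSEQ_inverse_real_of_nat]
    by (intro tendsto_intros) (simp add: inverse_eq_divide)
  then have "Sup Q - 0 \<le> z \<bullet> T z"
    using x_maximizing(3) completely_continuous_inner_tendsto[OF T_completely_continuous
        F_cluster(3) x_maximizing(2)]
    by (intro tendsto_le[OF F_cluster(2)]) (auto intro!: always_eventually less_imp_le)
  moreover have "v \<bullet> T v \<le> Sup Q" if "v \<in> S\<^sup>\<bottom>" "norm v \<le> 1" for v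
    using that Q_bounded by (intro cSup_upper) (auto simp: Q_def)
  ultimately show ?thesis
    using that[of z] norm_z weakly_tendsto_orthogonal_comp[OF F_cluster(2,3) x_maximizing(1)]
    by force
qed

lemma completely_continuous_eigensphere_compact:
  fixes T :: "'a::{real_inner,banach} \<Rightarrow> 'a"
  assumes T_completely_continuous: "completely_continuous T" and "\<mu> \<noteq> 0" and "closed S"
  shows "compact {x \<in> S. T x = \<mu> *\<^sub>R x \<and> norm x = 1}" (is "compact ?S")
  unfolding compact_filter
proof (intro allI impI)
  interpret T: bounded_linear T
    using T_completely_continuous by (simp add: completely_continuous_def)
  have "closed ?S"
    using \<open>closed S\<close>
    by (intro closed_Collect_conj closed_Collect_eq continuous_intros T.continuous_on) simp
  fix F :: "'a filter" assume F_sphere: "F \<noteq> bot" "\<forall>\<^sub>F x in F. x \<in> ?S"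
  define clip where "clip x = (if norm x \<le> 1 then x else 0)" for x :: 'a
  have norm_clip: "norm (clip x) \<le> 1" for x by (simp add: clip_def)
  obtain G y where G_cluster: "G \<le> F" "G \<noteq> bot" "weakly_tendsto clip y G"
    by (rule weakly_convergent_subfilter[OF F_sphere(1) norm_clip])
  have G_sphere: "\<forall>\<^sub>F x in G. x \<in> ?S" using F_sphere(2) G_cluster(1) by (rule filter_leD[rotated])
  have "((\<lambda>x. inverse \<mu> *\<^sub>R T (clip x)) \<longlongrightarrow> inverse \<mu> *\<^sub>R T y) G"
    by (intro tendsto_intros completely_continuous_tendsto[OF T_completely_continuous G_cluster(3)]
        norm_clip)
  moreover have "\<forall>\<^sub>F x in G. inverse \<mu> *\<^sub>R T (clip x) = x"
    using G_sphere by eventually_elim (simp add: clip_def \<open>\<mu> \<noteq> 0\<close>)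
  ultimately have id_limit: "((\<lambda>x. x) \<longlongrightarrow> inverse \<mu> *\<^sub>R T y) G" by (rule Lim_transform_eventually)
  then have "inverse \<mu> *\<^sub>R T y \<in> ?S"
    using Lim_in_closed_set[OF \<open>closed ?S\<close> G_sphere G_cluster(2)] by blast
  moreover have "G \<le> inf (nhds (inverse \<mu> *\<^sub>R T y)) F"
    using G_cluster(1) id_limit by (simp add: filterlim_def)
  then have "inf (nhds (inverse \<mu> *\<^sub>R T y)) F \<noteq> bot"
    using G_cluster(2) by (metis bot.extremum_uniqueI)
  ultimately show "\<exists>x\<in>?S. inf (nhds x) F \<noteq> bot" by blast
qed

lemma completely_continuous_positive_eigenvector:
  fixes T :: "'a::{real_inner,banach} \<Rightarrow> 'a"
  assumes T_completely_continuous: "completely_continuous T"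
    and symmetric: "\<And>v w. v \<bullet> T w = T v \<bullet> w"
    and invariant: "\<And>v. v \<in> S\<^sup>\<bottom> \<Longrightarrow> T v \<in> S\<^sup>\<bottom>" and y_positive: "y \<in> S\<^sup>\<bottom>" "0 < y \<bullet> T y"
  obtains z \<mu> where "0 < \<mu>" "z \<in> S\<^sup>\<bottom>" "z \<noteq> 0" "T z = \<mu> *\<^sub>R z"
proof -
  interpret T: bounded_linear T
    using T_completely_continuous by (simp add: completely_continuous_def)
  obtain z where z_maximal: "z \<in> S\<^sup>\<bottom>" "norm z \<le> 1" "\<And>x. x \<in> S\<^sup>\<bottom> \<Longrightarrow> norm x \<le> 1 \<Longrightarrow> x \<bullet> T x \<le> z \<bullet> T z"
    using completely_continuous_attains_sup[OF T_completely_continuous, of S] by blast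
  define \<mu> where "\<mu> = z \<bullet> T z"
  have rayleigh_le: "x \<bullet> T x \<le> \<mu> * (x \<bullet> x)" if "x \<in> S\<^sup>\<bottom>" for x
    using z_maximal(3) that
      quadratic_form_le_if_le_on_sphere[OF subspace_orthogonal_comp, of S T \<mu> x]
    by (simp add: T.scaleR \<mu>_def)
  have "0 < \<mu>"
    using rayleigh_le[OF y_positive(1)] y_positive(2)
    by (smt (verit) inner_ge_zero mult_nonpos_nonneg)
  then have "z \<noteq> 0" by (auto simp: \<mu>_def)
  have "\<mu> * (z \<bullet> z) \<le> \<mu>"
    using z_maximal(2) \<open>0 < \<mu>\<close> power_le_one[of "norm z" 2]
    by (simp add: mult_le_cancel_left1 flip: power2_norm_eq_inner)
  then have "z \<bullet> T z = \<mu> * (z \<bullet> z)" using rayleigh_le[OF z_maximal(1)] by (simp add: \<mu>_def)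
  then have "T z = \<mu> *\<^sub>R z"
    by (intro maximizer_is_eigenvector[OF subspace_orthogonal_comp invariant _ symmetric rayleigh_le
        z_maximal(1)])
      (simp_all add: T.add T.scaleR)
  then show ?thesis using that \<open>0 < \<mu>\<close> z_maximal(1) \<open>z \<noteq> 0\<close> by blast
qed

section \<open>Vector-valued functions of a real variable\<close>

lemma has_vector_derivative_iff_norm_tendsto_0:
  "(f has_vector_derivative f') (at t) \<longleftrightarrow>
     ((\<lambda>h. norm (inverse h *\<^sub>R (f (t + h) - f t) - f')) \<longlongrightarrow> 0) (at 0)"
proof -
  have "norm (f (t + h) - f t - h *\<^sub>R f') / norm h = norm (inverse h *\<^sub>R (f (t + h) - f t) - f')"
    if "h \<noteq> 0" for h
  proof -
    have "inverse h *\<^sub>R (f (t + h) - f t) - f' = inverse h *\<^sub>R (f (t + h) - f t - h *\<^sub>R f')"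
      using that by (simp add: scaleR_diff_right)
    then show ?thesis by (simp add: divide_inverse mult.commute)
  qed
  then have "\<forall>\<^sub>F h in at 0. norm (f (t + h) - f t - h *\<^sub>R f') / norm h
      = norm (inverse h *\<^sub>R (f (t + h) - f t) - f')"
    by (simp add: eventually_at_filter)
  from tendsto_cong[OF this] show ?thesis
    by (simp add: has_vector_derivative_def has_derivative_at bounded_linear_scaleR_left)
qed

lemma vector_Taylor2_bound:
  fixes u :: "real \<Rightarrow> 'a::real_normed_vector"
  assumes u_deriv: "\<And>t. (u has_vector_derivative u' t) (at t)"
    and u'_deriv: "\<And>t. (u' has_vector_derivative u'' t) (at t)"
    and u''_bound: "\<And>t. norm (u'' t) \<le> C"
  shows "norm (u (t + h) - u t - h *\<^sub>R u' t) \<le> C * h\<^sup>2"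
proof -
  have "0 \<le> C" using u''_bound[of 0] norm_ge_zero order_trans by blast
  have Lipschitz: "norm (u' s - u' t) \<le> C * \<bar>s - t\<bar>" for s
    unfolding real_norm_def[symmetric]
  proof (rule differentiable_bound[of UNIV])
    show "(u' has_derivative (\<lambda>h. h *\<^sub>R u'' x)) (at x within UNIV)" for x
      using u'_deriv[of x] by (simp add: has_vector_derivative_def)
    show "onorm (\<lambda>h. h *\<^sub>R u'' x) \<le> C" for x
      by (intro onorm_le) (simp add: mult_left_mono u''_bound mult.commute[of C])
  qed auto
  have "norm (u (t + h) - u t - (t + h - t) *\<^sub>R u' t) \<le> norm (t + h - t) * (C * \<bar>h\<bar>)"
  proof (rule vector_differentiable_bound_linearization[where S="closed_segment t (t + h)"])
    fix s assume "s \<in> closed_segment t (t + h)"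
    then have "C * \<bar>s - t\<bar> \<le> C * \<bar>h\<bar>"
      using segment_bound1[of s t "t + h"] \<open>0 \<le> C\<close> by (intro mult_left_mono) auto
    then show "norm (u' s - u' t) \<le> C * \<bar>h\<bar>" using Lipschitz[of s] by linarith
  qed (auto intro: u_deriv has_vector_derivative_at_within)
  then show ?thesis by (simp add: power2_eq_square mult.left_commute)
qed

lemma has_vector_derivative_if_Taylor_bound:
  fixes f :: "real \<Rightarrow> 'a::real_normed_vector"
  assumes "\<And>h. norm (f (t + h) - f t - h *\<^sub>R f') \<le> C * h\<^sup>2"
  shows "(f has_vector_derivative f') (at t)"
proof -
  let ?r = "\<lambda>h. norm (f (t + h) - f t - h *\<^sub>R f') / norm h"
  have "(?r \<longlongrightarrow> 0) (at 0)"
  proof (rule tendsto_sandwich[OF _ _ tendsto_const])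
    show "\<forall>\<^sub>F h in at 0. ?r h \<le> C * \<bar>h\<bar>"
      using assms by (auto simp: eventually_at_filter divide_le_eq power2_eq_square mult.assoc)
    have "((\<lambda>h. C * \<bar>h\<bar>) \<longlongrightarrow> C * \<bar>0\<bar>) (at 0)" by (intro tendsto_intros)
    then show "((\<lambda>h. C * \<bar>h\<bar>) \<longlongrightarrow> 0) (at 0)" by simp
  qed simp
  then show ?thesis
    by (simp add: has_vector_derivative_def has_derivative_at bounded_linear_scaleR_left)
qed

lemma has_vector_derivative_power_over_fact:
  "((\<lambda>s. (s ^ k / fact k) *\<^sub>R x) has_vector_derivative
      (case k of 0 \<Rightarrow> 0 | Suc j \<Rightarrow> (s ^ j / fact j) *\<^sub>R x)) (at s within S)"
proof (cases k)
  case (Suc j)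
  have "((\<lambda>s. s ^ Suc j / fact (Suc j)) has_real_derivative s ^ j / fact j) (at s within S)"
    by (rule derivative_eq_intros refl | simp add: field_simps del: of_nat_Suc)+
  from has_vector_derivative_scaleR[OF this has_vector_derivative_const[of x]] show ?thesis
    by (simp add: Suc)
qed simp

subsection \<open>The exponential of a bounded operator\<close>

definition exp_orbit :: "('a::banach \<Rightarrow> 'a) \<Rightarrow> real \<Rightarrow> 'a \<Rightarrow> 'a" where
  "exp_orbit A t x = (\<Sum>k. (t ^ k / fact k) *\<^sub>R (A ^^ k) x)"

context
  fixes A :: "'a::banach \<Rightarrow> 'a"
  assumes bounded_linear_A: "bounded_linear A"
begin

interpretation A: bounded_linear A by (rule bounded_linear_A)

lemma exp_orbit_term_bound:
  obtains K where "0 \<le> K"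
    "\<And>t R k x. \<bar>t\<bar> \<le> R \<Longrightarrow> norm ((t ^ k / fact k) *\<^sub>R (A ^^ k) x)
        \<le> norm x * (inverse (fact k) * (K * R) ^ k)"
proof -
  obtain K where A_bound: "0 \<le> K" "\<And>x. norm (A x) \<le> norm x * K" using A.nonneg_bounded by blast
  have norm_funpow_le: "norm ((A ^^ k) x) \<le> norm x * K ^ k" for k x
  proof (induction k)
    case (Suc k)
    have "norm ((A ^^ Suc k) x) \<le> norm ((A ^^ k) x) * K" using A_bound(2) by simp
    also have "\<dots> \<le> norm x * K ^ k * K" using Suc A_bound(1) by (rule mult_right_mono)
    finally show ?case by (simp add: ac_simps)
  qed simp
  have "norm ((t ^ k / fact k) *\<^sub>R (A ^^ k) x) \<le> norm x * (inverse (fact k) * (K * R) ^ k)"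
    if "\<bar>t\<bar> \<le> R" for t R k x
  proof -
    have "norm ((t ^ k / fact k) *\<^sub>R (A ^^ k) x) = inverse (fact k) * (\<bar>t\<bar> ^ k * norm ((A ^^ k) x))"
      by (simp add: divide_inverse power_abs abs_mult)
    also have "\<dots> \<le> inverse (fact k) * (R ^ k * (norm x * K ^ k))"
      using that by (intro mult_left_mono mult_mono power_mono norm_funpow_le) auto
    finally show ?thesis by (simp add: power_mult_distrib ac_simps)
  qed
  then show ?thesis using that A_bound(1) by blast
qed

lemma exp_orbit_sums: "(\<lambda>k. (t ^ k / fact k) *\<^sub>R (A ^^ k) x) sums exp_orbit A t x"
proof -
  obtain K where term_bound: "\<And>t R k x. \<bar>t\<bar> \<le> R \<Longrightarrow>
      norm ((t ^ k / fact k) *\<^sub>R (A ^^ k) x) \<le> norm x * (inverse (fact k) * (K * R) ^ k)"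
    using exp_orbit_term_bound by metis
  have "summable (\<lambda>k. (t ^ k / fact k) *\<^sub>R (A ^^ k) x)"
    by (rule summable_comparison_test'[OF summable_mult[OF summable_exp] term_bound[OF order_refl]])
  then show ?thesis unfolding exp_orbit_def by (rule summable_sums)
qed

lemma exp_orbit_0: "exp_orbit A 0 x = x"
  using sums_unique2[OF exp_orbit_sums[of 0 x] sums_finite[of "{0}"]] by simp

lemma exp_orbit_commute:
  assumes bounded_linear_B: "bounded_linear B" and commutes: "\<And>x. B (A x) = A (B x)"
  shows "B (exp_orbit A t x) = exp_orbit A t (B x)"
proof -
  interpret B: bounded_linear B by (rule bounded_linear_B)
  have "B ((A ^^ k) x) = (A ^^ k) (B x)" for k by (induction k) (simp_all add: commutes)
  then have "(\<lambda>k. (t ^ k / fact k) *\<^sub>R (A ^^ k) (B x)) sums B (exp_orbit A t x)"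
    using B.sums[OF exp_orbit_sums[of t x]] by (simp add: B.scaleR)
  then show ?thesis by (rule sums_unique2[OF _ exp_orbit_sums])
qed

lemma exp_orbit_add: "exp_orbit A t (x + y) = exp_orbit A t x + exp_orbit A t y"
proof -
  have "(A ^^ k) (x + y) = (A ^^ k) x + (A ^^ k) y" for k
    by (induction k) (simp_all add: A.add)
  then show ?thesis
    using sums_add[OF exp_orbit_sums[of t x] exp_orbit_sums[of t y]] exp_orbit_sums[of t "x + y"]
    by (simp add: scaleR_add_right sums_unique2)
qed

lemma exp_orbit_scaleR: "exp_orbit A t (r *\<^sub>R x) = r *\<^sub>R exp_orbit A t x"
  by (rule exp_orbit_commute[symmetric, OF bounded_linear_scaleR_right]) (simp add: A.scaleR)

lemma exp_orbit_partial_sums_uniform_limit: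
  "uniform_limit {- R..R} (\<lambda>n t. \<Sum>k<n. (t ^ k / fact k) *\<^sub>R (A ^^ k) x) (\<lambda>t. exp_orbit A t x)
      sequentially"
proof -
  obtain K where term_bound: "\<And>t R k x. \<bar>t\<bar> \<le> R \<Longrightarrow>
      norm ((t ^ k / fact k) *\<^sub>R (A ^^ k) x) \<le> norm x * (inverse (fact k) * (K * R) ^ k)"
    using exp_orbit_term_bound by metis
  show ?thesis
    unfolding exp_orbit_def
    by (rule Weierstrass_m_test[OF term_bound[of _ R] summable_mult[OF summable_exp]])
      (simp add: abs_le_iff)
qed

lemma exp_orbit_has_vector_derivative:
  "((\<lambda>t. exp_orbit A t x) has_vector_derivative exp_orbit A t (A x)) (at t)"
proof -
  let ?S = "{- (\<bar>t\<bar> + 1)..\<bar>t\<bar> + 1}"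
  let ?f = "\<lambda>k s. (s ^ k / fact k) *\<^sub>R (A ^^ k) x"
  let ?f' = "\<lambda>k s. case k of 0 \<Rightarrow> 0 | Suc j \<Rightarrow> (s ^ j / fact j) *\<^sub>R (A ^^ k) x"
  have term_deriv: "(?f k has_derivative (\<lambda>h. h *\<^sub>R ?f' k s)) (at s within ?S)" for k s
    using has_vector_derivative_power_over_fact by (simp only: has_vector_derivative_def)
  have partial_sums_close: "\<forall>\<^sub>F n in sequentially. \<forall>s\<in>?S. \<forall>h.
      norm ((\<Sum>k<n. h *\<^sub>R ?f' k s) - h *\<^sub>R exp_orbit A s (A x)) \<le> e * norm h" if "0 < e" for e
  proof (subst eventually_sequentially_Suc[symmetric])
    have partial_sum_eq: "(\<Sum>k<Suc n. h *\<^sub>R ?f' k s) - h *\<^sub>R exp_orbit A s (A x)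
        = h *\<^sub>R ((\<Sum>j<n. (s ^ j / fact j) *\<^sub>R (A ^^ j) (A x)) - exp_orbit A s (A x))" for n s h
      by (simp add: sum.lessThan_Suc_shift scaleR_sum_right scaleR_diff_right funpow_swap1
          del: sum.lessThan_Suc)
    show "\<forall>\<^sub>F n in sequentially. \<forall>s\<in>?S. \<forall>h.
        norm ((\<Sum>k<Suc n. h *\<^sub>R ?f' k s) - h *\<^sub>R exp_orbit A s (A x)) \<le> e * norm h"
      using uniform_limitD[OF
          exp_orbit_partial_sums_uniform_limit[where R="\<bar>t\<bar> + 1" and x="A x"] that]
      unfolding partial_sum_eq norm_scaleR
      by eventually_elim (auto simp: dist_norm mult.commute[of e] less_imp_le
          intro!: mult_left_mono)
  qed
  have "t \<in> ?S" by auto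
  have "\<exists>g. \<forall>s\<in>?S. (\<lambda>k. ?f k s) sums g s
      \<and> (g has_derivative (\<lambda>h. h *\<^sub>R exp_orbit A s (A x))) (at s within ?S)"
    by (rule has_derivative_series[OF _ term_deriv partial_sums_close \<open>t \<in> ?S\<close> exp_orbit_sums])
      simp_all
  then obtain g where g_series: "\<And>s. s \<in> ?S \<Longrightarrow> (\<lambda>k. ?f k s) sums g s"
    "(g has_derivative (\<lambda>h. h *\<^sub>R exp_orbit A t (A x))) (at t within ?S)"
    using \<open>t \<in> ?S\<close> by blast
  have g_eq: "exp_orbit A s x = g s" if "s \<in> ?S" for s
    using sums_unique2[OF exp_orbit_sums g_series(1)[OF that]] .
  have "at t within ?S = at t" by (rule at_within_interior) (auto simp: abs_le_iff)
  moreover have "((\<lambda>s. exp_orbit A s x) has_derivative (\<lambda>h. h *\<^sub>R exp_orbit A t (A x)))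
      (at t within ?S)"
    by (rule has_derivative_transform[OF \<open>t \<in> ?S\<close> g_eq g_series(2)])
  ultimately show ?thesis by (simp add: has_vector_derivative_def)
qed

end

subsection \<open>Time averages\<close>

text \<open>The value is \<open>0\<close> for \<open>T \<le> 0\<close>.\<close>

definition time_avg :: "(real \<Rightarrow> 'a::banach) \<Rightarrow> real \<Rightarrow> 'a" where
  "time_avg f T = integral {0..T} f /\<^sub>R T"

lemma integrable_on_Icc_if_continuous:
  fixes f :: "real \<Rightarrow> 'a::banach"
  shows "continuous_on UNIV f \<Longrightarrow> f integrable_on {a..b}"
  by (rule integrable_continuous_real) (rule continuous_on_subset[OF _ subset_UNIV])

lemma time_avg_linear:
  assumes "bounded_linear h" "continuous_on UNIV f"
  shows "time_avg (\<lambda>t. h (f t)) T = h (time_avg f T)"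
proof -
  interpret h: bounded_linear h by fact
  show ?thesis
    using integral_linear[OF integrable_on_Icc_if_continuous[OF assms(2)] assms(1), of 0 T]
    by (simp add: time_avg_def o_def h.scaleR)
qed

lemma time_avg_diff:
  assumes "continuous_on UNIV f" "continuous_on UNIV g"
  shows "time_avg (\<lambda>t. f t - g t) T = time_avg f T - time_avg g T"
  using integral_diff[of f "{0..T}" g] assms
  by (simp add: time_avg_def integrable_on_Icc_if_continuous scaleR_diff_right)

lemma time_avg_sum:
  assumes "finite I" "\<And>i. i \<in> I \<Longrightarrow> continuous_on UNIV (f i)"
  shows "time_avg (\<lambda>t. \<Sum>i\<in>I. f i t) T = (\<Sum>i\<in>I. time_avg (f i) T)"
  using integral_sum[OF assms(1), of f "{0..T}"] assms
  by (simp add: time_avg_def integrable_on_Icc_if_continuous scaleR_sum_right)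

lemma time_avg_const: "0 < T \<Longrightarrow> time_avg (\<lambda>_. c) T = c"
  by (simp add: time_avg_def)

lemma time_avg_mono:
  fixes f g :: "real \<Rightarrow> real"
  assumes "continuous_on UNIV f" "continuous_on UNIV g" "\<And>t. f t \<le> g t" "0 < T"
  shows "time_avg f T \<le> time_avg g T"
  using assms by (simp add: time_avg_def integral_le integrable_on_Icc_if_continuous mult_left_mono)

lemma norm_time_avg_le:
  assumes "continuous_on UNIV f" and f_bound: "\<And>t. norm (f t) \<le> K"
  shows "norm (time_avg f T) \<le> K"
proof (cases "0 < T")
  case True
  have "norm (integral {0..T} f) \<le> integral {0..T} (\<lambda>_. K)"
    using assms by (intro integral_norm_bound_integral integrable_on_Icc_if_continuous) auto
  then show ?thesis
    using True
    by (simp add: time_avg_def divide_le_eq divide_inverse_commute[symmetric] mult.commute)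
next
  case False
  then have "time_avg f T = 0" by (cases "T = 0") (auto simp: time_avg_def)
  then show ?thesis using order_trans[OF norm_ge_zero f_bound[of 0]] by simp
qed

lemma time_avg_derivative_tendsto_0:
  fixes g :: "real \<Rightarrow> 'a::banach"
  assumes g_deriv: "\<And>t. (g has_vector_derivative f t) (at t)" and g_bound: "\<And>t. norm (g t) \<le> K"
  shows "(time_avg f \<longlongrightarrow> 0) at_top"
proof (rule Lim_null_comparison)
  have "norm (time_avg f T) \<le> 2 * K * inverse T" if "0 < T" for T
  proof -
    have "(f has_integral (g T - g 0)) {0..T}"
      using that g_deriv
      by (intro fundamental_theorem_of_calculus) (auto intro: has_vector_derivative_at_within)
    then have "time_avg f T = (g T - g 0) /\<^sub>R T" by (simp add: time_avg_def integral_unique)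
    moreover have "norm (g T - g 0) \<le> 2 * K"
      using norm_triangle_ineq4[of "g T" "g 0"] g_bound[of T] g_bound[of 0] by linarith
    ultimately show ?thesis using that by (simp add: mult.commute mult_right_mono)
  qed
  then show "\<forall>\<^sub>F T in at_top. norm (time_avg f T) \<le> 2 * K * inverse T"
    by (intro eventually_mono[OF eventually_gt_at_top[of 0]])
  show "((\<lambda>T. 2 * K * inverse T) \<longlongrightarrow> 0) at_top"
    using tendsto_mult_right_zero[OF tendsto_inverse_0_at_top[OF filterlim_ident]] by simp
qed

lemma time_avg_shift_le:
  fixes g :: "real \<Rightarrow> real"
  assumes g_continuous: "continuous_on UNIV g" and g_bounds: "\<And>t. 0 \<le> g t" "\<And>t. g t \<le> M"
    and "0 \<le> \<sigma>" "0 < T"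
  shows "time_avg (\<lambda>t. g (t + \<sigma>)) T \<le> time_avg g T + \<sigma> * M / T"
proof -
  note g_integrable = integrable_on_Icc_if_continuous[OF g_continuous]
  have "integral {0..T} (\<lambda>t. g (t + \<sigma>)) = integral {\<sigma>..T + \<sigma>} g"
    using integral_shift_Icc_real[of 0 T g \<sigma>] by (simp add: o_def add.commute)
  also have "\<dots> \<le> integral {0..T + \<sigma>} g"
    using assms by (intro integral_subset_le g_integrable) auto
  also have "\<dots> = integral {0..T} g + integral {T..T + \<sigma>} g"
    using assms
    by (intro Henstock_Kurzweil_Integration.integral_combine[symmetric] g_integrable) auto
  also have "integral {T..T + \<sigma>} g \<le> integral {T..T + \<sigma>} (\<lambda>_. M)"
    by (intro integral_le g_integrable) (auto simp: g_bounds)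
  finally have "integral {0..T} (\<lambda>t. g (t + \<sigma>)) \<le> integral {0..T} g + \<sigma> * M"
    using \<open>0 \<le> \<sigma>\<close> by (simp add: mult.commute)
  from mult_left_mono[OF this, of "inverse T"] show ?thesis
    using \<open>0 < T\<close> by (simp add: time_avg_def divide_inverse algebra_simps)
qed

lemma recurrent_bound_le_time_avg:
  fixes g :: "real \<Rightarrow> real"
  assumes g_continuous: "continuous_on UNIV g" and g_bounds: "\<And>t. 0 \<le> g t" "\<And>t. g t \<le> M"
    and shifts: "finite F" "F \<subseteq> {0..}" and recurrent: "\<And>t. \<exists>\<sigma>\<in>F. c \<le> g (t + \<sigma>)" and "0 < T"
  shows "c \<le> real (card F) * time_avg g T + (\<Sum>\<sigma>\<in>F. \<sigma> * M) / T"
proof -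
  have shift_continuous: "continuous_on UNIV (\<lambda>t. g (t + \<sigma>))" for \<sigma>
    by (rule continuous_on_compose2[OF g_continuous]) (auto intro: continuous_intros)
  have "c \<le> (\<Sum>\<sigma>\<in>F. g (t + \<sigma>))" for t
  proof -
    obtain \<sigma> where "\<sigma> \<in> F" "c \<le> g (t + \<sigma>)" using recurrent by blast
    then show ?thesis using member_le_sum[of \<sigma> F "\<lambda>\<sigma>. g (t + \<sigma>)"] g_bounds(1) shifts(1) by force
  qed
  then have "time_avg (\<lambda>_. c) T \<le> time_avg (\<lambda>t. \<Sum>\<sigma>\<in>F. g (t + \<sigma>)) T"
    using \<open>0 < T\<close> by (intro time_avg_mono continuous_on_sum shift_continuous continuous_on_const)
  then have "c \<le> (\<Sum>\<sigma>\<in>F. time_avg (\<lambda>t. g (t + \<sigma>)) T)"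
    using \<open>0 < T\<close> by (simp add: time_avg_const time_avg_sum shifts(1) shift_continuous)
  also have "\<dots> \<le> (\<Sum>\<sigma>\<in>F. time_avg g T + \<sigma> * M / T)"
    using shifts(2) \<open>0 < T\<close> by (intro sum_mono time_avg_shift_le g_continuous g_bounds) auto
  also have "\<dots> = real (card F) * time_avg g T + (\<Sum>\<sigma>\<in>F. \<sigma> * M) / T"
    by (simp add: sum.distrib sum_divide_distrib)
  finally show ?thesis .
qed

lemma recurrent_bound_le_time_avg_limit:
  fixes g :: "real \<Rightarrow> real"
  assumes g_continuous: "continuous_on UNIV g" and g_bounds: "\<And>t. 0 \<le> g t" "\<And>t. g t \<le> M"
    and shifts: "finite F" "F \<subseteq> {0..}" and recurrent: "\<And>t. \<exists>\<sigma>\<in>F. c \<le> g (t + \<sigma>)"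
    and G_at_top: "G \<le> at_top" "G \<noteq> bot" and limit: "(time_avg g \<longlongrightarrow> l) G"
  shows "c \<le> real (card F) * l"
proof -
  let ?K = "\<Sum>\<sigma>\<in>F. \<sigma> * M"
  have "\<forall>\<^sub>F T in at_top. c \<le> real (card F) * time_avg g T + ?K / T"
    by (rule eventually_mono[OF eventually_gt_at_top[of 0]])
      (rule recurrent_bound_le_time_avg[OF g_continuous g_bounds shifts recurrent])
  then have "\<forall>\<^sub>F T in G. c \<le> real (card F) * time_avg g T + ?K / T"
    by (rule filter_leD[OF G_at_top(1)])
  moreover have "((\<lambda>T. ?K / T) \<longlongrightarrow> 0) G"
    using real_tendsto_divide_at_top[OF tendsto_const filterlim_ident]
    by (rule tendsto_mono[OF G_at_top(1)])
  then have "((\<lambda>T. real (card F) * time_avg g T + ?K / T) \<longlongrightarrow> real (card F) * l + 0) G"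
    by (intro tendsto_intros limit)
  ultimately have "c \<le> real (card F) * l + 0" using tendsto_lowerbound[OF _ _ G_at_top(2)] by blast
  then show ?thesis by simp
qed

lemma isometric_orbit_recurrent:
  fixes \<phi> :: "real \<Rightarrow> 'a::metric_space"
  assumes isometric: "\<And>h s t. dist (\<phi> (s + h)) (\<phi> (t + h)) = dist (\<phi> s) (\<phi> t)"
    and K_compact: "compact K" "range \<phi> \<subseteq> K" and "0 < e"
  shows "\<exists>F. finite F \<and> F \<subseteq> {0..} \<and> (\<forall>t. \<exists>\<sigma>\<in>F. dist (\<phi> s) (\<phi> (t + \<sigma>)) < e)"
proof -
  have "closure (range \<phi>) \<subseteq> K" using K_compact by (simp add: closure_minimal compact_imp_closed)
  then have "compact (closure (range \<phi>))"
    using compact_Int_closed[OF K_compact(1) closed_closure] by (metis Int_absorb1)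
  moreover have "closure (range \<phi>) \<subseteq> (\<Union>\<tau>\<in>UNIV. ball (\<phi> \<tau>) e)"
    using \<open>0 < e\<close> by (auto simp: closure_approachable dist_commute)
  ultimately obtain G where G_cover: "finite G" "closure (range \<phi>) \<subseteq> (\<Union>\<tau>\<in>G. ball (\<phi> \<tau>) e)"
    by (rule compactE_image[OF _ open_ball])
  define R where "R = (\<Sum>\<tau>\<in>G. \<bar>\<tau>\<bar>) + \<bar>s\<bar>"
  show ?thesis
  proof (intro exI conjI allI)
    show "finite ((\<lambda>\<tau>. R + s - \<tau>) ` G)" using G_cover(1) by simp
    show "(\<lambda>\<tau>. R + s - \<tau>) ` G \<subseteq> {0..}"
    proof safe
      fix \<tau> assume "\<tau> \<in> G"
      then show "0 \<le> R + s - \<tau>" using member_le_sum[of \<tau> G abs] G_cover(1) by (simp add: R_def)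
    qed
    fix t
    have "\<phi> (t + R) \<in> closure (range \<phi>)" by (rule subsetD[OF closure_subset rangeI])
    then obtain \<tau> where \<tau>: "\<tau> \<in> G" "dist (\<phi> \<tau>) (\<phi> (t + R)) < e" using G_cover(2) by auto
    moreover have "dist (\<phi> s) (\<phi> (t + (R + s - \<tau>))) = dist (\<phi> \<tau>) (\<phi> (t + R))"
      using isometric[of \<tau> "s - \<tau>" "t + R"] by (simp add: algebra_simps)
    ultimately show "\<exists>\<sigma>\<in>(\<lambda>\<tau>. R + s - \<tau>) ` G. dist (\<phi> s) (\<phi> (t + \<sigma>)) < e" by force
  qed
qed

section \<open>The Hilbert space of square-summable sequences\<close>

lemma in_l2_zero: "in_l2 (\<lambda>_. 0)"
  by (simp add: in_l2_def)

lemma in_l2_scale: "in_l2 f \<Longrightarrow> in_l2 (\<lambda>m. c * f m)"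
  unfolding in_l2_def norm_mult power_mult_distrib by (rule summable_on_cmult_right)

lemma in_l2_dominated:
  assumes "(\<lambda>m. (\<beta> m)\<^sup>2) summable_on UNIV" "\<And>m. cmod (f m) \<le> \<beta> m"
  shows "in_l2 f"
  unfolding in_l2_def
  by (rule summable_on_comparison_test[OF assms(1)]) (auto simp: power_mono assms(2))

lemma in_l2_add:
  assumes "in_l2 f" "in_l2 g"
  shows "in_l2 (\<lambda>m. f m + g m)"
proof -
  have "(\<lambda>m. 2 * (cmod (f m))\<^sup>2 + 2 * (cmod (g m))\<^sup>2) summable_on UNIV"
    using assms unfolding in_l2_def by (intro summable_on_add summable_on_cmult_right)
  moreover have "(cmod (f m + g m))\<^sup>2 \<le> 2 * (cmod (f m))\<^sup>2 + 2 * (cmod (g m))\<^sup>2" for m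
  proof -
    have "(cmod (f m + g m))\<^sup>2 \<le> (cmod (f m) + cmod (g m))\<^sup>2"
      by (simp add: norm_triangle_ineq power_mono)
    also have "\<dots> \<le> 2 * (cmod (f m))\<^sup>2 + 2 * (cmod (g m))\<^sup>2"
      using sum_squares_bound[of "cmod (f m)" "cmod (g m)"] by (simp add: power2_sum)
    finally show ?thesis .
  qed
  ultimately show ?thesis
    unfolding in_l2_def by (rule summable_on_comparison_test) auto
qed

lemma in_l2_diff: "in_l2 f \<Longrightarrow> in_l2 g \<Longrightarrow> in_l2 (\<lambda>m. f m - g m)"
  using in_l2_add[of f "\<lambda>m. (-1) * g m"] in_l2_scale[of g "-1"] by simp

lemma summable_on_norm_mult:
  assumes "in_l2 f" "in_l2 g"
  shows "(\<lambda>m. cmod (f m) * cmod (g m)) summable_on UNIV"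
proof (rule summable_on_comparison_test)
  show "(\<lambda>m. (cmod (f m))\<^sup>2 + (cmod (g m))\<^sup>2) summable_on UNIV"
    using assms unfolding in_l2_def by (rule summable_on_add)
  show "cmod (f m) * cmod (g m) \<le> (cmod (f m))\<^sup>2 + (cmod (g m))\<^sup>2" for m
  proof -
    have "0 \<le> cmod (f m) * cmod (g m)" by simp
    then show ?thesis using sum_squares_bound[of "cmod (f m)" "cmod (g m)"] by linarith
  qed
qed simp

lemma summable_on_inner:
  assumes "in_l2 f" "in_l2 g"
  shows "(\<lambda>m. f m \<bullet> g m) summable_on UNIV"
proof -
  have "(\<lambda>m. norm (f m \<bullet> g m)) summable_on UNIV"
    using Cauchy_Schwarz_ineq2
    by (intro summable_on_comparison_test[OF summable_on_norm_mult[OF assms]]) auto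
  then show ?thesis by (rule abs_summable_summable)
qed

typedef ell2 = "{f. in_l2 f}"
  morphisms coord Abs_ell2
  using in_l2_zero by blast

lemma in_l2_coord [simp]: "in_l2 (coord x)"
  using coord by blast

lemma coord_Abs [simp]: "in_l2 f \<Longrightarrow> coord (Abs_ell2 f) = f"
  by (simp add: Abs_ell2_inverse)

lemma ell2_eqI: "(\<And>m. coord x m = coord y m) \<Longrightarrow> x = y"
  by (metis coord_inject ext)

definition cscale :: "complex \<Rightarrow> ell2 \<Rightarrow> ell2" where
  "cscale c x = Abs_ell2 (\<lambda>m. c * coord x m)"

lemma coord_cscale [simp]: "coord (cscale c x) m = c * coord x m"
  by (simp add: cscale_def in_l2_scale)

instantiation ell2 :: real_inner
begin

definition "0 = Abs_ell2 (\<lambda>_. 0)"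
definition "x + y = Abs_ell2 (\<lambda>m. coord x m + coord y m)"
definition "x - y = Abs_ell2 (\<lambda>m. coord x m - coord y m)"
definition "- x = cscale (-1) x"
definition "s *\<^sub>R x = cscale (of_real s) x"
definition "inner x y = infsum (\<lambda>m. coord x m \<bullet> coord y m) UNIV"
definition "norm x = l2norm (coord x)"
definition "sgn x = inverse (norm x) *\<^sub>R (x::ell2)"
definition "dist x y = norm (x - y :: ell2)"
definition "(uniformity :: (ell2 \<times> ell2) filter) = (INF e\<in>{0<..}. principal {(x, y). dist x y < e})"
definition "open (U :: ell2 set) \<longleftrightarrow> (\<forall>x\<in>U. \<forall>\<^sub>F (x', y) in uniformity. x' = x \<longrightarrow> y \<in> U)"

lemma coord_ell2 [simp]:
  "coord 0 m = 0" "coord (x + y) m = coord x m + coord y m"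
  "coord (x - y) m = coord x m - coord y m" "coord (- x) m = - coord x m"
  "coord (s *\<^sub>R x) m = of_real s * coord x m"
  by (simp_all add: zero_ell2_def plus_ell2_def minus_ell2_def uminus_ell2_def scaleR_ell2_def
      in_l2_zero in_l2_add in_l2_diff)

instance
proof
  fix x y z :: ell2 and r s :: real
  show "dist x y = norm (x - y)" by (rule dist_ell2_def)
  show "sgn x = inverse (norm x) *\<^sub>R x" by (rule sgn_ell2_def)
  show "uniformity = (INF e\<in>{0<..}. principal {(x, y). dist (x::ell2) y < e})"
    by (rule uniformity_ell2_def)
  show "open U \<longleftrightarrow> (\<forall>x\<in>U. \<forall>\<^sub>F (x', y) in uniformity. x' = x \<longrightarrow> y \<in> U)" for U :: "ell2 set"
    by (rule open_ell2_def)
  show "x + y + z = x + (y + z)" "x + y = y + x" "0 + x = x" "- x + x = 0" "x - y = x + - y"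
    "r *\<^sub>R (x + y) = r *\<^sub>R x + r *\<^sub>R y" "(r + s) *\<^sub>R x = r *\<^sub>R x + s *\<^sub>R x"
    "r *\<^sub>R s *\<^sub>R x = (r * s) *\<^sub>R x" "1 *\<^sub>R x = x"
    by (rule ell2_eqI; simp add: algebra_simps)+
  show "inner x y = inner y x" by (simp add: inner_ell2_def inner_commute)
  show "inner (x + y) z = inner x z + inner y z"
    by (simp add: inner_ell2_def inner_add_left infsum_add summable_on_inner)
  show "inner (r *\<^sub>R x) y = r * inner x y"
    by (simp add: inner_ell2_def scaleR_conv_of_real[symmetric] infsum_cmult_right')
  have inner_self: "inner x x = infsum (\<lambda>m. (cmod (coord x m))\<^sup>2) UNIV" for x
    by (simp add: inner_ell2_def power2_norm_eq_inner)
  show "0 \<le> inner x x" by (simp add: inner_self infsum_nonneg)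
  show "norm x = sqrt (inner x x)" by (simp add: inner_self norm_ell2_def l2norm_def)
  show "inner x x = 0 \<longleftrightarrow> x = 0"
  proof
    assume "inner x x = 0"
    then have "(cmod (coord x m))\<^sup>2 = 0" for m
      using nonneg_infsum_le_0D[of "\<lambda>m. (cmod (coord x m))\<^sup>2" UNIV m] in_l2_coord[of x]
      by (simp add: inner_self in_l2_def)
    then show "x = 0" by (intro ell2_eqI) simp
  next
    assume "x = 0"
    then show "inner x x = 0" by (simp add: inner_self)
  qed
qed

end

lemma norm_sq_ell2: "(norm x)\<^sup>2 = infsum (\<lambda>m. (cmod (coord x m))\<^sup>2) UNIV"
  by (simp add: power2_norm_eq_inner inner_ell2_def)

lemma summable_coord: "(\<lambda>m. (cmod (coord x m))\<^sup>2) summable_on UNIV"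
  using in_l2_coord[of x] by (simp add: in_l2_def)

lemma sum_coord_le: "finite F \<Longrightarrow> (\<Sum>m\<in>F. (cmod (coord x m))\<^sup>2) \<le> (norm x)\<^sup>2"
  unfolding norm_sq_ell2 by (rule finite_sum_le_infsum) (auto simp: summable_coord)

lemma norm_coord_le: "cmod (coord x m) \<le> norm x"
  using sum_coord_le[of "{m}" x] by (simp add: abs_le_square_iff[symmetric])

lemma bounded_linear_coord: "bounded_linear (\<lambda>x. coord x m)"
  by (rule bounded_linear_intro[where K=1]) (auto simp: norm_coord_le scaleR_conv_of_real)

lemma coord_sum: "coord (sum f A) m = (\<Sum>i\<in>A. coord (f i) m)"
  by (induction A rule: infinite_finite_induct) auto

lemma in_l2_if_finite_sums_le:
  assumes "\<And>F. finite F \<Longrightarrow> (\<Sum>m\<in>F. (cmod (f m))\<^sup>2) \<le> K\<^sup>2" "0 \<le> K"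
  shows "in_l2 f" "norm (Abs_ell2 f) \<le> K"
proof -
  show f_l2: "in_l2 f"
    unfolding in_l2_def
    by (rule nonneg_bdd_above_summable_on) (auto intro!: bdd_aboveI2 assms)
  have "(norm (Abs_ell2 f))\<^sup>2 \<le> K\<^sup>2"
    unfolding norm_sq_ell2 using f_l2
    by (intro infsum_le_finite_sums) (auto simp: in_l2_def assms)
  then show "norm (Abs_ell2 f) \<le> K" using assms(2) by (rule power2_le_imp_le)
qed

lemma coord_tendsto_norm_le:
  assumes "G \<noteq> bot" "\<And>m. ((\<lambda>t. coord (x t) m) \<longlongrightarrow> f m) G" "\<forall>\<^sub>F t in G. norm (x t) \<le> K"
  shows "in_l2 f" "norm (Abs_ell2 f) \<le> K"
proof -
  have "0 \<le> K" using eventually_happens[OF assms(3)] assms(1) norm_ge_zero order_trans by blast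
  have "(\<Sum>m\<in>F. (cmod (f m))\<^sup>2) \<le> K\<^sup>2" if "finite F" for F
  proof (rule tendsto_upperbound[OF _ _ assms(1)])
    show "((\<lambda>t. \<Sum>m\<in>F. (cmod (coord (x t) m))\<^sup>2) \<longlongrightarrow> (\<Sum>m\<in>F. (cmod (f m))\<^sup>2)) G"
      by (intro tendsto_intros assms)
    show "\<forall>\<^sub>F t in G. (\<Sum>m\<in>F. (cmod (coord (x t) m))\<^sup>2) \<le> K\<^sup>2"
      using assms(3)
      by eventually_elim (rule order_trans[OF sum_coord_le[OF that] power_mono], simp_all)
  qed
  from in_l2_if_finite_sums_le[OF this \<open>0 \<le> K\<close>] show "in_l2 f" "norm (Abs_ell2 f) \<le> K" by auto
qed

instance ell2 :: complete_space
proof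
  fix X :: "nat \<Rightarrow> ell2" assume X_Cauchy: "Cauchy X"
  have "Cauchy (\<lambda>n. coord (X n) m)" for m
    by (rule bounded_linear.Cauchy[OF bounded_linear_coord X_Cauchy])
  then have "\<forall>m. \<exists>l. (\<lambda>n. coord (X n) m) \<longlonglongrightarrow> l"
    by (simp add: Cauchy_convergent_iff convergent_def)
  then obtain f where f_limit: "\<And>m. (\<lambda>n. coord (X n) m) \<longlonglongrightarrow> f m" by metis
  obtain K where "\<And>n. norm (X n) \<le> K" using Cauchy_Bseq[OF X_Cauchy] by (auto simp: Bseq_def)
  then have f_l2: "in_l2 f"
    using coord_tendsto_norm_le(1)[OF sequentially_bot f_limit always_eventually] by blast
  have "X \<longlonglongrightarrow> Abs_ell2 f"
  proof (rule metric_LIMSEQ_I)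
    fix e :: real assume "0 < e"
    then obtain N where N_close: "\<And>m n. N \<le> m \<Longrightarrow> N \<le> n \<Longrightarrow> dist (X m) (X n) < e / 2"
      using metric_CauchyD[OF X_Cauchy, of "e / 2"] by auto
    have "dist (X n) (Abs_ell2 f) < e" if "N \<le> n" for n
    proof -
      have "norm (Abs_ell2 (coord (Abs_ell2 f - X n))) \<le> e / 2"
      proof (rule coord_tendsto_norm_le(2)[OF sequentially_bot])
        show "(\<lambda>k. coord (X k - X n) m) \<longlonglongrightarrow> coord (Abs_ell2 f - X n) m" for m
          using f_limit by (auto simp: f_l2 intro!: tendsto_intros)
        show "\<forall>\<^sub>F k in sequentially. norm (X k - X n) \<le> e / 2"
          using N_close[OF _ that]
          by (intro eventually_sequentiallyI[of N]) (simp add: dist_norm less_imp_le)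
      qed
      then show ?thesis using \<open>0 < e\<close> by (simp add: coord_inverse dist_commute dist_norm)
    qed
    then show "\<exists>N. \<forall>n\<ge>N. dist (X n) (Abs_ell2 f) < e" by blast
  qed
  then show "convergent X" by (auto simp: convergent_def)
qed

instance ell2 :: banach ..

subsection \<open>Multiplication by complex scalars and the standard basis\<close>

lemma cscale_simps [simp]:
  "cscale c (x + y) = cscale c x + cscale c y" "cscale c (x - y) = cscale c x - cscale c y"
  "cscale c (- x) = - cscale c x" "cscale c (r *\<^sub>R x) = r *\<^sub>R cscale c x"
  "cscale c (cscale d x) = cscale (c * d) x" "cscale c 0 = 0" "cscale 0 x = 0" "cscale 1 x = x"
  "cscale (- c) x = - cscale c x"
  by (rule ell2_eqI; simp add: algebra_simps)+

lemma cscale_of_real: "cscale (of_real r) x = r *\<^sub>R x"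
  by (rule ell2_eqI) simp

lemma cscale_minus_one: "cscale (- 1) x = - x"
  by simp

lemma cscale_eq_Re_Im: "cscale c x = Re c *\<^sub>R x + Im c *\<^sub>R cscale \<i> x"
  by (rule ell2_eqI) (simp add: complex_eq_iff)

lemma inner_cscale: "cscale c x \<bullet> y = x \<bullet> cscale (cnj c) y"
  unfolding inner_ell2_def by (rule infsum_cong) (simp add: inner_complex_def algebra_simps)

lemma norm_cscale [simp]: "norm (cscale c x) = cmod c * norm x"
proof -
  have "(norm (cscale c x))\<^sup>2 = (cmod c * norm x)\<^sup>2"
    unfolding norm_sq_ell2 power_mult_distrib
    by (simp add: norm_mult power_mult_distrib infsum_cmult_right')
  then show ?thesis by simp
qed

lemma bounded_bilinear_cscale: "bounded_bilinear cscale"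
proof
  show "cscale (c + d) x = cscale c x + cscale d x" "cscale (r *\<^sub>R c) x = r *\<^sub>R cscale c x"
    for c d x and r :: real
    by (rule ell2_eqI; simp add: scaleR_conv_of_real algebra_simps)+
  show "\<exists>K. \<forall>c x. norm (cscale c x) \<le> norm c * norm x * K" by (intro exI[of _ 1]) simp
qed simp_all

lemma inner_cscale_self: "x \<bullet> cscale c x = Re c * (norm x)\<^sup>2"
proof -
  have "x \<bullet> cscale c x = infsum (\<lambda>m. Re c * (cmod (coord x m))\<^sup>2) UNIV"
    unfolding inner_ell2_def cmod_power2
    by (rule infsum_cong) (simp add: inner_complex_def algebra_simps power2_eq_square)
  then show ?thesis by (simp add: norm_sq_ell2 infsum_cmult_right')
qed

definition basis :: "int \<Rightarrow> ell2" where
  "basis n = Abs_ell2 (kdelta n)"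

lemma in_l2_kdelta: "in_l2 (kdelta n)"
proof -
  have "(\<lambda>m. (cmod (kdelta n m))\<^sup>2) summable_on UNIV \<longleftrightarrow> (\<lambda>m. (cmod (kdelta n m))\<^sup>2) summable_on {n}"
    by (rule summable_on_cong_neutral) (auto simp: kdelta_def)
  then show ?thesis by (simp add: in_l2_def)
qed

lemma coord_basis_eq_kdelta: "coord (basis n) = kdelta n"
  by (simp add: basis_def in_l2_kdelta)

lemma coord_basis [simp]: "coord (basis n) m = (if m = n then 1 else 0)"
  by (simp add: coord_basis_eq_kdelta kdelta_def)

lemma inner_cscale_basis: "cscale c (basis m) \<bullet> x = c \<bullet> coord x m"
proof -
  have "cscale c (basis m) \<bullet> x = infsum (\<lambda>k. c \<bullet> coord x k) {m}"
    unfolding inner_ell2_def by (rule infsum_cong_neutral) auto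
  then show ?thesis by simp
qed

lemma norm_basis [simp]: "norm (basis m) = 1"
  using inner_cscale_basis[of 1 m "basis m"] by (simp add: norm_eq_sqrt_inner)

lemma ell2_eq_if_inner_cscale_basis_eq:
  assumes "\<And>c m. cscale c (basis m) \<bullet> x = cscale c (basis m) \<bullet> y"
  shows "x = y"
proof (rule ell2_eqI)
  show "coord x m = coord y m" for m
    using assms[of _ m] vector_eq_ldot[of "coord x m" "coord y m"] by (simp add: inner_cscale_basis)
qed

lemma weakly_tendsto_coord:
  assumes "weakly_tendsto x y F"
  shows "((\<lambda>t. coord (x t) m) \<longlongrightarrow> coord y m) F"
  using weakly_tendsto_inner[OF assms, of "cscale 1 (basis m)"]
    weakly_tendsto_inner[OF assms, of "cscale \<i> (basis m)"]
  unfolding inner_cscale_basis by (simp add: inner_complex_def tendsto_complex_iff)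

lemma weakly_tendsto_cscale:
  assumes "weakly_tendsto x y F"
  shows "weakly_tendsto (\<lambda>t. cscale c (x t)) (cscale c y) F"
proof -
  have "w \<bullet> cscale c v = cscale (cnj c) w \<bullet> v" for w v by (simp add: inner_cscale)
  then show ?thesis using assms by (simp add: weakly_tendsto_def)
qed

subsection \<open>Dominated convergence and compactness\<close>

lemma ell2_tendsto_if_dominated:
  assumes converges: "\<And>m. ((\<lambda>t. coord (x t) m) \<longlongrightarrow> coord y m) G"
    and x_bound: "\<forall>\<^sub>F t in G. \<forall>m. cmod (coord (x t) m) \<le> \<beta> m"
    and \<beta>_l2: "(\<lambda>m. (\<beta> m)\<^sup>2) summable_on UNIV"
  shows "(x \<longlongrightarrow> y) G"
proof (cases "G = bot")
  case False
  let ?S = "{t. \<forall>m. cmod (coord (x t) m) \<le> \<beta> m}"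
  let ?f = "\<lambda>m t. (cmod (coord (x t - y) m))\<^sup>2"
  have y_bound: "cmod (coord y m) \<le> \<beta> m" for m
    using x_bound
    by (intro tendsto_upperbound[OF tendsto_norm[OF converges] _ False])
      (auto elim: eventually_mono)
  have "?f m t \<le> (2 * \<beta> m)\<^sup>2" if "t \<in> ?S" for m t
  proof (rule power_mono)
    have "cmod (coord (x t) m) \<le> \<beta> m" using that by blast
    then show "cmod (coord (x t - y) m) \<le> 2 * \<beta> m"
      using norm_triangle_ineq4[of "coord (x t) m" "coord y m"] y_bound[of m] by simp
  qed simp
  then have "uniform_limit ?S (\<lambda>F t. \<Sum>m\<in>F. ?f m t) (\<lambda>t. infsum (\<lambda>m. ?f m t) UNIV)
      (finite_subsets_at_top UNIV)"
    by (intro Weierstrass_m_test_general[of _ _ _ "\<lambda>m. (2 * \<beta> m)\<^sup>2"])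
      (auto simp: power_mult_distrib intro: summable_on_cmult_right \<beta>_l2)
  moreover have "((\<lambda>t. ?f m t) \<longlongrightarrow> 0) G" for m
    using tendsto_power[OF tendsto_norm[OF LIM_zero[OF converges[of m]]], of 2] by simp
  then have "((\<lambda>t. \<Sum>m\<in>F. ?f m t) \<longlongrightarrow> 0) G" for F by (intro tendsto_null_sum) blast
  ultimately have "((\<lambda>t. infsum (\<lambda>m. ?f m t) UNIV) \<longlongrightarrow> 0) G"
    using x_bound by (intro swap_uniform_limit'[OF always_eventually tendsto_const]) auto
  then have "((\<lambda>t. sqrt ((norm (x t - y))\<^sup>2)) \<longlongrightarrow> sqrt 0) G"
    unfolding norm_sq_ell2 by (rule tendsto_real_sqrt)
  then show ?thesis by (subst Lim_null) (simp add: tendsto_norm_zero_iff)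
qed simp

lemma compact_dominated:
  assumes \<beta>_l2: "(\<lambda>m. (\<beta> m)\<^sup>2) summable_on UNIV"
  shows "compact {x. \<forall>m. cmod (coord x m) \<le> \<beta> m}"
proof -
  let ?P = "Pi\<^sub>E UNIV (\<lambda>m. cball (0::complex) (\<beta> m))"
  have P_l2: "in_l2 f" if "f \<in> ?P" for f
    using that by (intro in_l2_dominated[OF \<beta>_l2]) (auto simp: PiE_iff)
  have "compact ?P"
    using compactin_PiE[of "\<lambda>_. euclidean" UNIV "\<lambda>m. cball (0::complex) (\<beta> m)"]
    by (simp add: euclidean_product_topology)
  moreover have "continuous_on ?P Abs_ell2"
    unfolding continuous_on
  proof (intro ballI ell2_tendsto_if_dominated[OF _ _ \<beta>_l2])
    fix f m assume f_mem: "f \<in> ?P"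
    have "((\<lambda>g. g m) \<longlongrightarrow> f m) (at f within ?P)"
      using continuous_on_subset[OF continuous_on_product_coordinates[of m] subset_UNIV] f_mem
      unfolding continuous_on by blast
    moreover have "\<forall>\<^sub>F g in at f within ?P. g m = coord (Abs_ell2 g) m"
      using P_l2 by (auto simp: eventually_at_filter)
    ultimately show "((\<lambda>g. coord (Abs_ell2 g) m) \<longlongrightarrow> coord (Abs_ell2 f) m) (at f within ?P)"
      using P_l2[OF f_mem] by (simp add: Lim_transform_eventually)
    show "\<forall>\<^sub>F g in at f within ?P. \<forall>m. cmod (coord (Abs_ell2 g) m) \<le> \<beta> m"
      using P_l2 by (auto simp: eventually_at_filter PiE_iff)
  qed
  ultimately have "compact (Abs_ell2 ` ?P)" by (rule compact_continuous_image[rotated])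
  also have "Abs_ell2 ` ?P = {x. \<forall>m. cmod (coord x m) \<le> \<beta> m}"
  proof (intro equalityI subsetI)
    fix x assume "x \<in> {x. \<forall>m. cmod (coord x m) \<le> \<beta> m}"
    then have "coord x \<in> ?P" by (simp add: PiE_iff)
    then show "x \<in> Abs_ell2 ` ?P" by (metis coord_inverse imageI)
  qed (use P_l2 in \<open>auto simp: PiE_iff\<close>)
  finally show ?thesis .
qed

section \<open>The Jacobi operator\<close>

definition shift_op :: "int \<Rightarrow> ell2 \<Rightarrow> ell2" where
  "shift_op k x = Abs_ell2 (\<lambda>m. coord x (m + k))"

definition diag_op :: "(int \<Rightarrow> real) \<Rightarrow> ell2 \<Rightarrow> ell2" where
  "diag_op b x = Abs_ell2 (\<lambda>m. of_real (b m) * coord x m)"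

lemma bij_add_int: "bij (\<lambda>m::int. m + k)"
  by (rule bij_betw_byWitness[where f'="\<lambda>m. m - k"]) auto

lemma coord_shift_op [simp]: "coord (shift_op k x) m = coord x (m + k)"
proof -
  have "in_l2 (\<lambda>m. coord x (m + k))"
    using summable_on_reindex_bij_betw[OF bij_add_int, of "\<lambda>m. (cmod (coord x m))\<^sup>2" k]
      summable_coord
    by (simp add: in_l2_def)
  then show ?thesis by (simp add: shift_op_def)
qed

lemma inner_shift_op: "shift_op k x \<bullet> y = x \<bullet> shift_op (- k) y"
  using infsum_reindex_bij_betw[OF bij_add_int, of "\<lambda>m. coord x m \<bullet> coord y (m - k)" k]
  by (simp add: inner_ell2_def)

lemma norm_shift_op: "norm (shift_op k x) = norm x"
proof -
  have "shift_op (- k) (shift_op k x) = x" by (rule ell2_eqI) simp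
  then show ?thesis by (simp add: norm_eq_sqrt_inner inner_shift_op)
qed

lemma coord_diag_op:
  "in_l2 (\<lambda>m. of_real (b m) * coord x m) \<Longrightarrow> coord (diag_op b x) m = of_real (b m) * coord x m"
  by (simp add: diag_op_def)

lemma inner_diag_op:
  assumes "in_l2 (\<lambda>m. of_real (b m) * coord x m)" "in_l2 (\<lambda>m. of_real (b m) * coord y m)"
  shows "diag_op b x \<bullet> y = x \<bullet> diag_op b y"
  unfolding inner_ell2_def by (rule infsum_cong) (simp add: coord_diag_op assms inner_complex_def)

lemma in_l2_diag_op_if_bounded:
  assumes "\<And>m. \<bar>b m\<bar> \<le> K"
  shows "in_l2 (\<lambda>m. of_real (b m) * coord x m)"
proof (rule in_l2_dominated)
  show "(\<lambda>m. (K * cmod (coord x m))\<^sup>2) summable_on UNIV"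
    unfolding power_mult_distrib by (intro summable_on_cmult_right summable_coord)
  show "cmod (of_real (b m) * coord x m) \<le> K * cmod (coord x m)" for m
    by (simp add: norm_mult mult_right_mono assms)
qed

lemma norm_diag_op_le:
  assumes "\<And>m. \<bar>b m\<bar> \<le> K"
  shows "norm (diag_op b x) \<le> K * norm x"
proof (rule power2_le_imp_le)
  have "0 \<le> K" using assms[of 0] by linarith
  then show "0 \<le> K * norm x" by simp
  have "(norm (diag_op b x))\<^sup>2 \<le> infsum (\<lambda>m. K\<^sup>2 * (cmod (coord x m))\<^sup>2) UNIV"
    unfolding norm_sq_ell2
  proof (intro infsum_mono summable_coord summable_on_cmult_right)
    fix m
    have "cmod (coord (diag_op b x) m) \<le> K * cmod (coord x m)"
      by (simp add: coord_diag_op in_l2_diag_op_if_bounded[OF assms] norm_mult mult_right_mono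
          assms)
    then show "(cmod (coord (diag_op b x) m))\<^sup>2 \<le> K\<^sup>2 * (cmod (coord x m))\<^sup>2"
      unfolding power_mult_distrib[symmetric] by (rule power_mono) simp
  qed
  also have "\<dots> = (K * norm x)\<^sup>2" by (simp add: infsum_cmult_right' norm_sq_ell2 power_mult_distrib)
  finally show "(norm (diag_op b x))\<^sup>2 \<le> (K * norm x)\<^sup>2" .
qed

lemma jacobi_coord:
  "jacobi a \<omega> (coord 0) = (\<lambda>n. 0)"
  "jacobi a \<omega> (coord (x + y)) = (\<lambda>n. jacobi a \<omega> (coord x) n + jacobi a \<omega> (coord y) n)"
  "jacobi a \<omega> (coord (x - y)) = (\<lambda>n. jacobi a \<omega> (coord x) n - jacobi a \<omega> (coord y) n)"
  "jacobi a \<omega> (coord (cscale c x)) = (\<lambda>n. c * jacobi a \<omega> (coord x) n)"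
  "jacobi a \<omega> (coord (r *\<^sub>R x)) = (\<lambda>n. of_real r * jacobi a \<omega> (coord x) n)"
  by (rule ext; simp add: jacobi_def algebra_simps)+

definition jop :: "(int \<Rightarrow> real) \<Rightarrow> (int \<Rightarrow> real) \<Rightarrow> ell2 \<Rightarrow> ell2" where
  "jop a \<omega> x = Abs_ell2 (jacobi a \<omega> (coord x))"

definition jdomain :: "(int \<Rightarrow> real) \<Rightarrow> (int \<Rightarrow> real) \<Rightarrow> ell2 set" where
  "jdomain a \<omega> = {x. in_l2 (jacobi a \<omega> (coord x))}"

lemma coord_jop: "x \<in> jdomain a \<omega> \<Longrightarrow> coord (jop a \<omega> x) m = jacobi a \<omega> (coord x) m"
  by (simp add: jdomain_def jop_def)

lemma jdomain_iff_jdom: "x \<in> jdomain a \<omega> \<longleftrightarrow> coord x \<in> jdom a \<omega>"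
  by (simp add: jdomain_def jdom_def)

lemma jopI:
  assumes "\<And>m. jacobi a \<omega> (coord x) m = coord y m"
  shows "x \<in> jdomain a \<omega>" "jop a \<omega> x = y"
proof -
  have "jacobi a \<omega> (coord x) = coord y" using assms by (rule ext)
  then show "x \<in> jdomain a \<omega>" "jop a \<omega> x = y" by (simp_all add: jdomain_def jop_def coord_inverse)
qed

lemma jdomain_closed:
  "0 \<in> jdomain a \<omega>"
  "x \<in> jdomain a \<omega> \<Longrightarrow> y \<in> jdomain a \<omega> \<Longrightarrow> x + y \<in> jdomain a \<omega>"
  "x \<in> jdomain a \<omega> \<Longrightarrow> y \<in> jdomain a \<omega> \<Longrightarrow> x - y \<in> jdomain a \<omega>"
  "x \<in> jdomain a \<omega> \<Longrightarrow> cscale c x \<in> jdomain a \<omega>"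
  "x \<in> jdomain a \<omega> \<Longrightarrow> r *\<^sub>R x \<in> jdomain a \<omega>"
  "x \<in> jdomain a \<omega> \<Longrightarrow> - x \<in> jdomain a \<omega>"
  unfolding cscale_minus_one[symmetric]
  by (simp_all only: jdomain_def mem_Collect_eq jacobi_coord in_l2_zero in_l2_add in_l2_diff
      in_l2_scale)

lemma jop_linear:
  "jop a \<omega> 0 = 0"
  "x \<in> jdomain a \<omega> \<Longrightarrow> y \<in> jdomain a \<omega> \<Longrightarrow> jop a \<omega> (x + y) = jop a \<omega> x + jop a \<omega> y"
  "x \<in> jdomain a \<omega> \<Longrightarrow> y \<in> jdomain a \<omega> \<Longrightarrow> jop a \<omega> (x - y) = jop a \<omega> x - jop a \<omega> y"
  "x \<in> jdomain a \<omega> \<Longrightarrow> jop a \<omega> (cscale c x) = cscale c (jop a \<omega> x)"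
  "x \<in> jdomain a \<omega> \<Longrightarrow> jop a \<omega> (r *\<^sub>R x) = r *\<^sub>R jop a \<omega> x"
  "x \<in> jdomain a \<omega> \<Longrightarrow> jop a \<omega> (- x) = - jop a \<omega> x"
  unfolding cscale_minus_one[symmetric]
  by (rule ell2_eqI; simp only: coord_ell2 coord_cscale coord_jop jdomain_closed jacobi_coord)+

lemma jop_sum:
  assumes "finite I" "\<And>i. i \<in> I \<Longrightarrow> f i \<in> jdomain a \<omega>"
  shows "sum f I \<in> jdomain a \<omega>" "jop a \<omega> (sum f I) = (\<Sum>i\<in>I. jop a \<omega> (f i))"
  using assms by (induction I) (auto simp: jdomain_closed jop_linear)

lemma
  shows jdomain_basis: "basis n \<in> jdomain a \<omega>"
    and jop_basis: "jop a \<omega> (basis n) = a n *\<^sub>R basis (n + 1) + a (n - 1) *\<^sub>R basis (n - 1)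
        + \<omega> n *\<^sub>R basis n"
  by (rule jopI[of _ _ _ "a n *\<^sub>R basis (n + 1) + a (n - 1) *\<^sub>R basis (n - 1) + \<omega> n *\<^sub>R basis n"];
      auto simp: jacobi_def)+

lemma inner_jop_cscale_basis: "jop a \<omega> (cscale c (basis m)) \<bullet> y = c \<bullet> jacobi a \<omega> (coord y) m"
proof -
  have "jop a \<omega> (cscale c (basis m)) = a m *\<^sub>R cscale c (basis (m + 1))
      + a (m - 1) *\<^sub>R cscale c (basis (m - 1)) + \<omega> m *\<^sub>R cscale c (basis m)"
    by (simp add: jop_linear jdomain_basis jop_basis)
  then show ?thesis
    by (simp add: inner_add_left inner_cscale_basis jacobi_def inner_add_right
        flip: scaleR_conv_of_real)
qed

lemma jdomain_if_adjoint_bound: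
  assumes "0 \<le> C" "\<And>w. w \<in> jdomain a \<omega> \<Longrightarrow> \<bar>jop a \<omega> w \<bullet> y\<bar> \<le> C * norm w"
  shows "y \<in> jdomain a \<omega>" "norm (jop a \<omega> y) \<le> C"
proof -
  let ?g = "jacobi a \<omega> (coord y)"
  have "(\<Sum>m\<in>F. (cmod (?g m))\<^sup>2) \<le> C\<^sup>2" if F_finite: "finite F" for F
  proof -
    define w where "w = (\<Sum>m\<in>F. cscale (?g m) (basis m))"
    have w_dom: "w \<in> jdomain a \<omega>"
      unfolding w_def by (intro jop_sum(1) F_finite jdomain_closed jdomain_basis)
    have "jop a \<omega> w \<bullet> y = (\<Sum>m\<in>F. (cmod (?g m))\<^sup>2)"
      unfolding w_def jop_sum(2)[OF F_finite jdomain_closed(4)[OF jdomain_basis]]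
      by (simp add: inner_sum_left inner_jop_cscale_basis power2_norm_eq_inner)
    moreover have "coord w k = ?g k" if "k \<in> F" for k
      using F_finite that by (simp add: w_def coord_sum if_distrib sum.delta' cong: if_cong)
    then have "w \<bullet> w = (\<Sum>m\<in>F. (cmod (?g m))\<^sup>2)"
      by (subst (1) w_def) (simp add: inner_sum_left inner_cscale_basis power2_norm_eq_inner)
    ultimately have "norm w * norm w \<le> C * norm w"
      using assms(2)[OF w_dom] by (simp add: norm_eq_sqrt_inner)
    then have "norm w \<le> C" using assms(1) by (cases "w = 0") auto
    then show ?thesis
      using \<open>w \<bullet> w = _\<close> power_mono[of "norm w" C 2] by (simp add: power2_norm_eq_inner)
  qed
  note jacobi_l2 = in_l2_if_finite_sums_le[OF this assms(1)]
  show "y \<in> jdomain a \<omega>" using jacobi_l2(1) by (simp add: jdomain_def)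
  show "norm (jop a \<omega> y) \<le> C" using jacobi_l2(2) by (simp add: jop_def)
qed

lemma jop_energy_shift:
  assumes "x \<in> jdomain a \<omega>"
  shows "x \<in> jdomain a (\<lambda>m. \<omega> m - e)" "jop a (\<lambda>m. \<omega> m - e) x = jop a \<omega> x - e *\<^sub>R x"
  by (rule jopI[of _ _ _ "jop a \<omega> x - e *\<^sub>R x"];
      simp add: coord_jop[OF assms] jacobi_def algebra_simps)+

locale jacobi_operator =
  fixes a \<omega> :: "int \<Rightarrow> real" and \<alpha> :: real
  assumes a_le: "\<And>n. \<bar>a n\<bar> \<le> \<alpha>"
begin

abbreviation "J \<equiv> jop a \<omega>"
abbreviation "D \<equiv> jdomain a \<omega>"

definition hop :: "ell2 \<Rightarrow> ell2" where
  "hop x = diag_op a (shift_op 1 x) + shift_op (- 1) (diag_op a x)"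

lemma in_l2_a: "in_l2 (\<lambda>m. of_real (a m) * coord x m)"
  by (rule in_l2_diag_op_if_bounded[OF a_le])

lemma coord_hop:
  "coord (hop x) m = of_real (a m) * coord x (m + 1) + of_real (a (m - 1)) * coord x (m - 1)"
  by (simp add: hop_def coord_diag_op[OF in_l2_a])

lemma hop_symmetric: "hop x \<bullet> y = x \<bullet> hop y"
  by (simp add: hop_def inner_add_left inner_add_right inner_shift_op
      inner_diag_op[OF in_l2_a in_l2_a])

lemma norm_hop_le: "norm (hop x) \<le> 2 * \<alpha> * norm x"
  using norm_triangle_ineq[of "diag_op a (shift_op 1 x)" "shift_op (- 1) (diag_op a x)"]
    norm_diag_op_le[of a \<alpha> "shift_op 1 x"] norm_diag_op_le[of a \<alpha> x] a_le
  by (simp add: hop_def norm_shift_op)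

lemma jop_eq_hop_plus_diag_op:
  assumes "x \<in> D"
  shows "in_l2 (\<lambda>m. of_real (\<omega> m) * coord x m)" "J x = hop x + diag_op \<omega> x"
proof -
  have diag_op: "(\<lambda>m. of_real (\<omega> m) * coord x m) = coord (J x - hop x)"
    by (rule ext) (simp add: coord_jop[OF assms] coord_hop jacobi_def)
  show "in_l2 (\<lambda>m. of_real (\<omega> m) * coord x m)" unfolding diag_op by (rule in_l2_coord)
  then show "J x = hop x + diag_op \<omega> x"
    by (intro ell2_eqI) (simp add: coord_jop[OF assms] coord_hop coord_diag_op jacobi_def)
qed

lemma jop_symmetric:
  assumes "x \<in> D" "y \<in> D"
  shows "J x \<bullet> y = x \<bullet> J y"
  by (simp add: jop_eq_hop_plus_diag_op(2) assms inner_add hop_symmetric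
      inner_diag_op[OF jop_eq_hop_plus_diag_op(1)[OF assms(1)]
          jop_eq_hop_plus_diag_op(1)[OF assms(2)]])

lemma inner_i_jop_eq:
  assumes "w \<in> D" "x \<in> D"
  shows "cscale \<i> w \<bullet> J x = cscale \<i> (J w) \<bullet> x"
  using jop_symmetric[of "cscale \<i> w" x] assms by (simp add: jop_linear jdomain_closed)

lemma inner_i_jop_zero:
  assumes "x \<in> D"
  shows "cscale \<i> x \<bullet> J x = 0"
proof -
  have "cscale \<i> x \<bullet> J x = cscale \<i> (J x) \<bullet> x" by (rule inner_i_jop_eq[OF assms assms])
  also have "\<dots> = - (cscale \<i> x \<bullet> J x)" by (simp add: inner_cscale inner_commute)
  finally show ?thesis by simp
qed

end

section \<open>The unitary evolution\<close>

abbreviation generator :: "(int \<Rightarrow> real) \<Rightarrow> (int \<Rightarrow> real) \<Rightarrow> ell2 \<Rightarrow> ell2" where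
  "generator a \<omega> \<equiv> \<lambda>x. cscale (- \<i>) (jop a \<omega> x)"

definition schrod_orbit :: "(int \<Rightarrow> real) \<Rightarrow> (int \<Rightarrow> real) \<Rightarrow> (real \<Rightarrow> ell2) \<Rightarrow> bool" where
  "schrod_orbit a \<omega> \<psi> \<longleftrightarrow> (\<forall>t. \<psi> t \<in> jdomain a \<omega> \<and>
     (\<psi> has_vector_derivative generator a \<omega> (\<psi> t)) (at t))"

lemma schrod_orbitD:
  assumes "schrod_orbit a \<omega> \<psi>"
  shows "\<psi> t \<in> jdomain a \<omega>" "(\<psi> has_vector_derivative generator a \<omega> (\<psi> t)) (at t)"
  using assms by (auto simp: schrod_orbit_def)

lemma schrod_sol_iff_orbit:
  "schrod_sol a \<omega> (coord x) (\<lambda>t. coord (\<psi> t)) \<longleftrightarrow> \<psi> 0 = x \<and> schrod_orbit a \<omega> \<psi>"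
proof -
  have "l2norm (\<lambda>m. (coord (\<psi> (t + h)) m - coord (\<psi> t) m) / of_real h
      + \<i> * jacobi a \<omega> (coord (\<psi> t)) m)
      = norm (inverse h *\<^sub>R (\<psi> (t + h) - \<psi> t) - cscale (- \<i>) (jop a \<omega> (\<psi> t)))"
    if "\<psi> t \<in> jdomain a \<omega>" for t h
    unfolding norm_ell2_def
    by (rule arg_cong[of _ _ l2norm], rule ext)
      (simp add: coord_jop[OF that] divide_inverse algebra_simps)
  then show ?thesis
    unfolding schrod_sol_def schrod_orbit_def jdomain_iff_jdom[symmetric] coord_inject
      has_vector_derivative_iff_norm_tendsto_0
    by auto
qed

lemma schrod_orbit_diff:
  assumes "schrod_orbit a \<omega> \<psi>" "schrod_orbit a \<omega> \<phi>"
  shows "schrod_orbit a \<omega> (\<lambda>t. \<psi> t - \<phi> t)"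
  unfolding schrod_orbit_def
  using schrod_orbitD[OF assms(1)] schrod_orbitD[OF assms(2)]
  by (auto simp: jop_linear jdomain_closed intro!: derivative_eq_intros)

lemma schrod_orbit_shift:
  assumes "schrod_orbit a \<omega> \<psi>"
  shows "schrod_orbit a \<omega> (\<lambda>t. \<psi> (t + s))"
proof -
  have "((\<lambda>t. \<psi> (t + s)) has_vector_derivative generator a \<omega> (\<psi> (t + s))) (at t)" for t
  proof -
    have "((\<lambda>t. t + s) has_vector_derivative 1) (at t)" by (auto intro!: derivative_eq_intros)
    from vector_diff_chain_at[OF this schrod_orbitD(2)[OF assms]] show ?thesis by (simp add: o_def)
  qed
  then show ?thesis using assms by (simp add: schrod_orbit_def)
qed

lemma schrod_orbit_inner_deriv:
  assumes "schrod_orbit a \<omega> \<psi>"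
  shows "((\<lambda>t. w \<bullet> \<psi> t) has_real_derivative cscale \<i> w \<bullet> jop a \<omega> (\<psi> t)) (at t)"
  using bounded_linear.has_vector_derivative[OF bounded_linear_inner_right
      schrod_orbitD(2)[OF assms], of w]
  by (simp add: has_real_derivative_iff_has_vector_derivative inner_cscale)

lemma schrod_orbit_continuous: "schrod_orbit a \<omega> \<psi> \<Longrightarrow> continuous_on A \<psi>"
  by (meson schrod_orbitD(2) continuous_at_imp_continuous_on has_vector_derivative_continuous)

context jacobi_operator
begin

lemma schrod_orbit_norm:
  assumes "schrod_orbit a \<omega> \<psi>"
  shows "norm (\<psi> t) = norm (\<psi> s)"
proof -
  have "((\<lambda>t. \<psi> t \<bullet> \<psi> t) has_real_derivative 0) (at t)" for t
  proof -
    note orbit_t = schrod_orbitD[OF assms, of t]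
    have "\<psi> t \<bullet> cscale (- \<i>) (J (\<psi> t)) = 0"
      using inner_i_jop_zero[OF orbit_t(1)] by (simp add: inner_cscale)
    then show ?thesis
      using bounded_bilinear.has_vector_derivative[OF bounded_bilinear_inner orbit_t(2) orbit_t(2)]
      by (simp add: has_real_derivative_iff_has_vector_derivative inner_commute)
  qed
  from DERIV_isconst_all[of "\<lambda>t. \<psi> t \<bullet> \<psi> t", of t s] this
  have "\<psi> t \<bullet> \<psi> t = \<psi> s \<bullet> \<psi> s" by blast
  then show ?thesis by (simp add: norm_eq_sqrt_inner)
qed

lemma schrod_orbit_isometric:
  assumes "schrod_orbit a \<omega> \<psi>"
  shows "dist (\<psi> (s + h)) (\<psi> (t + h)) = dist (\<psi> s) (\<psi> t)"
  using schrod_orbit_norm[OF schrod_orbit_diff[OF schrod_orbit_shift[OF assms, of s]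
      schrod_orbit_shift[OF assms, of t]], of h 0]
  by (simp add: dist_norm add.commute)

lemma schrod_orbit_unique:
  assumes "schrod_orbit a \<omega> \<psi>" "schrod_orbit a \<omega> \<phi>" "\<psi> 0 = \<phi> 0"
  shows "\<psi> = \<phi>"
proof
  fix t
  show "\<psi> t = \<phi> t"
    using schrod_orbit_norm[OF schrod_orbit_diff[OF assms(1,2)], of t 0] assms(3) by simp
qed

lemma unitary_evol_eq:
  assumes "schrod_orbit a \<omega> \<psi>"
  shows "unitary_evol a \<omega> t (coord (\<psi> 0)) = coord (\<psi> t)"
proof -
  have "(THE f. schrod_sol a \<omega> (coord (\<psi> 0)) f) = (\<lambda>t. coord (\<psi> t))"
  proof (rule the_equality)
    show "schrod_sol a \<omega> (coord (\<psi> 0)) (\<lambda>t. coord (\<psi> t))"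
      using assms by (simp add: schrod_sol_iff_orbit)
    fix f assume f_sol: "schrod_sol a \<omega> (coord (\<psi> 0)) f"
    then have "in_l2 (f t)" for t by (simp add: schrod_sol_def jdom_def)
    then have f_eq: "f = (\<lambda>t. coord (Abs_ell2 (f t)))" by simp
    have "(\<lambda>t. Abs_ell2 (f t)) = \<psi>"
      using f_sol
      by (subst (asm) f_eq) (auto simp: schrod_sol_iff_orbit intro!: schrod_orbit_unique assms)
    then show "f = (\<lambda>t. coord (\<psi> t))" using f_eq by metis
  qed
  then show ?thesis by (simp add: unitary_evol_def)
qed

lemma schrod_orbit_inner_deriv_dom:
  assumes "schrod_orbit a \<omega> \<psi>" "w \<in> D"
  shows "((\<lambda>t. w \<bullet> \<psi> t) has_real_derivative cscale \<i> (J w) \<bullet> \<psi> t) (at t)"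
  using schrod_orbit_inner_deriv[OF assms(1), of w t]
    inner_i_jop_eq[OF assms(2) schrod_orbitD(1)[OF assms(1)]]
  by simp

end

subsection \<open>Bounded potentials\<close>

locale bounded_jacobi_operator = jacobi_operator +
  assumes \<omega>_bounded: "bounded (range \<omega>)"
begin

lemma jdomain_UNIV: "x \<in> D" and bounded_linear_jop: "bounded_linear J"
proof -
  obtain W where W_bound: "\<And>n. \<bar>\<omega> n\<bar> \<le> W" using \<omega>_bounded by (auto simp: bounded_iff)
  note diag_l2 = in_l2_diag_op_if_bounded[OF W_bound]
  have "x \<in> D" for x
    by (rule jopI[of _ _ _ "hop x + diag_op \<omega> x"])
      (simp add: coord_hop coord_diag_op[OF diag_l2] jacobi_def)
  moreover have "norm (J x) \<le> norm x * (2 * \<alpha> + W)" for x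
    using norm_triangle_ineq[of "hop x" "diag_op \<omega> x"] norm_hop_le[of x]
      norm_diag_op_le[of \<omega> W x] W_bound jop_eq_hop_plus_diag_op(2)[OF \<open>x \<in> D\<close>]
    by (simp add: algebra_simps)
  ultimately show "x \<in> D" "bounded_linear J"
    by (auto intro!: bounded_linear_intro[where K="2 * \<alpha> + W"] simp: jop_linear)
qed

lemma bounded_linear_generator: "bounded_linear (generator a \<omega>)"
  by (intro bounded_linear_compose[OF _ bounded_linear_jop]
      bounded_bilinear.bounded_linear_right[OF bounded_bilinear_cscale])

lemma schrod_orbit_exp_orbit: "schrod_orbit a \<omega> (\<lambda>t. exp_orbit (generator a \<omega>) t x)"
  using exp_orbit_has_vector_derivative[OF bounded_linear_generator]
  by (simp only: simp_thms schrod_orbit_def jdomain_UNIV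
      exp_orbit_commute[OF bounded_linear_generator bounded_linear_generator refl])

lemma norm_exp_orbit: "norm (exp_orbit (generator a \<omega>) t x) = norm x"
  using schrod_orbit_norm[OF schrod_orbit_exp_orbit, of t x 0]
  by (simp only: exp_orbit_0[OF bounded_linear_generator])

lemma jop_exp_orbit:
  "J (exp_orbit (generator a \<omega>) t x) = exp_orbit (generator a \<omega>) t (J x)"
  by (rule exp_orbit_commute[OF bounded_linear_generator bounded_linear_jop])
    (simp add: jop_linear jdomain_UNIV jdomain_closed)

end

subsection \<open>Truncated potentials\<close>

definition trunc :: "nat \<Rightarrow> (int \<Rightarrow> real) \<Rightarrow> int \<Rightarrow> real" where
  "trunc N \<omega> m = (if \<bar>m\<bar> \<le> int N then \<omega> m else 0)"

definition trunc_evol :: "(int \<Rightarrow> real) \<Rightarrow> (int \<Rightarrow> real) \<Rightarrow> nat \<Rightarrow> real \<Rightarrow> ell2 \<Rightarrow> ell2" where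
  "trunc_evol a \<omega> N = exp_orbit (generator a (trunc N \<omega>))"

lemma bounded_range_trunc: "bounded (range (trunc N \<omega>))"
proof -
  have "range (trunc N \<omega>) \<subseteq> insert 0 (\<omega> ` {- int N..int N})"
    by (auto simp: trunc_def image_iff abs_le_iff)
  then show ?thesis by (rule bounded_subset[rotated]) (simp add: finite_imp_bounded)
qed

lemma eventually_trunc_eq: "\<forall>\<^sub>F N in sequentially. trunc N \<omega> m = \<omega> m"
  using eventually_ge_at_top[of "nat \<bar>m\<bar>"] by eventually_elim (auto simp: trunc_def)

context jacobi_operator
begin

interpretation trunc: bounded_jacobi_operator a "trunc N \<omega>" \<alpha> for N
  by unfold_locales (rule bounded_range_trunc)

lemma norm_trunc_evol: "norm (trunc_evol a \<omega> N t x) = norm x"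
  unfolding trunc_evol_def by (rule trunc.norm_exp_orbit)

lemma trunc_evol_0: "trunc_evol a \<omega> N 0 x = x"
  unfolding trunc_evol_def by (rule exp_orbit_0[OF trunc.bounded_linear_generator])

lemma jop_trunc_evol:
  "jop a (trunc N \<omega>) (trunc_evol a \<omega> N t x) = trunc_evol a \<omega> N t (jop a (trunc N \<omega>) x)"
  unfolding trunc_evol_def by (rule trunc.jop_exp_orbit)

lemma jop_trunc_evol_basis:
  "jop a (trunc N \<omega>) (trunc_evol a \<omega> N t (basis n)) = a n *\<^sub>R trunc_evol a \<omega> N t (basis (n + 1))
     + a (n - 1) *\<^sub>R trunc_evol a \<omega> N t (basis (n - 1))
     + trunc N \<omega> n *\<^sub>R trunc_evol a \<omega> N t (basis n)"
  unfolding jop_trunc_evol jop_basis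
  by (simp only: trunc_evol_def exp_orbit_add[OF trunc.bounded_linear_generator]
      exp_orbit_scaleR[OF trunc.bounded_linear_generator])

lemma eventually_jop_trunc_jop_trunc_basis:
  "\<forall>\<^sub>F N in sequentially. jop a (trunc N \<omega>) (jop a (trunc N \<omega>) (basis n)) = J (J (basis n))"
proof -
  have "\<forall>\<^sub>F N in sequentially.
      trunc N \<omega> (n - 1) = \<omega> (n - 1) \<and> trunc N \<omega> n = \<omega> n \<and> trunc N \<omega> (n + 1) = \<omega> (n + 1)"
    by (intro eventually_conj eventually_trunc_eq)
  then show ?thesis
    by eventually_elim (simp add: jop_basis jop_linear jdomain_closed jdomain_basis)
qed

lemma eventually_trunc_evol_Taylor:
  "\<forall>\<^sub>F N in sequentially. norm (trunc_evol a \<omega> N (t + h) (basis n) - trunc_evol a \<omega> N t (basis n)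
      - h *\<^sub>R generator a (trunc N \<omega>) (trunc_evol a \<omega> N t (basis n))) \<le> norm (J (J (basis n))) * h\<^sup>2"
  using eventually_jop_trunc_jop_trunc_basis[of n]
proof eventually_elim
  case (elim N)
  let ?A = "generator a (trunc N \<omega>)"
  note bounded_generator = trunc.bounded_linear_generator[of N]
  have "norm (exp_orbit ?A t (?A (?A (basis n)))) \<le> norm (J (J (basis n)))" for t
    unfolding trunc.norm_exp_orbit
    by (simp add: jop_linear jdomain_closed trunc.jdomain_UNIV elim)
  from vector_Taylor2_bound[OF exp_orbit_has_vector_derivative[OF bounded_generator]
      exp_orbit_has_vector_derivative[OF bounded_generator] this]
  show ?case
    unfolding trunc_evol_def exp_orbit_commute[OF bounded_generator bounded_generator refl] .
qed

text \<open>The second-order Taylor bound does not depend on the truncation and survives weak limits, so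
  weak limit points of the truncated evolutions solve the Schroedinger equation.\<close>

lemma trunc_evol_weak_limit:
  assumes G_cluster: "G \<noteq> bot" "G \<le> sequentially"
    and \<phi>_limit: "\<And>n t. weakly_tendsto (\<lambda>N. trunc_evol a \<omega> N t (basis n)) (\<phi> n t) G"
  shows "J (\<phi> n t) = a n *\<^sub>R \<phi> (n + 1) t + a (n - 1) *\<^sub>R \<phi> (n - 1) t + \<omega> n *\<^sub>R \<phi> n t"
    and "schrod_orbit a \<omega> (\<phi> n)" and "\<phi> n 0 = basis n"
proof -
  let ?J = "\<lambda>N. jop a (trunc N \<omega>)" and ?u = "\<lambda>N t. trunc_evol a \<omega> N t (basis n)"
  let ?\<psi> = "\<lambda>t. a n *\<^sub>R \<phi> (n + 1) t + a (n - 1) *\<^sub>R \<phi> (n - 1) t + \<omega> n *\<^sub>R \<phi> n t"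
  have trunc_limit: "((\<lambda>N. trunc N \<omega> m) \<longlongrightarrow> \<omega> m) G" for m
    using filter_leD[OF G_cluster(2) eventually_trunc_eq] by (rule tendsto_eventually)
  have J_limit: "weakly_tendsto (\<lambda>N. ?J N (?u N t)) (?\<psi> t) G" for t
    unfolding jop_trunc_evol_basis
    by (intro weakly_tendsto_add weakly_tendsto_scaleR \<phi>_limit tendsto_const trunc_limit)
  have "jacobi a \<omega> (coord (\<phi> n t)) m = coord (?\<psi> t) m" for t m
  proof (rule tendsto_unique[OF G_cluster(1) _ weakly_tendsto_coord[OF J_limit]])
    show "((\<lambda>N. coord (?J N (?u N t)) m) \<longlongrightarrow> jacobi a \<omega> (coord (\<phi> n t)) m) G"
      unfolding coord_jop[OF trunc.jdomain_UNIV] jacobi_def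
      by (intro tendsto_intros weakly_tendsto_coord[OF \<phi>_limit] trunc_limit)
  qed
  note jop_\<phi> = jopI[OF this]
  show "J (\<phi> n t) = ?\<psi> t" by (rule jop_\<phi>)
  have "norm (\<phi> n (t + h) - \<phi> n t - h *\<^sub>R cscale (- \<i>) (?\<psi> t)) \<le> norm (J (J (basis n))) * h\<^sup>2" for t h
    by (rule weakly_tendsto_norm_le[OF G_cluster(1) _ filter_leD[OF G_cluster(2)
          eventually_trunc_evol_Taylor[of t h]]])
      (intro weakly_tendsto_diff weakly_tendsto_scaleR weakly_tendsto_cscale \<phi>_limit J_limit
          tendsto_const)
  then have "(\<phi> n has_vector_derivative cscale (- \<i>) (?\<psi> t)) (at t)" for t
    by (rule has_vector_derivative_if_Taylor_bound)
  then show "schrod_orbit a \<omega> (\<phi> n)" by (simp only: schrod_orbit_def jop_\<phi> simp_thms)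
  have "weakly_tendsto (\<lambda>N. basis n) (basis n) G" by (simp add: weakly_tendsto_def)
  then show "\<phi> n 0 = basis n"
    using weakly_tendsto_unique[OF G_cluster(1) \<phi>_limit[of 0 n]] by (simp add: trunc_evol_0)
qed

definition evol :: "int \<Rightarrow> real \<Rightarrow> ell2" where
  "evol n t = Abs_ell2 (unitary_evol a \<omega> t (kdelta n))"

lemma evol_eq_orbit:
  assumes "schrod_orbit a \<omega> \<phi>" "\<phi> 0 = basis n"
  shows "evol n = \<phi>"
proof
  fix t
  show "evol n t = \<phi> t"
    using unitary_evol_eq[OF assms(1), of t] assms(2)
    by (simp add: evol_def coord_basis_eq_kdelta coord_inverse)
qed

lemma trunc_evol_weakly_convergent_subfilter:
  assumes "F \<noteq> bot" "F \<le> sequentially"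
  shows "\<exists>G\<le>F. G \<noteq> bot \<and> (\<forall>n t. weakly_tendsto (\<lambda>N. trunc_evol a \<omega> N t (basis n)) (evol n t) G)"
proof -
  let ?u = "\<lambda>N (n, t). trunc_evol a \<omega> N t (basis n)"
  have "norm (?u N p) \<le> 1" for N p by (simp add: norm_trunc_evol split: prod.split)
  with weakly_convergent_subfilter_family[OF assms(1), of ?u "\<lambda>_. 1"]
  obtain G y where G_refines: "G \<le> F" "G \<noteq> bot"
    and y_limit: "\<And>p. weakly_tendsto (\<lambda>N. ?u N p) (y p) G"
    by blast
  define \<phi> where "\<phi> n t = y (n, t)" for n t
  have \<phi>_limit: "weakly_tendsto (\<lambda>N. trunc_evol a \<omega> N t (basis n)) (\<phi> n t) G" for n t
    using y_limit[of "(n, t)"] by (simp add: \<phi>_def)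
  note \<phi>_orbit = trunc_evol_weak_limit[OF G_refines(2) order_trans[OF G_refines(1) assms(2)]
      \<phi>_limit]
  have "evol n = \<phi> n" for n by (rule evol_eq_orbit[OF \<phi>_orbit(2,3)])
  then show ?thesis using G_refines \<phi>_limit by auto
qed

lemma evol_orbit: "schrod_orbit a \<omega> (evol n)" and evol_0: "evol n 0 = basis n"
  and jop_evol: "J (evol n t) = a n *\<^sub>R evol (n + 1) t + a (n - 1) *\<^sub>R evol (n - 1) t
      + \<omega> n *\<^sub>R evol n t"
proof -
  obtain G where G_cluster: "G \<le> sequentially" "G \<noteq> bot"
    "\<And>n t. weakly_tendsto (\<lambda>N. trunc_evol a \<omega> N t (basis n)) (evol n t) G"
    using trunc_evol_weakly_convergent_subfilter[OF sequentially_bot order_refl] by blast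
  note evol_limit = trunc_evol_weak_limit[OF G_cluster(2,1,3)]
  show "schrod_orbit a \<omega> (evol n)" "evol n 0 = basis n"
    "J (evol n t) = a n *\<^sub>R evol (n + 1) t + a (n - 1) *\<^sub>R evol (n - 1) t + \<omega> n *\<^sub>R evol n t"
    by (rule evol_limit)+
qed

lemma norm_evol: "norm (evol n t) = 1"
  using schrod_orbit_norm[OF evol_orbit, of n t 0] by (simp add: evol_0)

lemma matrix_elem_eq: "matrix_elem a \<omega> m n t = coord (evol n t) m"
  using unitary_evol_eq[OF evol_orbit, of t n]
  by (simp add: matrix_elem_def evol_0 coord_basis_eq_kdelta)

lemma trunc_evol_tendsto: "(\<lambda>N. coord (trunc_evol a \<omega> N t (basis n)) m) \<longlonglongrightarrow> matrix_elem a \<omega> m n t"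
proof (rule tendsto_if_convergent_subfilters)
  fix F :: "nat filter" assume F_refines: "F \<le> sequentially" "F \<noteq> bot"
  obtain G where "G \<le> F" "G \<noteq> bot"
    "\<And>n t. weakly_tendsto (\<lambda>N. trunc_evol a \<omega> N t (basis n)) (evol n t) G"
    using trunc_evol_weakly_convergent_subfilter[OF F_refines(2,1)] by blast
  then show "\<exists>G\<le>F. G \<noteq> bot \<and> ((\<lambda>N. coord (trunc_evol a \<omega> N t (basis n)) m)
      \<longlongrightarrow> matrix_elem a \<omega> m n t) G"
    unfolding matrix_elem_eq using weakly_tendsto_coord by blast
qed

lemma matrix_elem_le_1: "cmod (matrix_elem a \<omega> m n t) \<le> 1"
  using norm_coord_le[of "evol n t" m] by (simp add: matrix_elem_eq norm_evol)

lemma matrix_elem_le_SUP: "cmod (matrix_elem a \<omega> m n t) \<le> (SUP t. cmod (matrix_elem a \<omega> m n t))"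
  by (rule cSUP_upper) (auto intro!: bdd_aboveI2 matrix_elem_le_1)

lemma SUP_matrix_elem_rational:
  "(SUP t. cmod (matrix_elem a \<omega> m n t)) = (SUP t\<in>\<rat>. cmod (matrix_elem a \<omega> m n t))"
proof (rule antisym)
  let ?f = "\<lambda>t. cmod (matrix_elem a \<omega> m n t)"
  have bounded_above: "bdd_above (?f ` A)" for A by (rule bdd_aboveI2[OF matrix_elem_le_1])
  have "continuous_on UNIV ?f"
    unfolding matrix_elem_eq
    by (intro continuous_intros bounded_linear.continuous_on[OF bounded_linear_coord]
        schrod_orbit_continuous[OF evol_orbit])
  then have "closed {t. ?f t \<le> (SUP t\<in>\<rat>. ?f t)}"
    by (intro closed_Collect_le continuous_on_const)
  moreover have "\<rat> \<subseteq> {t. ?f t \<le> (SUP t\<in>\<rat>. ?f t)}" using cSUP_upper[OF _ bounded_above] by blast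
  ultimately have "closure \<rat> \<subseteq> {t. ?f t \<le> (SUP t\<in>\<rat>. ?f t)}" by (rule closure_minimal[rotated])
  then show "(SUP t. ?f t) \<le> (SUP t\<in>\<rat>. ?f t)"
    unfolding Rats_closure_real by (intro cSUP_least) auto
  show "(SUP t\<in>\<rat>. ?f t) \<le> (SUP t. ?f t)"
    by (intro cSUP_subset_mono bounded_above) (auto intro: Rats_0)
qed

end

subsection \<open>Measurability in the potential\<close>

context
  fixes a :: "int \<Rightarrow> real" and \<alpha> :: real and M :: "(int \<Rightarrow> real) measure"
  assumes a_le: "\<And>n. \<bar>a n\<bar> \<le> \<alpha>" and coordinate_measurable: "\<And>m. (\<lambda>\<omega>. \<omega> m) \<in> borel_measurable M"
begin

interpretation jacobi_operator a \<omega> \<alpha> for \<omega>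
  by standard (rule a_le)

lemma trunc_evol_measurable: "(\<lambda>\<omega>. coord (trunc_evol a \<omega> N t (basis n)) m) \<in> borel_measurable M"
proof -
  let ?A = "\<lambda>\<omega>. generator a (trunc N \<omega>)"
  interpret trunc: bounded_jacobi_operator a "trunc N \<omega>" \<alpha> for \<omega>
    by unfold_locales (rule bounded_range_trunc)
  have trunc_measurable: "(\<lambda>\<omega>. complex_of_real (trunc N \<omega> m)) \<in> borel_measurable M" for m
  proof -
    have "(\<lambda>\<omega>. trunc N \<omega> m) \<in> borel_measurable M"
      using coordinate_measurable by (cases "\<bar>m\<bar> \<le> int N") (simp_all add: trunc_def)
    then show ?thesis
      by (rule measurable_compose) (intro borel_measurable_continuous_onI continuous_intros)
  qed
  have funpow_measurable: "(\<lambda>\<omega>. coord ((?A \<omega> ^^ k) (basis n)) m) \<in> borel_measurable M" for k m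
  proof (induction k arbitrary: m)
    case (Suc k)
    then show ?case
      unfolding funpow.simps o_def coord_cscale coord_jop[OF trunc.jdomain_UNIV] jacobi_def
      by (intro borel_measurable_add borel_measurable_times trunc_measurable borel_measurable_const)
  qed simp
  have "coord (trunc_evol a \<omega> N t (basis n)) m
      = (\<Sum>k. of_real (t ^ k / fact k) * coord ((?A \<omega> ^^ k) (basis n)) m)" for \<omega>
    using bounded_linear.sums[OF bounded_linear_coord
        exp_orbit_sums[OF trunc.bounded_linear_generator]]
    by (simp add: trunc_evol_def sums_unique)
  then show ?thesis
    by (simp only: borel_measurable_suminf borel_measurable_times borel_measurable_const
        funpow_measurable)
qed

lemma matrix_elem_measurable: "(\<lambda>\<omega>. matrix_elem a \<omega> m n t) \<in> borel_measurable M"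
  by (rule borel_measurable_LIMSEQ_metric[OF trunc_evol_measurable trunc_evol_tendsto])

lemma SUP_matrix_elem_measurable: "(\<lambda>\<omega>. SUP t. cmod (matrix_elem a \<omega> m n t)) \<in> borel_measurable M"
  unfolding SUP_matrix_elem_rational
proof (rule borel_measurable_cSUP[OF countable_rat])
  show "(\<lambda>\<omega>. cmod (matrix_elem a \<omega> m n t)) \<in> borel_measurable M" for t
    by (rule measurable_compose[OF matrix_elem_measurable borel_measurable_norm])
qed (rule bdd_aboveI2[OF matrix_elem_le_1])

end

section \<open>Decay of eigenfunctions\<close>

lemma int_two_step_induct:
  fixes k n :: int
  assumes "P k" "P (k + 1)"
    and up: "\<And>n. P n \<Longrightarrow> P (n + 1) \<Longrightarrow> P (n + 2)" and down: "\<And>n. P n \<Longrightarrow> P (n + 1) \<Longrightarrow> P (n - 1)"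
  shows "P n"
proof -
  have "P n \<and> P (n + 1)"
  proof (induction n rule: int_induct[of _ k])
    case (step1 i)
    then show ?case using up[of i] by (simp add: add.assoc)
  next
    case (step2 i)
    then show ?case using down[of i] by simp
  qed (use assms in simp)
  then show ?thesis ..
qed

lemma jacobi_solution_zero_if_consecutive_zero:
  assumes a_nonzero: "\<And>n. a n \<noteq> 0" and z_solves: "\<And>m. jacobi a \<omega> z m = E * z m" "z k = 0"
      "z (k + 1) = 0"
  shows "z m = 0"
proof (rule int_two_step_induct[of "\<lambda>m. z m = 0", OF z_solves(2,3)])
  fix m assume "z m = 0" "z (m + 1) = 0"
  then show "z (m + 2) = 0" "z (m - 1) = 0"
    using z_solves(1)[of "m + 1"] z_solves(1)[of m] a_nonzero
    by (simp_all add: jacobi_def add.assoc)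
qed

definition wronskian :: "(int \<Rightarrow> real) \<Rightarrow> (int \<Rightarrow> complex) \<Rightarrow> (int \<Rightarrow> complex) \<Rightarrow> int \<Rightarrow> complex" where
  "wronskian a u v m = of_real (a m) * (u m * v (m + 1) - u (m + 1) * v m)"

lemma wronskian_const:
  assumes "\<And>m. jacobi a \<omega> u m = E * u m" "\<And>m. jacobi a \<omega> v m = E * v m"
  shows "wronskian a u v m = wronskian a u v n"
proof -
  have wronskian_pred: "wronskian a u v m = wronskian a u v (m - 1)" for m
  proof -
    have "u m * jacobi a \<omega> v m - v m * jacobi a \<omega> u m = 0" by (simp add: assms)
    then show ?thesis by (simp add: wronskian_def jacobi_def algebra_simps)
  qed
  have "wronskian a u v m = wronskian a u v 0" for m
  proof (induction m rule: int_induct[of _ 0])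
    case (step1 i)
    then show ?case using wronskian_pred[of "i + 1"] by simp
  next
    case (step2 i)
    then show ?case using wronskian_pred[of i] by simp
  qed simp
  then show ?thesis by metis
qed

context jacobi_operator
begin

lemma summable_on_norm_wronskian: "(\<lambda>m. cmod (wronskian a (coord x) (coord y) m)) summable_on UNIV"
proof (rule summable_on_comparison_test)
  let ?b = "\<lambda>m. cmod (coord x m) * cmod (coord (shift_op 1 y) m)
      + cmod (coord (shift_op 1 x) m) * cmod (coord y m)"
  show "(\<lambda>m. \<alpha> * ?b m) summable_on UNIV"
    by (intro summable_on_cmult_right summable_on_add summable_on_norm_mult in_l2_coord)
  fix m
  have "cmod (coord x m * coord y (m + 1) - coord x (m + 1) * coord y m) \<le> ?b m"
    by (rule order_trans[OF norm_triangle_ineq4]) (simp add: norm_mult)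
  then show "cmod (wronskian a (coord x) (coord y) m) \<le> \<alpha> * ?b m"
    unfolding wronskian_def norm_mult norm_of_real using a_le[of m] by (intro mult_mono) auto
qed simp

lemma l2_solutions_proportional:
  assumes a_nonzero: "\<And>n. a n \<noteq> 0" and x_solves: "\<And>m. jacobi a \<omega> (coord x) m = E * coord x m"
    and y_solves: "\<And>m. jacobi a \<omega> (coord y) m = E * coord y m"
  shows "coord y k * coord x m = coord x k * coord y m"
proof -
  have "(\<lambda>m::int. cmod (wronskian a (coord x) (coord y) k)) summable_on UNIV"
    using summable_on_norm_wronskian[of x y]
    by (subst (asm) wronskian_const[OF x_solves y_solves, of _ k])
  then have "wronskian a (coord x) (coord y) k = 0"
    using infsum_diverge_constant[OF infinite_UNIV_int,
        of "cmod (wronskian a (coord x) (coord y) k)"] by fastforce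
  then have wronskian_zero: "coord x k * coord y (k + 1) = coord x (k + 1) * coord y k"
    using a_nonzero by (simp add: wronskian_def)
  define z where "z m = coord y k * coord x m - coord x k * coord y m" for m
  have "jacobi a \<omega> z m = coord y k * jacobi a \<omega> (coord x) m - coord x k * jacobi a \<omega> (coord y) m"
    for m
    by (simp add: z_def jacobi_def algebra_simps)
  then have "jacobi a \<omega> z m = E * z m" for m by (simp add: x_solves y_solves z_def algebra_simps)
  moreover have "z k = 0" "z (k + 1) = 0"
    using wronskian_zero by (simp_all add: z_def algebra_simps)
  ultimately have "z m = 0" by (rule jacobi_solution_zero_if_consecutive_zero[OF a_nonzero])
  then show ?thesis by (simp add: z_def)
qed

lemma l2_solution_multiple:
  assumes "\<And>n. a n \<noteq> 0" "\<And>m. jacobi a \<omega> (coord x) m = E * coord x m"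
    and "\<And>m. jacobi a \<omega> (coord y) m = E * coord y m" and "y \<noteq> 0"
  obtains r where "\<And>m. coord x m = r * coord y m"
proof -
  obtain k where "coord y k \<noteq> 0" using \<open>y \<noteq> 0\<close> by (metis coord_ell2(1) ell2_eqI)
  then have "coord x m = coord x k / coord y k * coord y m" for m
    using l2_solutions_proportional[OF assms(1-3), of k m] by (simp add: field_simps)
  then show ?thesis by (rule that)
qed

lemma time_avg_inner_jop_tendsto_0:
  assumes "schrod_orbit a \<omega> g" "w \<in> D"
  shows "(time_avg (\<lambda>t. J w \<bullet> g t) \<longlongrightarrow> 0) at_top"
proof (rule time_avg_derivative_tendsto_0)
  show "((\<lambda>t. cscale (- \<i>) w \<bullet> g t) has_vector_derivative J w \<bullet> g t) (at t)" for t
    using schrod_orbit_inner_deriv_dom[OF assms(1), of "cscale (- \<i>) w" t] assms(2)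
    by (simp add: jop_linear jdomain_closed has_real_derivative_iff_has_vector_derivative)
  show "norm (cscale (- \<i>) w \<bullet> g t) \<le> norm w * norm (g 0)" for t
    using Cauchy_Schwarz_ineq2[of "cscale (- \<i>) w" "g t"] schrod_orbit_norm[OF assms(1), of t 0]
    by simp
qed

lemma kernel_component_const:
  assumes "schrod_orbit a \<omega> g" "x \<in> D" "J x = 0"
  shows "x \<bullet> g t = x \<bullet> g 0"
proof -
  have "((\<lambda>t. x \<bullet> g t) has_real_derivative 0) (at t)" for t
    using schrod_orbit_inner_deriv_dom[OF assms(1,2), of t] assms(3) by simp
  from DERIV_isconst_all[of "\<lambda>t. x \<bullet> g t"] this show ?thesis by blast
qed

text \<open>The mean ergodic theorem: the limit is the projection of \<open>g 0\<close> onto the kernel of \<open>J\<close>.\<close>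

lemma ergodic_mean:
  assumes g_orbit: "schrod_orbit a \<omega> g" and \<beta>_bound: "\<And>t m. cmod (coord (g t) m) \<le> \<beta> m"
  obtains v where "\<And>m. cmod (coord v m) \<le> \<beta> m" "v \<in> D" "J v = 0"
    "\<And>x. x \<in> D \<Longrightarrow> J x = 0 \<Longrightarrow> x \<bullet> v = x \<bullet> g 0"
proof -
  note g_continuous = schrod_orbit_continuous[OF g_orbit]
  have norm_avg_le: "norm (time_avg g T) \<le> norm (g 0)" for T
    by (rule norm_time_avg_le[OF g_continuous eq_refl[OF schrod_orbit_norm[OF g_orbit]]])
  obtain G v where G_cluster: "G \<le> at_top" "G \<noteq> bot" and v_limit: "weakly_tendsto (time_avg g) v G"
    by (rule weakly_convergent_subfilter[OF trivial_limit_at_top_linorder norm_avg_le])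
  have inner_limit: "((\<lambda>T. time_avg (\<lambda>t. w \<bullet> g t) T) \<longlongrightarrow> w \<bullet> v) G" for w
    using weakly_tendsto_inner[OF v_limit]
    by (simp add: time_avg_linear[OF bounded_linear_inner_right g_continuous])
  have "J w \<bullet> v = 0" if "w \<in> D" for w
    by (rule tendsto_unique[OF G_cluster(2) inner_limit tendsto_mono[OF G_cluster(1)
        time_avg_inner_jop_tendsto_0[OF g_orbit that]]])
  then have v_kernel: "v \<in> D" "norm (J v) \<le> 0"
    using jdomain_if_adjoint_bound[of 0 a \<omega> v] by simp_all
  have "cmod (coord v m) \<le> \<beta> m" for m
  proof (rule tendsto_upperbound[OF tendsto_norm[OF weakly_tendsto_coord[OF v_limit]]
      always_eventually G_cluster(2)])
    have "norm (time_avg (\<lambda>t. coord (g t) m) T) \<le> \<beta> m" for T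
      by (intro norm_time_avg_le bounded_linear.continuous_on[OF bounded_linear_coord] g_continuous
          \<beta>_bound)
    then show "\<forall>T. cmod (coord (time_avg g T) m) \<le> \<beta> m"
      by (simp add: time_avg_linear[OF bounded_linear_coord g_continuous])
  qed
  moreover have "x \<bullet> v = x \<bullet> g 0" if "x \<in> D" "J x = 0" for x
  proof (rule tendsto_unique[OF G_cluster(2) inner_limit])
    have avg_const: "time_avg (\<lambda>t. x \<bullet> g t) = time_avg (\<lambda>_. x \<bullet> g 0)"
      by (intro arg_cong[of _ _ time_avg] ext kernel_component_const[OF g_orbit that])
    have "\<forall>\<^sub>F T in at_top. time_avg (\<lambda>t. x \<bullet> g t) T = x \<bullet> g 0"
      using eventually_gt_at_top[of 0] unfolding avg_const by eventually_elim (rule time_avg_const)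
    then show "((\<lambda>T. time_avg (\<lambda>t. x \<bullet> g t) T) \<longlongrightarrow> x \<bullet> g 0) G"
      using filter_leD[OF G_cluster(1)] by (intro tendsto_eventually) blast
  qed
  ultimately show ?thesis using that v_kernel by auto
qed

lemma schrod_orbit_energy_shift:
  assumes "schrod_orbit a \<omega> \<psi>"
  shows "schrod_orbit a (\<lambda>m. \<omega> m - e) (\<lambda>t. cscale (cis (e * t)) (\<psi> t))"
proof -
  let ?g = "\<lambda>t. cscale (cis (e * t)) (\<psi> t)"
  have "(?g has_vector_derivative generator a (\<lambda>m. \<omega> m - e) (?g t)) (at t)"
    and "?g t \<in> jdomain a (\<lambda>m. \<omega> m - e)" for t
  proof -
    note \<psi>_orbit = schrod_orbitD[OF assms, of t]
    note shifted = jop_energy_shift[OF \<psi>_orbit(1), of e]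
    show "?g t \<in> jdomain a (\<lambda>m. \<omega> m - e)" by (intro jdomain_closed shifted)
    have "((\<lambda>t. cis (e * t)) has_vector_derivative e *\<^sub>R (\<i> * cis (e * t))) (at t)"
      unfolding has_vector_derivative_def by (auto intro!: derivative_eq_intros simp: mult.commute)
    from bounded_bilinear.has_vector_derivative[OF bounded_bilinear_cscale this \<psi>_orbit(2)]
    show "(?g has_vector_derivative generator a (\<lambda>m. \<omega> m - e) (?g t)) (at t)"
      unfolding jop_linear(4)[OF shifted(1)] shifted(2)
      by (rule has_vector_derivative_eq_rhs)
        (rule ell2_eqI, simp add: scaleR_conv_of_real algebra_simps)
  qed
  then show ?thesis by (simp add: schrod_orbit_def)
qed

end

definition eigenvectors :: "(int \<Rightarrow> real) \<Rightarrow> (int \<Rightarrow> real) \<Rightarrow> ell2 set" where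
  "eigenvectors a \<omega> = {x. eigenfunction a \<omega> (coord x)}"

lemma mem_eigenvectors_iff:
  "x \<in> eigenvectors a \<omega> \<longleftrightarrow> x \<noteq> 0 \<and> x \<in> jdomain a \<omega> \<and> (\<exists>E. jop a \<omega> x = cscale E x)"
proof -
  have "coord x = (\<lambda>_. 0) \<longleftrightarrow> x = 0" by (metis coord_ell2(1) ell2_eqI)
  moreover have "x \<in> jdomain a \<omega> \<and> jop a \<omega> x = cscale E x \<longleftrightarrow>
      jacobi a \<omega> (coord x) = (\<lambda>m. E * coord x m)" for E
  proof
    assume "x \<in> jdomain a \<omega> \<and> jop a \<omega> x = cscale E x"
    then show "jacobi a \<omega> (coord x) = (\<lambda>m. E * coord x m)"
      by (metis coord_jop coord_cscale)
  next
    assume "jacobi a \<omega> (coord x) = (\<lambda>m. E * coord x m)"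
    then show "x \<in> jdomain a \<omega> \<and> jop a \<omega> x = cscale E x"
      using jopI[of a \<omega> x "cscale E x"] by simp
  qed
  ultimately show ?thesis unfolding eigenvectors_def eigenfunction_def using in_l2_coord by auto
qed

context jacobi_operator
begin

lemma eigenvalue_real:
  assumes "x \<in> eigenvectors a \<omega>"
  obtains e where "J x = e *\<^sub>R x"
proof -
  obtain E where x_eigen: "x \<noteq> 0" "x \<in> D" "J x = cscale E x"
    using assms by (auto simp: mem_eigenvectors_iff)
  have "Im E * (norm x)\<^sup>2 = cscale \<i> x \<bullet> J x"
    using inner_cscale_self[of x "- \<i> * E"] by (simp add: x_eigen(3) inner_cscale)
  then have "E = of_real (Re E)"
    using inner_i_jop_zero[OF x_eigen(2)] x_eigen(1) by (simp add: complex_eq_iff)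
  then have "J x = Re E *\<^sub>R x" using x_eigen(3) by (metis cscale_of_real)
  then show ?thesis by (rule that)
qed

lemma energy_component:
  assumes g_orbit: "schrod_orbit a \<omega> g" and \<beta>_bound: "\<And>t m. cmod (coord (g t) m) \<le> \<beta> m"
  obtains v where "\<And>m. cmod (coord v m) \<le> \<beta> m" "v \<in> D" "J v = e *\<^sub>R v"
    "\<And>x. x \<in> D \<Longrightarrow> J x = e *\<^sub>R x \<Longrightarrow> x \<bullet> v = x \<bullet> g 0"
proof -
  interpret shifted: jacobi_operator a "\<lambda>m. \<omega> m - e" \<alpha> by standard (rule a_le)
  have "cmod (coord (cscale (cis (e * t)) (g t)) m) \<le> \<beta> m" for t m
    using \<beta>_bound by (simp add: norm_mult)
  from shifted.ergodic_mean[OF schrod_orbit_energy_shift[OF g_orbit] this]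
  obtain v where v_kernel: "\<And>m. cmod (coord v m) \<le> \<beta> m" "v \<in> shifted.D" "shifted.J v = 0"
    and v_inner: "\<And>x. x \<in> shifted.D \<Longrightarrow> shifted.J x = 0 \<Longrightarrow> x \<bullet> v = x \<bullet> cscale (cis (e * 0)) (g 0)"
    by blast
  have "jacobi a \<omega> (coord v) m = coord (e *\<^sub>R v) m" for m
    using coord_jop[OF v_kernel(2), of m] by (simp add: v_kernel(3) jacobi_def algebra_simps)
  note v_eigen = jopI[OF this]
  have "x \<bullet> v = x \<bullet> g 0" if "x \<in> D" "J x = e *\<^sub>R x" for x
    using v_inner[of x] jop_energy_shift[OF that(1), of e] that(2) by (simp add: cis_zero)
  then show ?thesis using that v_kernel(1) v_eigen by blast
qed

lemma eigenfunction_dominated: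
  assumes a_nonzero: "\<And>n. a n \<noteq> 0"
    and \<beta>_bound: "\<And>n t m. n \<in> {0, 1} \<Longrightarrow> cmod (coord (evol n t) m) \<le> \<beta> m"
    and u_eigen: "eigenfunction a \<omega> u"
  obtains K where "\<And>m. cmod (u m) \<le> K * \<beta> m"
proof -
  define x where "x = Abs_ell2 u"
  have coord_x: "coord x = u" using u_eigen by (simp add: x_def eigenfunction_def)
  have x_eigen: "x \<in> eigenvectors a \<omega>" using u_eigen by (simp add: eigenvectors_def coord_x)
  then have "x \<noteq> 0" "x \<in> D" by (simp_all add: mem_eigenvectors_iff)
  obtain e where x_energy: "J x = e *\<^sub>R x" by (rule eigenvalue_real[OF x_eigen])
  have solves: "jacobi a \<omega> (coord y) m = of_real e * coord y m" if "y \<in> D" "J y = e *\<^sub>R y" for y m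
    using coord_jop[OF that(1), of m] that(2) by simp
  obtain n where x_n_nonzero: "n \<in> {0, 1}" "coord x n \<noteq> 0"
    using jacobi_solution_zero_if_consecutive_zero[OF a_nonzero solves[OF \<open>x \<in> D\<close> x_energy], of 0]
      \<open>x \<noteq> 0\<close>
    by (metis add_0 coord_ell2(1) ell2_eqI insertCI)
  obtain v where v_component: "\<And>m. cmod (coord v m) \<le> \<beta> m" "v \<in> D" "J v = e *\<^sub>R v"
    and v_inner: "\<And>y. y \<in> D \<Longrightarrow> J y = e *\<^sub>R y \<Longrightarrow> y \<bullet> v = y \<bullet> evol n 0"
    using energy_component[OF evol_orbit \<beta>_bound[OF x_n_nonzero(1)], of e] by blast
  have "cscale (cnj (coord x n)) x \<bullet> v = cscale 1 (basis n) \<bullet> cscale (cnj (coord x n)) x"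
    using v_inner[of "cscale (cnj (coord x n)) x"] \<open>x \<in> D\<close>
    by (simp add: jdomain_closed jop_linear x_energy evol_0 inner_commute)
  also have "\<dots> = (cmod (coord x n))\<^sup>2"
    unfolding inner_cscale_basis cmod_power2 by (simp add: inner_complex_def power2_eq_square)
  finally have "v \<noteq> 0" using x_n_nonzero(2) by auto
  then obtain r where r_multiple: "\<And>m. coord x m = r * coord v m"
    using l2_solution_multiple[OF a_nonzero solves[OF \<open>x \<in> D\<close> x_energy]
        solves[OF v_component(2,3)]] by blast
  have "cmod (u m) \<le> cmod r * \<beta> m" for m
    unfolding coord_x[symmetric] r_multiple norm_mult
    by (rule mult_left_mono[OF v_component(1) norm_ge_zero])
  then show ?thesis by (rule that)
qed

end

section \<open>Pure point spectrum\<close>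

text \<open>For a unit vector \<open>v\<close> the orthogonal projection onto the complex line through \<open>v\<close>; the scalar is
  the complex inner product of \<open>v\<close> and \<open>x\<close>.\<close>

definition cproj :: "ell2 \<Rightarrow> ell2 \<Rightarrow> ell2" where
  "cproj v x = cscale (Complex (v \<bullet> x) (cscale \<i> v \<bullet> x)) v"

lemma inner_cproj: "w \<bullet> cproj v x = (v \<bullet> w) * (v \<bullet> x) + (cscale \<i> v \<bullet> w) * (cscale \<i> v \<bullet> x)"
  by (simp add: cproj_def cscale_eq_Re_Im[of "Complex _ _"] inner_add_right inner_commute
      mult.commute)

lemma cproj_cscale: "cproj v (cscale c x) = cscale c (cproj v x)"
proof -
  have "Complex (v \<bullet> cscale c x) (cscale \<i> v \<bullet> cscale c x) = c * Complex (v \<bullet> x) (cscale \<i> v \<bullet> x)"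
    by (simp add: cscale_eq_Re_Im[of c x] inner_add_right inner_cscale complex_eq_iff)
  then show ?thesis by (simp add: cproj_def)
qed

lemma cmod_complex_inner_le: "cmod (Complex (v \<bullet> x) (cscale \<i> v \<bullet> x)) \<le> 2 * norm v * norm x"
  using cmod_le[of "Complex (v \<bullet> x) (cscale \<i> v \<bullet> x)"] Cauchy_Schwarz_ineq2[of v x]
    Cauchy_Schwarz_ineq2[of "cscale \<i> v" x] by simp

lemma eigenvectors_orthogonal:
  assumes "y \<in> (eigenvectors a \<omega>)\<^sup>\<bottom>" "u \<in> jdomain a \<omega>" "jop a \<omega> u = cscale E u"
  shows "u \<bullet> y = 0"
proof (cases "u = 0")
  case False
  then have "u \<in> eigenvectors a \<omega>" using assms(2,3) mem_eigenvectors_iff by blast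
  then show ?thesis using assms(1) by (simp add: orthogonal_comp_def orthogonal_def)
qed simp

lemma orthogonal_comp_eigenvectorsI:
  assumes "\<And>u E. u \<in> jdomain a \<omega> \<Longrightarrow> jop a \<omega> u = cscale E u \<Longrightarrow> u \<bullet> y = 0"
  shows "y \<in> (eigenvectors a \<omega>)\<^sup>\<bottom>"
  unfolding orthogonal_comp_def orthogonal_def using assms mem_eigenvectors_iff by blast

lemma cscale_orthogonal_comp_eigenvectors:
  assumes "y \<in> (eigenvectors a \<omega>)\<^sup>\<bottom>"
  shows "cscale c y \<in> (eigenvectors a \<omega>)\<^sup>\<bottom>"
proof (rule orthogonal_comp_eigenvectorsI)
  fix u E assume "u \<in> jdomain a \<omega>" "jop a \<omega> u = cscale E u"
  then have "cscale (cnj c) u \<bullet> y = 0"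
    by (intro eigenvectors_orthogonal[OF assms, of _ E])
      (simp_all add: jdomain_closed jop_linear mult.commute)
  then show "u \<bullet> cscale c y = 0" by (simp add: inner_cscale)
qed

lemma (in jacobi_operator) jop_orthogonal_comp_eigenvectors:
  assumes "y \<in> (eigenvectors a \<omega>)\<^sup>\<bottom>" "y \<in> D"
  shows "J y \<in> (eigenvectors a \<omega>)\<^sup>\<bottom>"
proof (rule orthogonal_comp_eigenvectorsI)
  fix u E assume u_eigen: "u \<in> D" "J u = cscale E u"
  then have "cscale E u \<bullet> y = 0"
    by (intro eigenvectors_orthogonal[OF assms(1), of _ E])
      (simp_all add: jdomain_closed jop_linear)
  then show "u \<bullet> J y = 0" using jop_symmetric[OF u_eigen(1) assms(2)] u_eigen(2) by simp
qed

lemma pure_point_if_eigenvectors_total: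
  assumes "(eigenvectors a \<omega>)\<^sup>\<bottom> = {0}"
  shows "pure_point a \<omega>"
  unfolding pure_point_def
proof (intro allI impI)
  fix f and \<epsilon> :: real assume f_l2: "in_l2 f" and "0 < \<epsilon>"
  have "(span (eigenvectors a \<omega>))\<^sup>\<bottom> \<subseteq> {0}"
    using orthogonal_comp_anti_mono[OF span_superset] assms by blast
  then have "(span (eigenvectors a \<omega>))\<^sup>\<bottom> = {0}"
    using subspace_0[OF subspace_orthogonal_comp] by blast
  then have "Abs_ell2 f \<in> closure (span (eigenvectors a \<omega>))"
    by (simp add: subspace_dense_if_orthogonal_comp_trivial)
  then obtain w where "w \<in> span (eigenvectors a \<omega>)" and w_close: "norm (Abs_ell2 f - w) < \<epsilon>"
    using \<open>0 < \<epsilon>\<close> by (auto simp: closure_approachable dist_norm norm_minus_commute)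
  then obtain A r where w_combination: "finite A" "A \<subseteq> eigenvectors a \<omega>" "w = (\<Sum>v\<in>A. r v *\<^sub>R v)"
    by (auto simp: span_explicit)
  let ?coef = "\<lambda>u. complex_of_real (r (Abs_ell2 u))"
  have "inj_on coord A" by (simp add: inj_on_def coord_inject)
  then have "(\<lambda>m. f m - (\<Sum>u\<in>coord ` A. ?coef u * u m)) = coord (Abs_ell2 f - w)"
    using f_l2 by (auto simp: sum.reindex coord_inverse w_combination(3) coord_sum)
  then have "l2norm (\<lambda>m. f m - (\<Sum>u\<in>coord ` A. ?coef u * u m)) < \<epsilon>"
    using w_close by (simp add: norm_ell2_def)
  then show "\<exists>U coef. finite U \<and> (\<forall>u\<in>U. eigenfunction a \<omega> u) \<and>
       l2norm (\<lambda>m. f m - (\<Sum>u\<in>U. coef u * u m)) < \<epsilon>"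
    using w_combination(1,2)
    by (intro exI[of _ "coord ` A"] exI[of _ ?coef]) (auto simp: eigenvectors_def)
qed

subsection \<open>Localized orbits\<close>

locale localized_orbit = jacobi_operator +
  fixes \<phi> :: "real \<Rightarrow> ell2" and \<beta> :: "int \<Rightarrow> real" and C :: real
  assumes orbit: "schrod_orbit a \<omega> \<phi>" and norm_orbit: "\<And>t. norm (\<phi> t) = 1"
    and dominated: "\<And>t m. cmod (coord (\<phi> t) m) \<le> \<beta> m" and \<beta>_l2: "(\<lambda>m. (\<beta> m)\<^sup>2) summable_on UNIV"
    and norm_jop_orbit: "\<And>t. norm (J (\<phi> t)) \<le> C"
begin

lemma continuous_cproj_orbit: "continuous_on UNIV (\<lambda>t. cproj (\<phi> t) x)"
proof -
  note \<phi>_continuous = schrod_orbit_continuous[OF orbit]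
  have "continuous_on UNIV (\<lambda>t. cscale \<i> (\<phi> t))"
    by (intro bounded_bilinear.continuous_on[OF bounded_bilinear_cscale] continuous_intros
        \<phi>_continuous)
  then show ?thesis
    unfolding cproj_def complex_of_real_mult_Complex Complex_eq
    by (intro bounded_bilinear.continuous_on[OF bounded_bilinear_cscale] continuous_intros
        \<phi>_continuous)
qed

lemma cmod_complex_inner_orbit_le: "cmod (Complex (\<phi> t \<bullet> x) (cscale \<i> (\<phi> t) \<bullet> x)) \<le> 2 * norm x"
  using cmod_complex_inner_le[of "\<phi> t" x] by (simp add: norm_orbit)

lemma norm_cproj_orbit_le: "norm (cproj (\<phi> t) x) \<le> 2 * norm x"
  using cmod_complex_inner_orbit_le by (simp add: cproj_def norm_orbit)

lemma coord_cproj_orbit_le: "cmod (coord (cproj (\<phi> t) x) m) \<le> 2 * \<beta> m * norm x"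
  using mult_mono[OF cmod_complex_inner_orbit_le[of t x] dominated[of t m]]
  by (simp add: cproj_def norm_mult mult_ac)

lemma abs_inner_jop_cproj_orbit_le:
  assumes "w \<in> D"
  shows "\<bar>J w \<bullet> cproj (\<phi> t) x\<bar> \<le> 2 * C * norm x * norm w"
proof -
  let ?z = "Complex (\<phi> t \<bullet> x) (cscale \<i> (\<phi> t) \<bullet> x)"
  note \<phi>_dom = schrod_orbitD(1)[OF orbit, of t]
  have "J w \<bullet> cproj (\<phi> t) x = w \<bullet> cscale ?z (J (\<phi> t))"
    using jop_symmetric[OF assms jdomain_closed(4)[OF \<phi>_dom]]
    by (simp add: cproj_def jop_linear \<phi>_dom)
  also have "\<bar>\<dots>\<bar> \<le> norm w * (cmod ?z * norm (J (\<phi> t)))"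
    using Cauchy_Schwarz_ineq2[of w "cscale ?z (J (\<phi> t))"] by simp
  also have "\<dots> \<le> norm w * ((2 * norm x) * C)"
    by (intro mult_left_mono mult_mono cmod_complex_inner_orbit_le norm_jop_orbit) auto
  finally show ?thesis by (simp add: mult_ac)
qed

lemma cproj_orbit_deriv:
  assumes "w \<in> D" "x \<in> D"
  shows "((\<lambda>t. w \<bullet> cproj (\<phi> t) (cscale \<i> x)) has_real_derivative
      J w \<bullet> cproj (\<phi> t) x - w \<bullet> cproj (\<phi> t) (J x)) (at t)"
proof -
  have inner_deriv: "((\<lambda>t. \<phi> t \<bullet> v) has_real_derivative - (cscale \<i> (\<phi> t) \<bullet> J v)) (at t)"
    "((\<lambda>t. cscale \<i> (\<phi> t) \<bullet> v) has_real_derivative \<phi> t \<bullet> J v) (at t)" if "v \<in> D" for v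
    using schrod_orbit_inner_deriv_dom[OF orbit that, of t]
      schrod_orbit_inner_deriv_dom[OF orbit jdomain_closed(4)[OF that, of "- \<i>"], of t]
    by (simp_all add: inner_commute[of _ v] inner_commute[of _ "J v"] inner_cscale jop_linear
        jdomain_closed that)
  have "\<phi> t \<bullet> cscale \<i> x = - (cscale \<i> (\<phi> t) \<bullet> x)" "cscale \<i> (\<phi> t) \<bullet> cscale \<i> x = \<phi> t \<bullet> x" for t
    by (simp_all add: inner_cscale)
  then show ?thesis
    unfolding inner_cproj
    by (auto intro!: derivative_eq_intros inner_deriv assms simp: algebra_simps)
qed

lemma cproj_average_limit:
  "\<exists>G B. G \<le> at_top \<and> G \<noteq> bot \<and>
     (\<forall>x. weakly_tendsto (time_avg (\<lambda>t. cproj (\<phi> t) x)) (B x) G \<and> norm (B x) \<le> 2 * norm x)"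
proof -
  have "norm (time_avg (\<lambda>t. cproj (\<phi> t) x) T) \<le> 2 * norm x" for T x
    by (rule norm_time_avg_le[OF continuous_cproj_orbit norm_cproj_orbit_le])
  then show ?thesis by (rule weakly_convergent_subfilter_family[OF trivial_limit_at_top_linorder])
qed

lemma inner_orbit_recurrent:
  assumes "0 < c"
  shows "\<exists>F. finite F \<and> F \<subseteq> {0..} \<and> (\<forall>t. \<exists>\<sigma>\<in>F. \<bar>y \<bullet> \<phi> s\<bar> - c \<le> \<bar>y \<bullet> \<phi> (t + \<sigma>)\<bar>)"
proof -
  define e where "e = c / (norm y + 1)"
  have "0 < e" using assms norm_ge_zero[of y] by (simp add: e_def add_nonneg_pos)
  have "range \<phi> \<subseteq> {x. \<forall>m. cmod (coord x m) \<le> \<beta> m}" using dominated by auto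
  have "\<exists>F. finite F \<and> F \<subseteq> {0..} \<and> (\<forall>t. \<exists>\<sigma>\<in>F. dist (\<phi> s) (\<phi> (t + \<sigma>)) < e)"
    by (rule isometric_orbit_recurrent[OF schrod_orbit_isometric[OF orbit]
        compact_dominated[OF \<beta>_l2]]) fact+
  then obtain F where F_returns: "finite F" "F \<subseteq> {0..}" "\<forall>t. \<exists>\<sigma>\<in>F. dist (\<phi> s) (\<phi> (t + \<sigma>)) < e"
    by metis
  have "\<bar>y \<bullet> \<phi> s\<bar> - c \<le> \<bar>y \<bullet> \<phi> t\<bar>" if "dist (\<phi> s) (\<phi> t) < e" for t
  proof -
    have "\<bar>y \<bullet> (\<phi> s - \<phi> t)\<bar> \<le> norm y * norm (\<phi> s - \<phi> t)" by (rule Cauchy_Schwarz_ineq2)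
    also have "\<dots> \<le> (norm y + 1) * e" using that by (intro mult_mono) (auto simp: dist_norm)
    also have "\<dots> = c" using add_nonneg_pos[OF norm_ge_zero[of y] zero_less_one] by (simp add: e_def)
    finally show ?thesis unfolding inner_diff_right by linarith
  qed
  then have "\<exists>\<sigma>\<in>F. \<bar>y \<bullet> \<phi> s\<bar> - c \<le> \<bar>y \<bullet> \<phi> (t + \<sigma>)\<bar>" for t using spec[OF F_returns(3), of t] by blast
  then show ?thesis using F_returns(1,2) by metis
qed

end

locale orbit_average = localized_orbit +
  fixes G :: "real filter" and B :: "ell2 \<Rightarrow> ell2"
  assumes G_at_top: "G \<le> at_top" "G \<noteq> bot"
    and B_limit: "\<And>x. weakly_tendsto (time_avg (\<lambda>t. cproj (\<phi> t) x)) (B x) G"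
    and norm_B: "\<And>x. norm (B x) \<le> 2 * norm x"
begin

lemma inner_B_limit: "((\<lambda>T. time_avg (\<lambda>t. w \<bullet> cproj (\<phi> t) x) T) \<longlongrightarrow> w \<bullet> B x) G"
  using weakly_tendsto_inner[OF B_limit]
  by (simp add: time_avg_linear[OF bounded_linear_inner_right continuous_cproj_orbit])

lemma continuous_inner_cproj_orbit: "continuous_on UNIV (\<lambda>t. w \<bullet> cproj (\<phi> t) x)"
  by (intro continuous_intros continuous_cproj_orbit)

lemma B_symmetric: "w \<bullet> B x = B w \<bullet> x"
proof -
  have "w \<bullet> cproj v x = x \<bullet> cproj v w" for v by (simp add: inner_cproj mult.commute)
  then have "w \<bullet> B x = x \<bullet> B w"
    using tendsto_unique[OF G_at_top(2) inner_B_limit[of w x]] inner_B_limit[of x w] by simp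
  then show ?thesis by (simp add: inner_commute)
qed

lemma bounded_linear_B: "bounded_linear B"
proof -
  interpret linear B by (rule linear_if_symmetric[OF B_symmetric])
  show ?thesis
    by (rule bounded_linear_intro[where K=2]) (simp_all add: add scale norm_B mult.commute[of _ 2])
qed

lemma B_cscale: "B (cscale c x) = cscale c (B x)"
proof (rule weakly_tendsto_unique[OF G_at_top(2) B_limit])
  have "time_avg (\<lambda>t. cproj (\<phi> t) (cscale c x)) T = cscale c (time_avg (\<lambda>t. cproj (\<phi> t) x) T)" for T
    unfolding cproj_cscale
    by (intro time_avg_linear continuous_cproj_orbit
        bounded_bilinear.bounded_linear_right[OF bounded_bilinear_cscale])
  then show "weakly_tendsto (time_avg (\<lambda>t. cproj (\<phi> t) (cscale c x))) (cscale c (B x)) G"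
    using weakly_tendsto_cscale[OF B_limit] by presburger
qed

lemma coord_B_le: "cmod (coord (B x) m) \<le> 2 * \<beta> m * norm x"
proof (rule tendsto_upperbound[OF tendsto_norm[OF weakly_tendsto_coord[OF B_limit]]
    always_eventually G_at_top(2)])
  have "norm (time_avg (\<lambda>t. coord (cproj (\<phi> t) x) m) T) \<le> 2 * \<beta> m * norm x" for T
    by (intro norm_time_avg_le coord_cproj_orbit_le continuous_cproj_orbit
        bounded_linear.continuous_on[OF bounded_linear_coord])
  then show "\<forall>T. cmod (coord (time_avg (\<lambda>t. cproj (\<phi> t) x) T) m) \<le> 2 * \<beta> m * norm x"
    by (simp add: time_avg_linear[OF bounded_linear_coord continuous_cproj_orbit])
qed

lemma completely_continuous_B: "completely_continuous B"
  unfolding completely_continuous_def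
proof (intro conjI bounded_linear_B allI impI)
  fix F and y :: ell2 assume weak: "weakly_tendsto (\<lambda>x. x) y F" and ball: "\<forall>\<^sub>F x in F. norm x \<le> 1"
  show "(B \<longlongrightarrow> B y) F"
  proof (rule ell2_tendsto_if_dominated)
    have "weakly_tendsto B (B y) F"
      using weakly_tendsto_inner[OF weak] by (simp add: weakly_tendsto_def B_symmetric)
    then show "((\<lambda>x. coord (B x) m) \<longlongrightarrow> coord (B y) m) F" for m by (rule weakly_tendsto_coord)
    have \<beta>_nonneg: "0 \<le> \<beta> m" for m using order_trans[OF norm_ge_zero dominated] .
    show "\<forall>\<^sub>F x in F. \<forall>m. cmod (coord (B x) m) \<le> 2 * \<beta> m"
      using ball
    proof eventually_elim
      case (elim x)
      then show ?case
        using order_trans[OF coord_B_le mult_left_mono[OF elim]] \<beta>_nonneg by simp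
    qed
    show "(\<lambda>m. (2 * \<beta> m)\<^sup>2) summable_on UNIV"
      unfolding power_mult_distrib by (rule summable_on_cmult_right[OF \<beta>_l2])
  qed
qed

lemma B_dom: "B x \<in> D" and norm_jop_B: "norm (J (B x)) \<le> 2 * C * norm x"
proof -
  have "0 \<le> C" using order_trans[OF norm_ge_zero norm_jop_orbit] .
  moreover have "\<bar>J w \<bullet> B x\<bar> \<le> 2 * C * norm x * norm w" if "w \<in> D" for w
  proof (rule tendsto_upperbound[OF tendsto_rabs[OF inner_B_limit] always_eventually G_at_top(2)])
    show "\<forall>T. \<bar>time_avg (\<lambda>t. J w \<bullet> cproj (\<phi> t) x) T\<bar> \<le> 2 * C * norm x * norm w"
      using norm_time_avg_le[OF continuous_inner_cproj_orbit] abs_inner_jop_cproj_orbit_le[OF that]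
      by simp
  qed
  ultimately show "B x \<in> D" "norm (J (B x)) \<le> 2 * C * norm x"
    using jdomain_if_adjoint_bound[of "2 * C * norm x" a \<omega> "B x"] by auto
qed

lemma inner_jop_B:
  assumes "w \<in> D" "x \<in> D"
  shows "J w \<bullet> B x = w \<bullet> B (J x)"
proof -
  have inner_cproj_bound: "norm (w \<bullet> cproj (\<phi> t) (cscale \<i> x)) \<le> norm w * (2 * norm x)" for t
    using order_trans[OF Cauchy_Schwarz_ineq2 mult_left_mono[OF norm_cproj_orbit_le], of w t
        "cscale \<i> x"]
    by simp
  have "(time_avg (\<lambda>t. J w \<bullet> cproj (\<phi> t) x - w \<bullet> cproj (\<phi> t) (J x)) \<longlongrightarrow> 0) at_top"
    by (rule time_avg_derivative_tendsto_0[OF _ inner_cproj_bound])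
      (rule cproj_orbit_deriv[OF assms, unfolded has_real_derivative_iff_has_vector_derivative])
  moreover have "time_avg (\<lambda>t. J w \<bullet> cproj (\<phi> t) x - w \<bullet> cproj (\<phi> t) (J x))
      = (\<lambda>T. time_avg (\<lambda>t. J w \<bullet> cproj (\<phi> t) x) T - time_avg (\<lambda>t. w \<bullet> cproj (\<phi> t) (J x)) T)"
    by (rule ext) (rule time_avg_diff[OF continuous_inner_cproj_orbit continuous_inner_cproj_orbit])
  ultimately have "((\<lambda>T. time_avg (\<lambda>t. J w \<bullet> cproj (\<phi> t) x) T
      - time_avg (\<lambda>t. w \<bullet> cproj (\<phi> t) (J x)) T) \<longlongrightarrow> 0) G"
    using tendsto_mono[OF G_at_top(1)] by simp
  from tendsto_unique[OF G_at_top(2) this tendsto_diff[OF inner_B_limit inner_B_limit]] show ?thesis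
    by simp
qed

lemma jop_B_commute:
  assumes "x \<in> D"
  shows "J (B x) = B (J x)"
proof (rule ell2_eq_if_inner_cscale_basis_eq)
  fix c m
  have "cscale c (basis m) \<in> D" by (intro jdomain_closed jdomain_basis)
  then show "cscale c (basis m) \<bullet> J (B x) = cscale c (basis m) \<bullet> B (J x)"
    using inner_jop_B[OF _ assms] jop_symmetric[OF _ B_dom] by metis
qed

lemma bounded_linear_jop_B: "bounded_linear (\<lambda>x. J (B x))"
proof -
  interpret linear B by (rule linear_if_symmetric[OF B_symmetric])
  show ?thesis
    by (rule bounded_linear_intro[where K="2 * C"])
      (simp_all add: add scale jop_linear B_dom norm_jop_B mult.commute[of _ "2 * C"])
qed

lemma B_orthogonal_comp_eigenvectors:
  assumes "y \<in> (eigenvectors a \<omega>)\<^sup>\<bottom>"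
  shows "B y \<in> (eigenvectors a \<omega>)\<^sup>\<bottom>"
proof (rule orthogonal_comp_eigenvectorsI)
  fix u E assume "u \<in> D" "J u = cscale E u"
  then have "J (B u) = cscale E (B u)" by (simp add: jop_B_commute B_cscale)
  from eigenvectors_orthogonal[OF assms B_dom this] show "u \<bullet> B y = 0" by (simp add: B_symmetric)
qed

text \<open>A positive value would give a top eigenspace of the compact operator \<open>B\<close> orthogonal to all
  eigenvectors of \<open>J\<close>; it is invariant under \<open>J\<close> and has a compact unit sphere, so it contains an
  eigenvector of \<open>J\<close>.\<close>

lemma B_nonpos_on_orthogonal_comp_eigenvectors:
  assumes y_orthogonal: "y \<in> (eigenvectors a \<omega>)\<^sup>\<bottom>"
  shows "y \<bullet> B y \<le> 0"
proof (rule ccontr)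
  assume "\<not> y \<bullet> B y \<le> 0"
  then have "0 < y \<bullet> B y" by simp
  obtain z \<mu> where z_eigen: "0 < \<mu>" "z \<in> (eigenvectors a \<omega>)\<^sup>\<bottom>" "z \<noteq> 0" "B z = \<mu> *\<^sub>R z"
    by (rule completely_continuous_positive_eigenvector[OF completely_continuous_B B_symmetric
          B_orthogonal_comp_eigenvectors y_orthogonal \<open>0 < y \<bullet> B y\<close>])
  interpret B: bounded_linear B by (rule bounded_linear_B)
  define V where "V = {x \<in> (eigenvectors a \<omega>)\<^sup>\<bottom>. B x = \<mu> *\<^sub>R x}"
  have V_subspace: "subspace V"
    using subspace_orthogonal_comp[of "eigenvectors a \<omega>"]
    by (auto simp: V_def subspace_def B.zero B.add B.scaleR scaleR_add_right)
  have V_eq: "x = inverse \<mu> *\<^sub>R B x" if "x \<in> V" for x using that z_eigen(1) by (simp add: V_def)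
  have V_dom: "x \<in> D" if "x \<in> V" for x
    using V_eq[OF that] jdomain_closed(5)[OF B_dom] by metis
  have jop_V: "J x = inverse \<mu> *\<^sub>R J (B x)" if "x \<in> V" for x
    using V_eq[OF that] jop_linear(5)[OF B_dom] by metis
  have V_invariant: "J x \<in> V" if "x \<in> V" for x
    using that V_dom[OF that] jop_B_commute[OF V_dom[OF that]] jop_orthogonal_comp_eigenvectors
    by (simp add: V_def jop_linear)
  have sphere_compact: "compact {v \<in> V. norm v = 1}"
    using completely_continuous_eigensphere_compact[OF completely_continuous_B _
        closed_orthogonal_comp] z_eigen(1)
    by (simp add: V_def conj_assoc)
  have J_continuous: "continuous_on {v \<in> V. norm v = 1} J"
    using jop_V by (subst continuous_on_cong[OF refl, of _ _ "\<lambda>x. inverse \<mu> *\<^sub>R J (B x)"])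
      (auto intro!: continuous_intros bounded_linear.continuous_on[OF bounded_linear_jop_B])
  have "z \<in> V" using z_eigen by (simp add: V_def)
  then obtain x \<nu> where x_eigen: "x \<in> V" "x \<noteq> 0" "J x = \<nu> *\<^sub>R x"
    using eigenvector_if_compact_sphere[OF V_subspace V_invariant _ _ sphere_compact J_continuous _
        z_eigen(3)]
    by (metis V_dom jop_symmetric jop_linear(2,5) jdomain_closed(5))
  have "x \<bullet> x = 0"
    using x_eigen(1,3)
    by (intro eigenvectors_orthogonal[of _ a \<omega> _ "of_real \<nu>"] V_dom)
      (auto simp: V_def cscale_of_real)
  then show False using x_eigen(2) by simp
qed

text \<open>By recurrence of the orbit, the almost periodic function \<open>t \<mapsto> y \<bullet> \<phi> t\<close> vanishes if its quadratic
  mean does.\<close>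

lemma orthogonal_comp_eigenvectors_orthogonal_orbit:
  assumes y_orthogonal: "y \<in> (eigenvectors a \<omega>)\<^sup>\<bottom>"
  shows "y \<bullet> \<phi> s = 0"
proof (rule ccontr)
  assume "y \<bullet> \<phi> s \<noteq> 0"
  define c where "c = \<bar>y \<bullet> \<phi> s\<bar> / 2"
  have "0 < c" using \<open>y \<bullet> \<phi> s \<noteq> 0\<close> by (simp add: c_def)
  from inner_orbit_recurrent[OF this, of y s]
  obtain F where F_returns: "finite F" "F \<subseteq> {0..}" "\<forall>t. \<exists>\<sigma>\<in>F. \<bar>y \<bullet> \<phi> s\<bar> - c \<le> \<bar>y \<bullet> \<phi> (t + \<sigma>)\<bar>"
    by metis
  have square_le: "(y \<bullet> \<phi> t)\<^sup>2 \<le> y \<bullet> cproj (\<phi> t) y" for t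
    by (simp add: inner_cproj inner_commute power2_eq_square)
  have "\<exists>\<sigma>\<in>F. c\<^sup>2 \<le> y \<bullet> cproj (\<phi> (t + \<sigma>)) y" for t
  proof -
    obtain \<sigma> where "\<sigma> \<in> F" "\<bar>c\<bar> \<le> \<bar>y \<bullet> \<phi> (t + \<sigma>)\<bar>"
      using spec[OF F_returns(3), of t] by (auto simp: c_def)
    then show ?thesis
      using order_trans[OF _ square_le[of "t + \<sigma>"]] by (auto simp: abs_le_square_iff)
  qed
  moreover have "0 \<le> y \<bullet> cproj (\<phi> t) y" for t using order_trans[OF zero_le_power2 square_le] .
  moreover have "y \<bullet> cproj (\<phi> t) y \<le> norm y * (2 * norm y)" for t
    by (rule order_trans[OF norm_cauchy_schwarz mult_left_mono[OF norm_cproj_orbit_le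
        norm_ge_zero]])
  ultimately have "c\<^sup>2 \<le> real (card F) * (y \<bullet> B y)"
    by (intro recurrent_bound_le_time_avg_limit[OF continuous_inner_cproj_orbit _ _ F_returns(1,2) _
        G_at_top inner_B_limit])
  also have "\<dots> \<le> 0"
    using B_nonpos_on_orthogonal_comp_eigenvectors[OF y_orthogonal]
    by (simp add: mult_nonneg_nonpos)
  finally show False using \<open>0 < c\<close> by simp
qed

end

context jacobi_operator
begin

lemma orthogonal_comp_eigenvectors_orthogonal_evol:
  assumes \<beta>_bound: "\<And>t m. cmod (coord (evol n t) m) \<le> \<beta> m" and \<beta>_l2: "(\<lambda>m. (\<beta> m)\<^sup>2) summable_on UNIV"
    and y_orthogonal: "y \<in> (eigenvectors a \<omega>)\<^sup>\<bottom>"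
  shows "y \<bullet> evol n t = 0"
proof -
  interpret localized_orbit a \<omega> \<alpha> "evol n" \<beta> "\<bar>a n\<bar> + \<bar>a (n - 1)\<bar> + \<bar>\<omega> n\<bar>"
  proof
    show "norm (J (evol n t)) \<le> \<bar>a n\<bar> + \<bar>a (n - 1)\<bar> + \<bar>\<omega> n\<bar>" for t
      unfolding jop_evol by (intro norm_triangle_mono) (simp_all add: norm_evol)
  qed (use evol_orbit norm_evol \<beta>_bound \<beta>_l2 in auto)
  obtain G B where average_limit: "G \<le> at_top" "G \<noteq> bot"
    "\<And>x. weakly_tendsto (time_avg (\<lambda>t. cproj (evol n t) x)) (B x) G" "\<And>x. norm (B x) \<le> 2 * norm x"
    using cproj_average_limit by blast
  interpret orbit_average a \<omega> \<alpha> "evol n" \<beta> "\<bar>a n\<bar> + \<bar>a (n - 1)\<bar> + \<bar>\<omega> n\<bar>" G B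
    by unfold_locales (rule average_limit)+
  show ?thesis by (rule orthogonal_comp_eigenvectors_orthogonal_orbit[OF y_orthogonal])
qed

lemma orthogonal_evol_recurrence:
  assumes "\<And>y t. y \<in> (eigenvectors a \<omega>)\<^sup>\<bottom> \<Longrightarrow> y \<bullet> evol n t = 0"
    and y_orthogonal: "y \<in> (eigenvectors a \<omega>)\<^sup>\<bottom>"
  shows "a n * (y \<bullet> evol (n + 1) t) + a (n - 1) * (y \<bullet> evol (n - 1) t) = 0"
proof -
  have "((\<lambda>t. cscale (- \<i>) y \<bullet> evol n t) has_real_derivative y \<bullet> J (evol n t)) (at t)"
    using schrod_orbit_inner_deriv[OF evol_orbit, of "cscale (- \<i>) y" n t] by simp
  then have "((\<lambda>t. 0) has_real_derivative y \<bullet> J (evol n t)) (at t)"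
    using assms(1)[OF cscale_orthogonal_comp_eigenvectors[OF y_orthogonal]] by simp
  then have "y \<bullet> J (evol n t) = 0" using DERIV_unique[OF _ DERIV_const] by blast
  then show ?thesis using assms by (simp add: jop_evol inner_add_right)
qed

lemma pure_point_if_localized:
  assumes a_nonzero: "\<And>n. a n \<noteq> 0"
    and \<beta>_bound: "\<And>n t m. n \<in> {0, 1} \<Longrightarrow> cmod (coord (evol n t) m) \<le> \<beta> m"
    and \<beta>_l2: "(\<lambda>m. (\<beta> m)\<^sup>2) summable_on UNIV"
  shows "pure_point a \<omega>"
proof (rule pure_point_if_eigenvectors_total)
  let ?P = "\<lambda>n. \<forall>y\<in>(eigenvectors a \<omega>)\<^sup>\<bottom>. \<forall>t. y \<bullet> evol n t = 0"
  have orthogonal: "?P n" for n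
  proof (rule int_two_step_induct[of ?P 0])
    show "?P 0" "?P (0 + 1)"
      using orthogonal_comp_eigenvectors_orthogonal_evol[OF \<beta>_bound \<beta>_l2] by auto
    fix n assume P_consecutive: "?P n" "?P (n + 1)"
    show "?P (n + 2)"
      using orthogonal_evol_recurrence[of "n + 1"] P_consecutive a_nonzero[of "n + 1"]
      by (auto simp: add.assoc)
    show "?P (n - 1)"
      using orthogonal_evol_recurrence[of n] P_consecutive a_nonzero[of "n - 1"] by auto
  qed
  have "y = 0" if y_orthogonal: "y \<in> (eigenvectors a \<omega>)\<^sup>\<bottom>" for y
  proof (rule ell2_eq_if_inner_cscale_basis_eq)
    fix c m
    have "cscale (cnj c) y \<bullet> evol m 0 = 0"
      using orthogonal cscale_orthogonal_comp_eigenvectors[OF y_orthogonal] by blast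
    then show "cscale c (basis m) \<bullet> y = cscale c (basis m) \<bullet> 0"
      using inner_cscale[of "cnj c" y "basis m"] by (simp add: evol_0 inner_commute[of y])
  qed
  then show "(eigenvectors a \<omega>)\<^sup>\<bottom> = {0}" using subspace_0[OF subspace_orthogonal_comp] by blast
qed

end

section \<open>Almost sure localization\<close>

lemma summable_on_int_if_summable_nat:
  fixes f :: "nat \<Rightarrow> real"
  assumes "summable f" "\<And>k. 0 \<le> f k"
  shows "(\<lambda>m::int. f (nat \<bar>m\<bar>)) summable_on UNIV"
proof -
  have f_summable: "f summable_on UNIV" using assms by (simp add: summable_on_UNIV_nonneg_real_iff)
  have "(\<lambda>m::int. f (nat \<bar>m\<bar>)) summable_on range int"
      "(\<lambda>m::int. f (nat \<bar>m\<bar>)) summable_on range (\<lambda>k. - int k)"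
    using f_summable by (simp_all add: summable_on_reindex o_def inj_on_def)
  moreover have "range int \<union> range (\<lambda>k. - int k) = UNIV"
  proof -
    have "m \<in> range int \<union> range (\<lambda>k. - int k)" for m :: int by (cases m rule: int_cases2) auto
    then show ?thesis by blast
  qed
  ultimately show ?thesis using summable_on_union by metis
qed

lemma summable_on_inverse_one_plus_square:
  "(\<lambda>m::int. inverse (1 + (real_of_int m)\<^sup>2)) summable_on UNIV"
proof -
  have "summable (\<lambda>k. inverse (1 + (real k)\<^sup>2))"
  proof (rule summable_comparison_test_ev)
    show "summable (\<lambda>k. inverse (real k ^ 2))" by (rule inverse_power_summable) simp
    show "\<forall>\<^sub>F k in sequentially. norm (inverse (1 + (real k)\<^sup>2)) \<le> inverse (real k ^ 2)"
      using eventually_gt_at_top[of 0] by eventually_elim (simp add: le_imp_inverse_le)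
  qed
  from summable_on_int_if_summable_nat[OF this] show ?thesis by simp
qed

text \<open>The polynomial factor makes room for summing over all sites, at no cost in the exponential rate.\<close>

definition loc_bound :: "real \<Rightarrow> int \<Rightarrow> real" where
  "loc_bound \<gamma> m = (1 + (real_of_int m)\<^sup>2) * exp (- \<gamma> * \<bar>real_of_int m\<bar>)"

lemma loc_bound_pos: "0 < loc_bound \<gamma> m"
  by (simp add: loc_bound_def add_pos_nonneg)

lemma one_plus_square_le_exp:
  fixes c x :: real
  assumes "0 < c" "0 \<le> x"
  shows "1 + x\<^sup>2 \<le> (1 + 2 / c\<^sup>2) * exp (c * x)"
proof -
  have "1 + c * x + (c * x)\<^sup>2 / 2 \<le> exp (c * x)"
    using assms by (intro exp_lower_Taylor_quadratic) simp
  moreover have "0 \<le> c * x" using assms by simp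
  ultimately have "(c * x)\<^sup>2 / 2 \<le> exp (c * x)" "1 \<le> exp (c * x)" by auto
  then have "1 + 2 / c\<^sup>2 * ((c * x)\<^sup>2 / 2) \<le> exp (c * x) + 2 / c\<^sup>2 * exp (c * x)"
    by (intro add_mono mult_left_mono) auto
  then show ?thesis using assms by (simp add: power_mult_distrib distrib_right)
qed

lemma loc_bound_le_exp:
  assumes "0 < \<epsilon>"
  shows "loc_bound \<gamma> m \<le> (1 + 2 / \<epsilon>\<^sup>2) * exp (- (\<gamma> - \<epsilon>) * \<bar>real_of_int m\<bar>)"
proof -
  have "loc_bound \<gamma> m \<le> (1 + 2 / \<epsilon>\<^sup>2) * exp (\<epsilon> * \<bar>real_of_int m\<bar>) * exp (- \<gamma> * \<bar>real_of_int m\<bar>)"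
    unfolding loc_bound_def using one_plus_square_le_exp[OF assms, of "\<bar>real_of_int m\<bar>"]
    by (intro mult_right_mono) auto
  also have "\<dots> = (1 + 2 / \<epsilon>\<^sup>2) * exp (- (\<gamma> - \<epsilon>) * \<bar>real_of_int m\<bar>)"
    by (simp add: mult.assoc algebra_simps flip: exp_add)
  finally show ?thesis .
qed

lemma summable_on_loc_bound_square:
  assumes "0 < \<gamma>"
  shows "(\<lambda>m. (loc_bound \<gamma> m)\<^sup>2) summable_on UNIV"
proof (rule summable_on_comparison_test)
  define K where "K = (1 + 2 / (2 * \<gamma> / 3)\<^sup>2) ^ 3"
  show "(\<lambda>m. K * inverse (1 + (real_of_int m)\<^sup>2)) summable_on UNIV"
    by (intro summable_on_cmult_right summable_on_inverse_one_plus_square)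
  fix m :: int
  let ?x = "\<bar>real_of_int m\<bar>"
  have "(1 + ?x\<^sup>2) ^ 3 \<le> K * exp (2 * \<gamma> / 3 * ?x) ^ 3"
    unfolding K_def power_mult_distrib[symmetric]
    using assms by (intro power_mono one_plus_square_le_exp) auto
  also have "exp (2 * \<gamma> / 3 * ?x) ^ 3 = exp (2 * \<gamma> * ?x)" by (simp flip: exp_of_nat_mult)
  finally have "(1 + ?x\<^sup>2) ^ 3 * exp (- (2 * \<gamma> * ?x)) \<le> K"
    by (simp add: exp_minus divide_inverse[symmetric] pos_divide_le_eq)
  moreover have "(loc_bound \<gamma> m)\<^sup>2 * (1 + ?x\<^sup>2) = (1 + ?x\<^sup>2) ^ 3 * exp (- (2 * \<gamma> * ?x))"
    by (simp add: loc_bound_def power_mult_distrib power3_eq_cube power2_eq_square flip: exp_add)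
  ultimately show "(loc_bound \<gamma> m)\<^sup>2 \<le> K * inverse (1 + (real_of_int m)\<^sup>2)"
    by (simp add: divide_inverse[symmetric] pos_le_divide_eq add_pos_nonneg)
qed simp

lemma AE_bounded_if_integrals_summable:
  fixes f :: "'i::countable \<Rightarrow> 'a \<Rightarrow> real"
  assumes [measurable]: "\<And>i. f i \<in> borel_measurable M"
    and integral_le: "\<And>i. (\<integral>\<^sup>+ x. ennreal (f i x) \<partial>M) \<le> ennreal (w i)"
    and w_summable: "w summable_on UNIV" "\<And>i. 0 \<le> w i"
  shows "AE x in M. \<exists>K. \<forall>i. f i x \<le> K"
proof -
  let ?S = "\<lambda>x. \<integral>\<^sup>+ i. ennreal (f i x) \<partial>count_space UNIV"
  interpret sigma_finite_measure "count_space (UNIV :: 'i set)"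
    by (rule sigma_finite_measure_count_space)
  have "(\<lambda>p. ennreal (f (snd p) (fst p))) \<in> borel_measurable (M \<Otimes>\<^sub>M count_space UNIV)"
    by (rule measurable_compose_countable[where f="\<lambda>i p. ennreal (f i (fst p))" and g=snd])
      measurable
  then have [measurable]: "?S \<in> borel_measurable M"
    by (intro borel_measurable_nn_integral) (simp add: split_beta)
  have "(\<integral>\<^sup>+ x. ?S x \<partial>M) = (\<integral>\<^sup>+ i. \<integral>\<^sup>+ x. ennreal (f i x) \<partial>M \<partial>count_space UNIV)"
    by (rule nn_integral_count_space_nn_integral) auto
  also have "\<dots> \<le> (\<integral>\<^sup>+ i. ennreal (w i) \<partial>count_space UNIV)" by (intro nn_integral_mono integral_le)
  also have "\<dots> < \<infinity>"
    using w_summable nn_integral_conv_infsetsum[of w UNIV] by (simp flip: abs_summable_equivalent)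
  finally have "AE x in M. ?S x \<noteq> \<infinity>" by (intro nn_integral_PInf_AE) auto
  then show ?thesis
  proof eventually_elim
    case (elim x)
    define K where "K = enn2real (?S x)"
    have S_eq_K: "?S x = ennreal K" "0 \<le> K" using elim by (simp_all add: K_def less_top)
    have "f i x \<le> K" for i
      using nn_integral_ge_point[of i UNIV "\<lambda>i. ennreal (f i x)"] S_eq_K by simp
    then show ?case by blast
  qed
qed

lemma AE_matrix_elem_le_loc_bound:
  assumes a_le: "\<And>n. \<bar>a n\<bar> \<le> \<alpha>" and coordinate_measurable: "\<And>m. (\<lambda>\<omega>. \<omega> m) \<in> borel_measurable M"
    and "0 \<le> C"
    and decay: "\<And>m. (\<integral>\<^sup>+ \<omega>. ennreal (SUP t. cmod (matrix_elem a \<omega> m n t)) \<partial>M)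
      \<le> ennreal (C * exp (- \<gamma> * \<bar>real_of_int m\<bar>))"
  shows "AE \<omega> in M. \<exists>K. \<forall>t m. cmod (matrix_elem a \<omega> m n t) \<le> K * loc_bound \<gamma> m"
proof -
  let ?S = "\<lambda>m \<omega>. SUP t. cmod (matrix_elem a \<omega> m n t)"
  have S_measurable: "?S m \<in> borel_measurable M" for m
    by (rule SUP_matrix_elem_measurable[OF a_le coordinate_measurable])
  have "(\<integral>\<^sup>+ \<omega>. ennreal (?S m \<omega> / loc_bound \<gamma> m) \<partial>M) \<le> ennreal (C * inverse (1 + (real_of_int m)\<^sup>2))"
    for m
  proof -
    have "(\<integral>\<^sup>+ \<omega>. ennreal (?S m \<omega> / loc_bound \<gamma> m) \<partial>M)
        = ennreal (inverse (loc_bound \<gamma> m)) * (\<integral>\<^sup>+ \<omega>. ennreal (?S m \<omega>) \<partial>M)"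
      using loc_bound_pos[of \<gamma> m] S_measurable
      by (subst nn_integral_cmult[symmetric])
        (auto simp: divide_inverse mult.commute ennreal_mult'[symmetric])
    also have "\<dots> \<le> ennreal (inverse (loc_bound \<gamma> m)) * ennreal (C * exp (- \<gamma> * \<bar>real_of_int m\<bar>))"
      by (intro mult_left_mono decay) simp
    also have "\<dots> = ennreal (C * inverse (1 + (real_of_int m)\<^sup>2))"
      using loc_bound_pos[of \<gamma> m] \<open>0 \<le> C\<close>
      by (simp add: ennreal_mult[symmetric] loc_bound_def inverse_mult_distrib)
    finally show ?thesis .
  qed
  then have "AE \<omega> in M. \<exists>K. \<forall>m. ?S m \<omega> / loc_bound \<gamma> m \<le> K"
    using \<open>0 \<le> C\<close> S_measurable
    by (intro AE_bounded_if_integrals_summable[OF _ _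
        summable_on_cmult_right[OF summable_on_inverse_one_plus_square]])
      (auto simp: add_pos_nonneg)
  then show ?thesis
  proof eventually_elim
    case (elim \<omega>)
    interpret jacobi_operator a \<omega> \<alpha> by standard (rule a_le)
    from elim obtain K where "\<And>m. ?S m \<omega> / loc_bound \<gamma> m \<le> K" by blast
    then have "?S m \<omega> \<le> K * loc_bound \<gamma> m" for m by (simp add: pos_divide_le_eq loc_bound_pos)
    then show ?case using order_trans[OF matrix_elem_le_SUP] by blast
  qed
qed

lemma AE_matrix_elem_le_loc_bound_finite:
  assumes "finite S" and localized: "\<And>n. n \<in> S \<Longrightarrow>
      AE \<omega> in M. \<exists>K. \<forall>t m. cmod (matrix_elem a \<omega> m n t) \<le> K * loc_bound \<gamma> m"
  shows "AE \<omega> in M. \<exists>K. \<forall>n\<in>S. \<forall>t m. cmod (matrix_elem a \<omega> m n t) \<le> K * loc_bound \<gamma> m"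
proof -
  have "AE \<omega> in M. \<forall>n\<in>S. \<exists>K. \<forall>t m. cmod (matrix_elem a \<omega> m n t) \<le> K * loc_bound \<gamma> m"
    by (rule AE_finite_allI[OF assms])
  then show ?thesis
  proof eventually_elim
    case (elim \<omega>)
    then obtain K where K_bound:
      "\<And>n t m. n \<in> S \<Longrightarrow> cmod (matrix_elem a \<omega> m n t) \<le> K n * loc_bound \<gamma> m"
      by metis
    have "cmod (matrix_elem a \<omega> m n t) \<le> (\<Sum>n\<in>S. \<bar>K n\<bar>) * loc_bound \<gamma> m" if "n \<in> S" for n t m
    proof -
      have "K n \<le> (\<Sum>n\<in>S. \<bar>K n\<bar>)"
        using member_le_sum[OF that, of "\<lambda>n. \<bar>K n\<bar>"] \<open>finite S\<close> by simp
      then show ?thesis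
        using K_bound[OF that, of m t] mult_right_mono loc_bound_pos[of \<gamma> m]
        by (meson less_imp_le order_trans)
    qed
    then show ?case by blast
  qed
qed

lemma coordinate_measurable_mu: "(\<lambda>\<omega>. \<omega> m) \<in> borel_measurable (mu r d c)"
proof -
  let ?N = "\<lambda>n. density lborel (\<lambda>x. ennreal (scaled_density r (d n) (x - c n)))"
  have "(\<lambda>\<omega>. \<omega> m) \<in> measurable (Pi\<^sub>M UNIV ?N) (?N m)"
    by (rule measurable_component_singleton) simp
  also have "measurable (Pi\<^sub>M UNIV ?N) (?N m) = borel_measurable (mu r d c)"
    unfolding mu_def by (rule measurable_cong_sets) simp_all
  finally show ?thesis .
qed

lemma (in jacobi_operator) eigenfunction_exponential_decay:
  assumes a_nonzero: "\<And>n. a n \<noteq> 0"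
    and localized: "\<And>n t m. n \<in> {0, 1} \<Longrightarrow> cmod (coord (evol n t) m) \<le> K * loc_bound \<gamma> m"
    and u_eigen: "eigenfunction a \<omega> u" and "0 < \<epsilon>"
  shows "\<exists>L. \<forall>m. cmod (u m) \<le> L * exp (- (\<gamma> - \<epsilon>) * \<bar>real_of_int m\<bar>)"
proof -
  obtain L where L_bound: "\<And>m. cmod (u m) \<le> L * (K * loc_bound \<gamma> m)"
    using eigenfunction_dominated[OF a_nonzero localized u_eigen] by blast
  have "cmod (u m) \<le> \<bar>L * K\<bar> * (1 + 2 / \<epsilon>\<^sup>2) * exp (- (\<gamma> - \<epsilon>) * \<bar>real_of_int m\<bar>)" for m
  proof -
    have "cmod (u m) \<le> (L * K) * loc_bound \<gamma> m" using L_bound[of m] by (simp add: mult.assoc)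
    also have "\<dots> \<le> \<bar>L * K\<bar> * ((1 + 2 / \<epsilon>\<^sup>2) * exp (- (\<gamma> - \<epsilon>) * \<bar>real_of_int m\<bar>))"
      using loc_bound_pos[of \<gamma> m] by (intro mult_mono loc_bound_le_exp \<open>0 < \<epsilon>\<close>) auto
    finally show ?thesis by (simp add: mult.assoc)
  qed
  then show ?thesis by blast
qed

lemma (in jacobi_operator) pure_point_if_exponentially_localized:
  assumes a_nonzero: "\<And>n. a n \<noteq> 0"
    and localized: "\<And>n t m. n \<in> {0, 1} \<Longrightarrow> cmod (coord (evol n t) m) \<le> K * loc_bound \<gamma> m"
    and "0 < \<gamma>"
  shows "pure_point a \<omega>"
proof (rule pure_point_if_localized[OF a_nonzero localized])
  show "(\<lambda>m. (K * loc_bound \<gamma> m)\<^sup>2) summable_on UNIV"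
    unfolding power_mult_distrib
    by (intro summable_on_cmult_right summable_on_loc_bound_square \<open>0 < \<gamma>\<close>)
qed

theorem theorem2p4:
  fixes r :: "real \<Rightarrow> real" and d c a :: "int \<Rightarrow> real" and \<delta> C \<gamma> :: real
  assumes r_nonneg: "\<And>x. r x \<ge> 0"
    and r_bounded: "bounded (range r)"
    and r_meas: "r \<in> borel_measurable lborel"
    and r_supp: "\<exists>R. \<forall>x. \<bar>x\<bar> > R \<longrightarrow> r x = 0"
    and r_int: "(\<integral>\<^sup>+ x. ennreal (r x) \<partial>lborel) = 1"
    and d_pos: "\<And>n. d n > 0"
    and c_bounded: "bounded (range c)"
    and a_bounded: "bounded (range a)"
    and \<delta>_pos: "\<delta> > 0"
    and a_lower: "\<And>n. a n \<ge> \<delta>"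
    and C_pos: "C > 0" and \<gamma>_pos: "\<gamma> > 0"
    and decay: "\<And>m. max (a_corr r d c a m 0) (a_corr r d c a m 1)
                        \<le> ennreal (C * exp (- \<gamma> * \<bar>real_of_int m\<bar>))"
  shows "AE \<omega> in mu r d c.
           pure_point a \<omega> \<and>
           (\<forall>u. eigenfunction a \<omega> u \<longrightarrow>
              (\<forall>\<epsilon>. 0 < \<epsilon> \<and> \<epsilon> < \<gamma> \<longrightarrow>
                 (\<exists>K::real. \<forall>m. cmod (u m) \<le> K * exp (- (\<gamma> - \<epsilon>) * \<bar>real_of_int m\<bar>))))"
proof -
  obtain \<alpha> where a_le: "\<And>n. \<bar>a n\<bar> \<le> \<alpha>" using a_bounded by (auto simp: bounded_iff)
  have a_nonzero: "a n \<noteq> 0" for n using a_lower[of n] \<delta>_pos by auto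
  have "AE \<omega> in mu r d c. \<exists>K. \<forall>n\<in>{0, 1}. \<forall>t m.
      cmod (matrix_elem a \<omega> m n t) \<le> K * loc_bound \<gamma> m"
    using decay
    by (intro AE_matrix_elem_le_loc_bound_finite
        AE_matrix_elem_le_loc_bound[OF a_le coordinate_measurable_mu less_imp_le[OF C_pos]])
      (auto simp: a_corr_def)
  then show ?thesis
  proof eventually_elim
    case (elim \<omega>)
    interpret jacobi_operator a \<omega> \<alpha> by standard (rule a_le)
    from elim obtain K where
      "\<And>n t m. n \<in> {0, 1} \<Longrightarrow> cmod (coord (evol n t) m) \<le> K * loc_bound \<gamma> m"
      unfolding matrix_elem_eq by blast
    then show ?case
      using pure_point_if_exponentially_localized[OF a_nonzero _ \<gamma>_pos]
        eigenfunction_exponential_decay[OF a_nonzero] by blast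
  qed
qed

end
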